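(* Let $(S_k)_{k\in\mathbb{N}_0}$ be a (not necessarily monotone) sequence of positive random variables such that $N(t):=\sum_{k\ge 0}\mathbf{1}_{\{S_k\le t\}}<\infty$ almost surely for every $t\ge 0$. Let $\alpha>0$ and let $W_\alpha=(W_\alpha(u))_{u\ge0}$ be a centered Gaussian process which is a.s. locally Hölder continuous with exponent $\alpha$ and satisfies $W_\alpha(0)=0$ a.s. Let $h\in D$ be an eventually nondecreasing function which is of bounded variation on every compact interval $[0,T]$ and which is regularly varying at $\infty$ of index $\beta\ge 0$. If $\beta=0$, assume in addition that $\lim_{t\to\infty}h(t)=\infty$. Put $$X(t):=\sum_{k\ge 0}h(t-S_k)\mathbf{1}_{\{S_k\le t\}},\qquad t\ge0.$$ Let $a:[0,\infty)\to[0,\infty)$ be regularly varying at $\infty$ of positive index, let $b:[0,\infty)\to[0,\infty)$ be a nondecreasing right-continuous function, and assume that $$\Big(\frac{N(tu)-b(tu)}{a(t)}\Big)_{u\ge0}\Longrightarrow (W_\alpha(u))_{u\ge 0},\qquad t\to\infty,$$ weakly in $D$ endowed with the $J_1$-topology. Then $$\Big(\frac{X(tu)-\int_{[0,\,tu]}h(tu-y)\,\mathrm{d}b(y)}{a(t)h(t)}\Big)_{u\ge0}\Longrightarrow (Y_{\alpha,\beta}(u))_{u\ge0},\qquad t\to\infty,$$ weakly in $D$ endowed with the $J_1$-topology, where $Y_{\alpha,0}:=W_\alpha$ and, for $\beta>0$, $$Y_{\alpha,\beta}(u):=\beta\int_0^u(u-y)^{\beta-1}W_\alpha(y)\,\mathrm{d}y,\quad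 u>0,\qquad Y_{\alpha,\beta}(0):=\lim_{u\to+0}Y_{\alpha,\beta}(u)\ (=0 \text{ a.s.}).$$
   Context: $D=D[0,\infty)$ is the Skorokhod space of right-continuous real-valued functions on $[0,\infty)$ having finite left limits at each positive point. A process $W_\alpha$ is a.s. locally Hölder continuous with exponent $\alpha$ if for every $T>0$ there is an a.s. finite random variable $M_T$ such that $|W_\alpha(x)-W_\alpha(y)|\le M_T|x-y|^\alpha$ for all $0\le x,y\le T$. A function $h$ is regularly varying at $\infty$ of index $\beta$ if it is (measurable and) eventually positive and $\lim_{t\to\infty}h(tx)/h(t)=x^\beta$ for all $x>0$. "Eventually nondecreasing" means nondecreasing on $(t_0,\infty)$ for some $t_0>0$. The integral $\int_{[0,t]}h(t-y)\,\mathrm{d}b(y)$ is the Stieltjes integral over the closed interval, with respect to the measure on $[0,\infty)$ assigning mass $b(y)$ to $[0,y]$ (i.e. with the convention $b(y)=0$ for $y<0$). *)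

theory Defs
  imports "HOL-Probability.Probability"
begin

section \<open>The Skorokhod space with the J1 topology\<close>

text \<open>Only the values on the half-line \<^term>\<open>{0::real..}\<close> matter below.\<close>

definition cadlag :: "(real \<Rightarrow> real) \<Rightarrow> bool" where
  "cadlag x \<longleftrightarrow> (\<forall>t\<ge>0. continuous (at_right t) x) \<and> (\<forall>t>0. \<exists>l. (x \<longlongrightarrow> l) (at_left t))"

text \<open>Extensionality makes an element of the Skorokhod space determined by its values on the
  half-line.\<close>

definition skorokhod_space :: "(real \<Rightarrow> real) set" where
  "skorokhod_space = {x \<in> extensional {0..}. cadlag x}"

definition time_change :: "(real \<Rightarrow> real) \<Rightarrow> bool" where
  "time_change l \<longleftrightarrow> strict_mono_on {0..} l \<and> continuous_on {0..} l \<and> l ` {0..} = {0..}"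

text \<open>\<open>y\<close> is in the neighbourhood if for some time change \<open>l\<close> both the supremum of
  \<open>\<bar>l t - t\<bar>\<close> over the half-line and the supremum of \<open>\<bar>y (l t) - x t\<bar>\<close> over \<open>[0,T]\<close> are
  less than \<open>e\<close>. That the resulting topology is the usual J1 topology is the content of
  \<open>limitin_J1_sequentially\<close>: at each point the neighbourhoods with \<open>T = n\<close>, \<open>e = 1/n\<close> form a
  countable base, so the topology is determined by its convergent sequences.\<close>

definition J1_nbhd :: "(real \<Rightarrow> real) \<Rightarrow> real \<Rightarrow> real \<Rightarrow> (real \<Rightarrow> real) set" where
  "J1_nbhd x T e = {y \<in> skorokhod_space. \<exists>l. time_change l \<and> (\<exists>d<e.
     (\<forall>t\<ge>0. \<bar>l t - t\<bar> \<le> d) \<and> (\<forall>t\<in>{0..T}. \<bar>y (l t) - x t\<bar> \<le> d))}"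

definition J1_topology :: "(real \<Rightarrow> real) topology" where
  "J1_topology = topology (\<lambda>U. U \<subseteq> skorokhod_space \<and>
     (\<forall>x\<in>U. \<exists>T e. 0 < T \<and> 0 < e \<and> J1_nbhd x T e \<subseteq> U))"

lemma J1_nbhd_mono:
  assumes "T \<le> T'" "e' \<le> e"
  shows "J1_nbhd x T' e' \<subseteq> J1_nbhd x T e"
proof
  fix y assume "y \<in> J1_nbhd x T' e'"
  then obtain l d where "y \<in> skorokhod_space" "time_change l" "d < e'"
    "\<forall>t\<ge>0. \<bar>l t - t\<bar> \<le> d" "\<forall>t\<in>{0..T'}. \<bar>y (l t) - x t\<bar> \<le> d"
    unfolding J1_nbhd_def by blast
  moreover from this have "d < e" "\<forall>t\<in>{0..T}. \<bar>y (l t) - x t\<bar> \<le> d"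
    using assms by auto
  ultimately show "y \<in> J1_nbhd x T e"
    unfolding J1_nbhd_def by blast
qed

lemma openin_J1_topology:
  "openin J1_topology U \<longleftrightarrow> U \<subseteq> skorokhod_space \<and>
     (\<forall>x\<in>U. \<exists>T e. 0 < T \<and> 0 < e \<and> J1_nbhd x T e \<subseteq> U)"
proof -
  let ?L = "\<lambda>U. U \<subseteq> skorokhod_space \<and> (\<forall>x\<in>U. \<exists>T e. 0 < T \<and> 0 < e \<and> J1_nbhd x T e \<subseteq> U)"
  have int: "?L (U \<inter> V)" if U: "?L U" and V: "?L V" for U V
  proof (intro conjI ballI)
    show "U \<inter> V \<subseteq> skorokhod_space" using U by blast
    fix x assume x: "x \<in> U \<inter> V"
    obtain T e where 1: "0 < T" "0 < e" "J1_nbhd x T e \<subseteq> U" using x U by blast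
    obtain T' e' where 2: "0 < T'" "0 < e'" "J1_nbhd x T' e' \<subseteq> V" using x V by blast
    have "J1_nbhd x (max T T') (min e e') \<subseteq> U \<inter> V"
      using 1(3) 2(3) J1_nbhd_mono[of T "max T T'" "min e e'" e x]
        J1_nbhd_mono[of T' "max T T'" "min e e'" e' x] by auto
    moreover have "0 < max T T'" "0 < min e e'" using 1 2 by auto
    ultimately show "\<exists>T e. 0 < T \<and> 0 < e \<and> J1_nbhd x T e \<subseteq> U \<inter> V" by blast
  qed
  have un: "?L (\<Union>K)" if K: "\<forall>U\<in>K. ?L U" for K
  proof (intro conjI ballI)
    show "\<Union>K \<subseteq> skorokhod_space" using K by blast
    fix x assume "x \<in> \<Union>K"
    then obtain U where U: "U \<in> K" "x \<in> U" by blast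
    then obtain T e where "0 < T" "0 < e" "J1_nbhd x T e \<subseteq> U" using K by blast
    then show "\<exists>T e. 0 < T \<and> 0 < e \<and> J1_nbhd x T e \<subseteq> \<Union>K" using U by blast
  qed
  have "istopology ?L"
    unfolding istopology_def using int un by blast
  then show ?thesis
    unfolding J1_topology_def by (simp add: topology_inverse')
qed

lemma topspace_J1_topology [simp]: "topspace J1_topology = skorokhod_space"
proof -
  have "J1_nbhd x 1 1 \<subseteq> skorokhod_space" for x
    unfolding J1_nbhd_def by blast
  then have "openin J1_topology skorokhod_space"
    unfolding openin_J1_topology by (meson subset_refl zero_less_one)
  then show ?thesis
    by (metis openin_J1_topology openin_subset openin_topspace subset_antisym)
qed

lemma time_change_id: "time_change (\<lambda>t. t)"
  unfolding time_change_def by (simp add: strict_mono_on_def)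

lemma time_change_nonneg: "time_change l \<Longrightarrow> 0 \<le> t \<Longrightarrow> 0 \<le> l t"
  unfolding time_change_def by force

lemma time_change_compose:
  assumes "time_change k" "time_change l"
  shows "time_change (\<lambda>t. k (l t))"
proof -
  have "(\<lambda>t. k (l t)) ` {0..} = k ` (l ` {0..})" by (simp add: image_image)
  moreover have "continuous_on {0..} (\<lambda>t. k (l t))"
    using assms unfolding time_change_def
    by (intro continuous_on_compose2[of "{0..}" k "{0..}" l]) auto
  moreover have "strict_mono_on {0..} (\<lambda>t. k (l t))"
    using assms time_change_nonneg[OF assms(2)] unfolding time_change_def strict_mono_on_def
    by auto
  ultimately show ?thesis
    using assms unfolding time_change_def by simp
qed

lemma centre_in_J1_nbhd: "x \<in> skorokhod_space \<Longrightarrow> 0 < e \<Longrightarrow> x \<in> J1_nbhd x T e"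
  unfolding J1_nbhd_def using time_change_id by force

lemma openin_J1_nbhd: "openin J1_topology (J1_nbhd x T e)"
  unfolding openin_J1_topology
proof (intro conjI ballI)
  show "J1_nbhd x T e \<subseteq> skorokhod_space" unfolding J1_nbhd_def by blast
  fix y assume "y \<in> J1_nbhd x T e"
  then obtain l d where l: "time_change l" "d < e" "\<forall>t\<ge>0. \<bar>l t - t\<bar> \<le> d"
    "\<forall>t\<in>{0..T}. \<bar>y (l t) - x t\<bar> \<le> d"
    unfolding J1_nbhd_def by blast
  have d0: "0 \<le> d" using l(3) by (meson abs_ge_zero order_refl order_trans)
  have "J1_nbhd y (\<bar>T\<bar> + d + 1) (e - d) \<subseteq> J1_nbhd x T e"
  proof
    fix z assume "z \<in> J1_nbhd y (\<bar>T\<bar> + d + 1) (e - d)"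
    then obtain k c where k: "z \<in> skorokhod_space" "time_change k" "c < e - d"
      "\<forall>t\<ge>0. \<bar>k t - t\<bar> \<le> c" "\<forall>t\<in>{0..\<bar>T\<bar> + d + 1}. \<bar>z (k t) - y t\<bar> \<le> c"
      unfolding J1_nbhd_def by blast
    have "\<bar>k (l t) - t\<bar> \<le> c + d" if "0 \<le> t" for t
    proof -
      have "\<bar>k (l t) - l t\<bar> \<le> c" using k(4) time_change_nonneg[OF l(1) that] by blast
      moreover have "\<bar>l t - t\<bar> \<le> d" using l(3) that by blast
      ultimately show ?thesis by linarith
    qed
    moreover have "\<bar>z (k (l t)) - x t\<bar> \<le> c + d" if t: "t \<in> {0..T}" for t
    proof -
      have a: "\<bar>l t - t\<bar> \<le> d" "0 \<le> l t" using l(3) t time_change_nonneg[OF l(1)] by auto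
      then have "l t \<in> {0..\<bar>T\<bar> + d + 1}" using t by auto
      then have "\<bar>z (k (l t)) - y (l t)\<bar> \<le> c" using k(5) by blast
      moreover have "\<bar>y (l t) - x t\<bar> \<le> d" using l(4) t by blast
      ultimately show ?thesis by linarith
    qed
    moreover have "c + d < e" using k(3) by simp
    ultimately show "z \<in> J1_nbhd x T e"
      unfolding J1_nbhd_def using k(1) time_change_compose[OF k(2) l(1)] by blast
  qed
  moreover have "0 < \<bar>T\<bar> + d + 1" "0 < e - d" using d0 l(2) by auto
  ultimately show "\<exists>T' e'. 0 < T' \<and> 0 < e' \<and> J1_nbhd y T' e' \<subseteq> J1_nbhd x T e" by blast
qed

lemma limitin_J1_iff:
  "limitin J1_topology X x F \<longleftrightarrow>
     x \<in> skorokhod_space \<and> (\<forall>T>0. \<forall>e>0. \<forall>\<^sub>F n in F. X n \<in> J1_nbhd x T e)"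
  (is "?L \<longleftrightarrow> ?R")
proof
  assume ?L
  then show ?R
    unfolding limitin_def using openin_J1_nbhd centre_in_J1_nbhd by simp
next
  assume R: ?R
  show ?L
    unfolding limitin_def
  proof (intro conjI allI impI)
    show "x \<in> topspace J1_topology" using R by simp
    fix U assume "openin J1_topology U \<and> x \<in> U"
    then obtain T e where "0 < T" "0 < e" "J1_nbhd x T e \<subseteq> U"
      unfolding openin_J1_topology by blast
    moreover from this R have "\<forall>\<^sub>F n in F. X n \<in> J1_nbhd x T e" by blast
    ultimately show "\<forall>\<^sub>F n in F. X n \<in> U"
      by (auto elim: eventually_mono)
  qed
qed

lemma limitin_J1_sequentially:
  "limitin J1_topology X x sequentially \<longleftrightarrow>
     x \<in> skorokhod_space \<and> (\<forall>\<^sub>F n in sequentially. X n \<in> skorokhod_space) \<and>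
     (\<exists>l. (\<forall>n. time_change (l n)) \<and>
        uniform_limit {0..} l (\<lambda>t. t) sequentially \<and>
        (\<forall>T. uniform_limit {0..T} (\<lambda>n t. X n (l n t)) x sequentially))"
  (is "?L \<longleftrightarrow> ?R")
proof
  assume L: ?L
  define B where "B k = J1_nbhd x (real (Suc k)) (1 / real (Suc k))" for k
  have evB: "\<forall>\<^sub>F n in sequentially. X n \<in> B k" for k
    using L unfolding limitin_J1_iff B_def by simp
  have antiB: "B k \<subseteq> B j" if "j \<le> k" for j k
    unfolding B_def using that by (intro J1_nbhd_mono) (auto simp: field_simps)
  define m where "m n = Max (insert 0 {k. k \<le> n \<and> X n \<in> B k})" for n
  have m_ge: "k \<le> m n" if "k \<le> n" "X n \<in> B k" for k n
    unfolding m_def using that by (intro Max_ge) auto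
  have m_in: "X n \<in> B (m n)" if "X n \<in> B 0" for n
  proof -
    have "m n \<in> insert 0 {k. k \<le> n \<and> X n \<in> B k}"
      unfolding m_def by (intro Max_in) auto
    then show ?thesis using that by auto
  qed
  have "\<exists>l. time_change l \<and> (X n \<in> B 0 \<longrightarrow> (\<forall>t\<ge>0. \<bar>l t - t\<bar> < 1 / real (Suc (m n))) \<and>
      (\<forall>t\<in>{0..real (Suc (m n))}. \<bar>X n (l t) - x t\<bar> < 1 / real (Suc (m n))))" for n
  proof (cases "X n \<in> B 0")
    case True
    obtain l d where "time_change l" "d < 1 / real (Suc (m n))" "\<forall>t\<ge>0. \<bar>l t - t\<bar> \<le> d"
      "\<forall>t\<in>{0..real (Suc (m n))}. \<bar>X n (l t) - x t\<bar> \<le> d"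
      using m_in[OF True] unfolding B_def J1_nbhd_def by blast
    then show ?thesis by (meson order.strict_trans1)
  next
    case False
    then show ?thesis using time_change_id by blast
  qed
  then obtain l where l: "\<And>n. time_change (l n)"
    and l1: "\<And>n t. X n \<in> B 0 \<Longrightarrow> 0 \<le> t \<Longrightarrow> \<bar>l n t - t\<bar> < 1 / real (Suc (m n))"
    and l2: "\<And>n t. X n \<in> B 0 \<Longrightarrow> t \<in> {0..real (Suc (m n))} \<Longrightarrow>
      \<bar>X n (l n t) - x t\<bar> < 1 / real (Suc (m n))"
    by metis
  have ev: "\<forall>\<^sub>F n in sequentially. X n \<in> B 0 \<and> k \<le> m n" for k
    using evB[of k] evB[of 0] eventually_ge_at_top[of k]
  proof eventually_elim
    case (elim n)
    then show ?case using m_ge[of k n] by simp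
  qed
  have small: "1 / real (Suc j) < e" if "k \<le> j" "1 / real (Suc k) < e" for j k e
  proof -
    have "1 / real (Suc j) \<le> 1 / real (Suc k)" using that(1) by (simp add: field_simps)
    then show ?thesis using that(2) by linarith
  qed
  have u1: "uniform_limit {0..} l (\<lambda>t. t) sequentially"
    unfolding uniform_limit_iff
  proof (intro allI impI)
    fix e :: real assume "0 < e"
    then obtain k where k: "1 / real (Suc k) < e" by (metis nat_approx_posE)
    show "\<forall>\<^sub>F n in sequentially. \<forall>t\<in>{0..}. dist (l n t) t < e"
      using ev[of k]
    proof eventually_elim
      case (elim n)
      have "1 / real (Suc (m n)) < e" using small[OF _ k, of "m n"] elim by simp
      then show ?case using l1[of n] elim by (auto simp: dist_real_def intro: less_trans)
    qed
  qed
  have u2: "uniform_limit {0..T} (\<lambda>n t. X n (l n t)) x sequentially" for T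
    unfolding uniform_limit_iff
  proof (intro allI impI)
    fix e :: real assume "0 < e"
    then obtain k where k: "1 / real (Suc k) < e" by (metis nat_approx_posE)
    obtain j where j: "T \<le> real j" using real_arch_simple by blast
    show "\<forall>\<^sub>F n in sequentially. \<forall>t\<in>{0..T}. dist (X n (l n t)) (x t) < e"
      using ev[of k] ev[of j]
    proof eventually_elim
      case (elim n)
      show ?case
      proof
        fix t assume t: "t \<in> {0..T}"
        then have "t \<in> {0..real (Suc (m n))}" using elim j by auto
        then have "\<bar>X n (l n t) - x t\<bar> < 1 / real (Suc (m n))" using l2 elim by blast
        then show "dist (X n (l n t)) (x t) < e"
          using small[OF _ k, of "m n"] elim by (simp add: dist_real_def)
      qed
    qed
  qed
  have "\<forall>\<^sub>F n in sequentially. X n \<in> skorokhod_space"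
    using evB[of 0] by eventually_elim (auto simp: B_def J1_nbhd_def)
  moreover have "x \<in> skorokhod_space" using L unfolding limitin_J1_iff by blast
  ultimately show ?R using l u1 u2 by blast
next
  assume R: ?R
  then obtain l where l: "\<And>n. time_change (l n)"
    "uniform_limit {0..} l (\<lambda>t. t) sequentially"
    "\<And>T. uniform_limit {0..T} (\<lambda>n t. X n (l n t)) x sequentially" by blast
  have "\<forall>\<^sub>F n in sequentially. X n \<in> J1_nbhd x T e" if "0 < e" for T e
  proof -
    have e: "0 < e / 2" using that by simp
    have "\<forall>\<^sub>F n in sequentially. X n \<in> skorokhod_space" using R by blast
    with l(2)[unfolded uniform_limit_iff, rule_format, OF e]
      l(3)[of T, unfolded uniform_limit_iff, rule_format, OF e]
    show ?thesis
    proof eventually_elim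
      case (elim n)
      have "\<forall>t\<ge>0. \<bar>l n t - t\<bar> \<le> e / 2" "\<forall>t\<in>{0..T}. \<bar>X n (l n t) - x t\<bar> \<le> e / 2"
        using elim by (auto simp: dist_real_def less_imp_le)
      moreover have "e / 2 < e" using that by simp
      ultimately show ?case
        unfolding J1_nbhd_def using elim(3) l(1) by blast
    qed
  qed
  then show ?L unfolding limitin_J1_iff using R by blast
qed

section \<open>Weak convergence of random elements of a topological space\<close>

definition borel_of :: "'a topology \<Rightarrow> 'a measure" where
  "borel_of T = sigma (topspace T) {U. openin T U}"

text \<open>The processes of interest have their paths in the Skorokhod space only almost surely, so
  random elements are taken up to modification on a null set. Expectations are accordingly taken
  with respect to the completed measure: if \<open>X\<close> agrees almost everywhere with a random
  element in the strict sense, the integrand \<open>\<lambda>\<omega>. f (X \<omega>)\<close> is measurable with respect to the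
  completion for every continuous \<open>f\<close>, and the values of \<open>f\<close> outside the space are
  irrelevant.\<close>

definition random_element :: "'a measure \<Rightarrow> 'b topology \<Rightarrow> ('a \<Rightarrow> 'b) \<Rightarrow> bool" where
  "random_element M T X \<longleftrightarrow> (\<exists>X'. X' \<in> M \<rightarrow>\<^sub>M borel_of T \<and> (AE \<omega> in M. X \<omega> = X' \<omega>))"

definition converges_weakly ::
    "'b topology \<Rightarrow> 'a measure \<Rightarrow> ('i \<Rightarrow> 'a \<Rightarrow> 'b) \<Rightarrow> 'c measure \<Rightarrow> ('c \<Rightarrow> 'b) \<Rightarrow> 'i filter \<Rightarrow> bool" where
  "converges_weakly T M X M' Y F \<longleftrightarrow>
     (\<forall>\<^sub>F i in F. random_element M T (X i)) \<and> random_element M' T Y \<and>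
     (\<forall>f. continuous_map T euclideanreal f \<and> bounded (f ` topspace T) \<longrightarrow>
        ((\<lambda>i. \<integral>\<omega>. f (X i \<omega>) \<partial>completion M) \<longlongrightarrow> (\<integral>\<omega>. f (Y \<omega>) \<partial>completion M')) F)"

section \<open>Gaussian and H\<ouml>lder continuous processes indexed by the half-line\<close>

text \<open>Normal laws include the degenerate ones.\<close>

definition normal_rv :: "'a measure \<Rightarrow> ('a \<Rightarrow> real) \<Rightarrow> bool" where
  "normal_rv M X \<longleftrightarrow> X \<in> borel_measurable M \<and>
     (\<exists>m. (AE \<omega> in M. X \<omega> = m) \<or> (\<exists>s>0. distributed M lborel X (normal_density m s)))"

definition gaussian_process :: "'a measure \<Rightarrow> (real \<Rightarrow> 'a \<Rightarrow> real) \<Rightarrow> bool" where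
  "gaussian_process M W \<longleftrightarrow>
     (\<forall>I c. finite I \<and> I \<subseteq> {0..} \<longrightarrow> normal_rv M (\<lambda>\<omega>. \<Sum>u\<in>I. c u * W u \<omega>))"

definition centered_process :: "'a measure \<Rightarrow> (real \<Rightarrow> 'a \<Rightarrow> real) \<Rightarrow> bool" where
  "centered_process M W \<longleftrightarrow> (\<forall>u\<ge>0. integrable M (W u) \<and> (\<integral>\<omega>. W u \<omega> \<partial>M) = 0)"

definition locally_hoelder_AE :: "'a measure \<Rightarrow> real \<Rightarrow> (real \<Rightarrow> 'a \<Rightarrow> real) \<Rightarrow> bool" where
  "locally_hoelder_AE M \<alpha> W \<longleftrightarrow> (\<forall>T>0. \<exists>K\<in>borel_measurable M. AE \<omega> in M.
     \<forall>x\<in>{0..T}. \<forall>y\<in>{0..T}. \<bar>W x \<omega> - W y \<omega>\<bar> \<le> K \<omega> * \<bar>x - y\<bar> powr \<alpha>)"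

section \<open>Regular variation and bounded variation\<close>

definition regularly_varying :: "(real \<Rightarrow> real) \<Rightarrow> real \<Rightarrow> bool" where
  "regularly_varying h \<beta> \<longleftrightarrow>
     h \<in> borel_measurable (restrict_space borel {0..}) \<and>
     (\<forall>\<^sub>F t in at_top. 0 < h t) \<and>
     (\<forall>x>0. ((\<lambda>t. h (t * x) / h t) \<longlongrightarrow> x powr \<beta>) at_top)"

definition bounded_variation_on :: "real \<Rightarrow> real \<Rightarrow> (real \<Rightarrow> real) \<Rightarrow> bool" where
  "bounded_variation_on a b h \<longleftrightarrow> (\<exists>V. \<forall>n p. mono_on {..n::nat} p \<and> p ` {..n} \<subseteq> {a..b} \<longrightarrow>
     (\<Sum>i<n. \<bar>h (p (Suc i)) - h (p i)\<bar>) \<le> V)"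

definition eventually_nondecreasing :: "(real \<Rightarrow> real) \<Rightarrow> bool" where
  "eventually_nondecreasing h \<longleftrightarrow> (\<exists>t\<^sub>0>0. mono_on {t\<^sub>0<..} h)"

section \<open>Shot noise\<close>

definition counting :: "(nat \<Rightarrow> 'a \<Rightarrow> real) \<Rightarrow> real \<Rightarrow> 'a \<Rightarrow> ennreal" where
  "counting S t \<omega> = (\<Sum>k. indicator {..t} (S k \<omega>))"

text \<open>A finite sum for every \<open>\<omega>\<close> with \<open>counting S t \<omega> < \<infinity>\<close>.\<close>

definition shot_noise :: "(real \<Rightarrow> real) \<Rightarrow> (nat \<Rightarrow> 'a \<Rightarrow> real) \<Rightarrow> real \<Rightarrow> 'a \<Rightarrow> real" where
  "shot_noise h S t \<omega> = (\<Sum>k. h (t - S k \<omega>) * indicator {..t} (S k \<omega>))"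

text \<open>Extending \<open>b\<close> by zero to the negative half-line gives the point 0 the mass \<open>b 0\<close>.\<close>

definition stieltjes_measure :: "(real \<Rightarrow> real) \<Rightarrow> real measure" where
  "stieltjes_measure b = interval_measure (\<lambda>y. if y < 0 then 0 else b y)"

lemma emeasure_stieltjes_measure:
  assumes nonneg: "\<And>y. 0 \<le> y \<Longrightarrow> 0 \<le> b y" and mono: "mono_on {0..} b"
    and cont: "\<And>y. 0 \<le> y \<Longrightarrow> continuous (at_right y) b" and "0 \<le> y"
  shows "emeasure (stieltjes_measure b) {0..y} = ennreal (b y)"
    and "emeasure (stieltjes_measure b) {..<0} = 0"
proof -
  let ?F = "\<lambda>y. if y < 0 then 0 else b y"
  have F_mono: "?F x \<le> ?F y" if "x \<le> y" for x y
    using that nonneg mono_onD[OF mono] by auto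
  have F_cont: "continuous (at_right a) ?F" for a
  proof (cases "a < 0")
    case True
    then have "\<forall>\<^sub>F x in at_right a. ?F x = 0"
      unfolding eventually_at_right_field by (intro exI[of _ 0]) auto
    then show ?thesis
      unfolding continuous_within using True by (simp add: tendsto_eventually)
  next
    case False
    then have "\<forall>\<^sub>F x in at_right a. b x = ?F x"
      unfolding eventually_at_right_field by (intro exI[of _ "a + 1"]) auto
    with cont[of a] False show ?thesis
      unfolding continuous_within by (simp add: tendsto_cong)
  qed
  have Ioc: "emeasure (stieltjes_measure b) {a<..c} = ennreal (?F c - ?F a)" if "a \<le> c" for a c
    unfolding stieltjes_measure_def
    by (rule emeasure_interval_measure_Ioc[of a c ?F, OF that]) (use F_mono F_cont in blast)+
  have sets: "sets (stieltjes_measure b) = sets borel"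
    unfolding stieltjes_measure_def by simp
  have *: "{..<0::real} = (\<Union>n. {- real (Suc n)<..- inverse (real (Suc n))})"
  proof (intro equalityI subsetI)
    fix x :: real assume "x \<in> {..<0}"
    then obtain i where i: "inverse (real (Suc i)) < - x" using reals_Archimedean[of "-x"] by auto
    obtain j where j: "- x < real j" using reals_Archimedean2 by blast
    have "inverse (real (Suc (max i j))) \<le> inverse (real (Suc i))"
      by (intro le_imp_inverse_le) auto
    then have "x \<le> - inverse (real (Suc (max i j)))" using i by linarith
    moreover have "- real (Suc (max i j)) < x" using j by auto
    ultimately have "x \<in> {- real (Suc (max i j))<..- inverse (real (Suc (max i j)))}" by simp
    then show "x \<in> (\<Union>n. {- real (Suc n)<..- inverse (real (Suc n))})" by blast
  next
    fix x :: real assume "x \<in> (\<Union>n. {- real (Suc n)<..- inverse (real (Suc n))})"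
    then obtain n where "x \<le> - inverse (real (Suc n))" by auto
    moreover have "0 < inverse (real (Suc n))" by simp
    ultimately show "x \<in> {..<0}" unfolding lessThan_iff by linarith
  qed
  have null: "emeasure (stieltjes_measure b) {- real (Suc n)<..- inverse (real (Suc n))} = 0" for n
  proof -
    have "inverse (real (Suc n)) \<le> real (Suc n)"
      by (rule order_trans[of _ 1]) (auto simp: inverse_le_1_iff)
    moreover have "0 < inverse (real (Suc n))" by simp
    ultimately show ?thesis by (subst Ioc) auto
  qed
  show neg: "emeasure (stieltjes_measure b) {..<0} = 0"
    unfolding * by (intro emeasure_UN_eq_0 null) (auto simp: sets)
  have "emeasure (stieltjes_measure b) {-1<..<0} \<le> emeasure (stieltjes_measure b) {..<0}"
    by (intro emeasure_mono) (auto simp: sets)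
  then have z: "emeasure (stieltjes_measure b) {-1<..<0} = 0" using neg by simp
  have "emeasure (stieltjes_measure b) {-1<..y} =
      emeasure (stieltjes_measure b) {-1<..<0} + emeasure (stieltjes_measure b) {0..y}"
    using \<open>0 \<le> y\<close> by (subst plus_emeasure) (auto simp: sets intro!: arg_cong2[of _ _ _ _ emeasure])
  then show "emeasure (stieltjes_measure b) {0..y} = ennreal (b y)"
    using Ioc[of "-1" y] z \<open>0 \<le> y\<close> by simp
qed

definition stieltjes_convolution :: "(real \<Rightarrow> real) \<Rightarrow> (real \<Rightarrow> real) \<Rightarrow> real \<Rightarrow> real" where
  "stieltjes_convolution h b t = (LINT y:{0..t}|stieltjes_measure b. h (t - y))"

definition limit_integral :: "(real \<Rightarrow> 'a \<Rightarrow> real) \<Rightarrow> real \<Rightarrow> real \<Rightarrow> 'a \<Rightarrow> real" where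
  "limit_integral W \<beta> u \<omega> = \<beta> * (LINT y:{0..u}|lborel. (u - y) powr (\<beta> - 1) * W y \<omega>)"

definition limit_process :: "(real \<Rightarrow> 'a \<Rightarrow> real) \<Rightarrow> real \<Rightarrow> real \<Rightarrow> 'a \<Rightarrow> real" where
  "limit_process W \<beta> u \<omega> =
     (if \<beta> = 0 then W u \<omega>
      else if 0 < u then limit_integral W \<beta> u \<omega>
      else Lim (at_right 0) (\<lambda>v. limit_integral W \<beta> v \<omega>))"

end

theory Submission
  imports Defs
begin

text \<open>Integrating by parts, the normalised process is the convolution of
  \<open>V t u = (N (t u) - b (t u)) / a t\<close> with the signed measure \<open>d h (t y) / h t\<close>, whose total variation on
  compacts stays bounded (\<open>h\<close> is eventually monotone and tends to infinity) and which converges to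
  \<open>d (y powr \<beta>)\<close> by regular variation. As the limit of \<open>V t\<close> has continuous paths vanishing at 0, paths
  of \<open>V t\<close> close to a path \<open>x\<close> of the limit are uniformly close to it on compacts, and
  then the convolutions are uniformly close to the convolution of \<open>x\<close> with \<open>d (y powr \<beta>)\<close>. An extended
  continuous mapping theorem turns this deterministic statement into weak convergence.\<close>

section \<open>Weak convergence of nearby random elements\<close>

text \<open>The maps in question depend on \<open>t\<close>, act on paths with jumps, and live in a
  topology given by neighbourhoods instead of a metric. A pseudometric that is continuous for
  \<open>J1_topology\<close> stands in for a metric: it only has to detect uniform closeness near
  continuous paths. As \<open>h\<close> and the counting process may both jump, the signed measure
  \<open>d h\<close> is never built: integration by parts is stated as a limit of sums over refining
  grids, and these are estimated, uniformly in the refinement, against a coarse grid depending on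
  the limit path and the accuracy but not on \<open>t\<close>. Extending paths by 0 to negative
  arguments replaces integrals over \<open>[0, u]\<close> by integrals over a fixed
  \<open>[0, R)\<close>. For \<beta> = 0 the limit measure is the unit mass at 0, which the
  convention \<open>0 powr 0 = 0\<close> fits into the same formula. Weak convergence also demands
  that the processes be random elements; Borel measurability is derived from measurability at fixed
  times through step approximations with countably many values.\<close>

lemma space_borel_of [simp]: "space (borel_of T) = topspace T"
  unfolding borel_of_def by (intro space_measure_of) (auto dest: openin_subset)

lemma sets_borel_of: "sets (borel_of T) = sigma_sets (topspace T) {U. openin T U}"
  unfolding borel_of_def by (intro sets_measure_of) (auto dest: openin_subset)

lemma borel_measurable_continuous_map:
  assumes "continuous_map T euclideanreal f"
  shows "f \<in> borel_measurable (borel_of T)"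
proof (rule borel_measurableI)
  fix S :: "real set" assume "open S"
  then have "openin T {x \<in> topspace T. f x \<in> S}"
    using assms by (intro openin_continuous_map_preimage[of T euclideanreal]) auto
  then show "f -` S \<inter> space (borel_of T) \<in> sets (borel_of T)"
    unfolding sets_borel_of by (intro sigma_sets.Basic) (auto simp: vimage_def Int_def conj_commute)
qed

lemma borel_measurable_completion_AE:
  fixes f g :: "'a \<Rightarrow> real"
  assumes g: "g \<in> borel_measurable M" and eq: "AE \<omega> in M. f \<omega> = g \<omega>"
  shows "f \<in> borel_measurable (completion M)"
proof (rule borel_measurableI)
  fix S :: "real set" assume "open S"
  have ae: "AE \<omega> in completion M. \<omega> \<in> g -` S \<inter> space M \<longleftrightarrow> \<omega> \<in> f -` S \<inter> space M"
    using AE_completion[OF eq] by eventually_elim auto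
  have "g -` S \<inter> space M \<in> sets (completion M)"
    using g \<open>open S\<close> by (intro sets_completionI_sets measurable_sets[of g M borel]) auto
  from completion.in_sets_AE[OF ae this]
  show "f -` S \<inter> space (completion M) \<in> sets (completion M)" by simp
qed

text \<open>Every expectation in \<open>converges_weakly\<close> is moved through this to a Borel
  version on the uncompleted space, where the usual monotonicity and convergence theorems
  apply.\<close>

lemma integral_completion_AE:
  fixes f g :: "'a \<Rightarrow> real"
  assumes g: "g \<in> borel_measurable M" and eq: "AE \<omega> in M. f \<omega> = g \<omega>"
  shows "(\<integral>\<omega>. f \<omega> \<partial>completion M) = (\<integral>\<omega>. g \<omega> \<partial>M)"
proof -
  have "(\<integral>\<omega>. f \<omega> \<partial>completion M) = (\<integral>\<omega>. g \<omega> \<partial>completion M)"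
    using borel_measurable_completion_AE[OF assms] measurable_completion[OF g] AE_completion[OF eq]
    by (intro integral_cong_AE)
  also have "\<dots> = (\<integral>\<omega>. g \<omega> \<partial>M)"
    by (rule integral_completion[OF g])
  finally show ?thesis .
qed

text \<open>The infimum convolution
  \<open>G n x = (INF (t, \<omega>). f (Z t \<omega>) + n * d x (V t \<omega>))\<close> over \<open>t \<ge> n\<close> is continuous and lies below
  \<open>f (Z t \<omega>)\<close> at \<open>x = V t \<omega>\<close>, while at the limit \<open>W \<omega>'\<close> it recovers \<open>f (Y \<omega>')\<close> as \<open>n\<close> grows;
  this replaces the use of the portmanteau theorem.\<close>

lemma converges_weakly_transfer_lower:
  fixes d :: "'x \<Rightarrow> 'x \<Rightarrow> real" and V :: "real \<Rightarrow> 'a \<Rightarrow> 'x" and W :: "'b \<Rightarrow> 'x"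
    and Z :: "real \<Rightarrow> 'a \<Rightarrow> 'y" and Y :: "'b \<Rightarrow> 'y"
  assumes M: "prob_space M" and M': "prob_space M'"
    and d: "\<And>x y. 0 \<le> d x y" "\<And>x y. d x y \<le> 1" "\<And>x y. d x y = d y x" "\<And>x. d x x = 0"
      "\<And>x y z. d x z \<le> d x y + d y z"
    and d_cont: "\<And>x e. x \<in> topspace T \<Longrightarrow> 0 < e \<Longrightarrow> \<exists>U. openin T U \<and> x \<in> U \<and> (\<forall>y\<in>U. d x y < e)"
    and conv: "converges_weakly T M V M' W at_top"
    and Z: "\<forall>\<^sub>F t in at_top. random_element M T' (Z t)" and Y: "random_element M' T' Y"
    and \<Omega>: "AE \<omega> in M. \<omega> \<in> \<Omega>" and Zspace: "\<And>t \<omega>. t \<ge> t\<^sub>0 \<Longrightarrow> \<omega> \<in> \<Omega> \<Longrightarrow> Z t \<omega> \<in> topspace T'"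
    and near: "AE \<omega>' in M'. \<forall>U. openin T' U \<and> Y \<omega>' \<in> U \<longrightarrow>
        (\<exists>\<eta>>0. \<forall>\<^sub>F t in at_top. \<forall>\<omega>\<in>\<Omega>. d (W \<omega>') (V t \<omega>) < \<eta> \<longrightarrow> Z t \<omega> \<in> U)"
    and f: "continuous_map T' euclideanreal f" "\<And>x. x \<in> topspace T' \<Longrightarrow> \<bar>f x\<bar> \<le> B" and "0 < \<epsilon>"
  shows "\<forall>\<^sub>F t in at_top. (\<integral>\<omega>. f (Y \<omega>) \<partial>completion M') - \<epsilon> < (\<integral>\<omega>. f (Z t \<omega>) \<partial>completion M)"
proof -
  interpret M: prob_space M by fact
  interpret M': prob_space M' by fact
  have "\<Omega> \<noteq> {}"
    using \<Omega> M.prob_space M.not_empty M.AE_False by auto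
  \<comment> \<open>The restriction \<open>n \<le> t\<close> makes \<open>G n\<close> feel only the
    tail, where \<open>near\<close> applies; \<open>t\<^sub>0 \<le> t\<close> keeps
    \<open>Z t \<omega>\<close> inside the space on which \<open>f\<close> is bounded.\<close>
  define I where "I n = {t. real n \<le> t \<and> t\<^sub>0 \<le> t} \<times> \<Omega>" for n
  define g where "g n x = (\<lambda>(t, \<omega>). f (Z t \<omega>) + real n * d x (V t \<omega>))" for n x
  define G where "G n x = (INF p\<in>I n. g n x p)" for n x
  have I_ne: "I n \<noteq> {}" for n
    unfolding I_def using \<open>\<Omega> \<noteq> {}\<close> by (auto intro!: exI[of _ "max (real n) t\<^sub>0"])
  have B: "0 \<le> B"
    using f(2)[OF Zspace[OF order_refl]] \<open>\<Omega> \<noteq> {}\<close> by fastforce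
  have g_ge: "- B \<le> g n x p" if "p \<in> I n" for n x p
  proof -
    obtain t \<omega> where p: "p = (t, \<omega>)" "t\<^sub>0 \<le> t" "\<omega> \<in> \<Omega>" using \<open>p \<in> I n\<close> unfolding I_def by auto
    have "- B \<le> f (Z t \<omega>)" using f(2)[OF Zspace[OF p(2,3)]] by linarith
    moreover have "0 \<le> real n * d x (V t \<omega>)" using d(1) by simp
    ultimately show ?thesis unfolding g_def p by simp
  qed
  have bdd: "bdd_below (g n x ` I n)" for n x
    using g_ge by (intro bdd_belowI[of _ "-B"]) auto
  have G_le: "G n x \<le> g n x p" if "p \<in> I n" for n x p
    unfolding G_def by (rule cINF_lower[OF bdd that])
  have G_ge: "- B \<le> G n x" for n x
    unfolding G_def using g_ge by (intro cINF_greatest I_ne)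
  have G_bound: "\<bar>G n x\<bar> \<le> B + real n" for n x
  proof -
    obtain p where p: "p \<in> I n" using I_ne[of n] by blast
    obtain t \<omega> where p': "p = (t, \<omega>)" "t\<^sub>0 \<le> t" "\<omega> \<in> \<Omega>" using p unfolding I_def by auto
    have "g n x p \<le> B + real n * 1"
      unfolding g_def p' prod.case using f(2)[OF Zspace[OF p'(2,3)]] d(2)[of x "V t \<omega>"]
      by (intro add_mono mult_left_mono) auto
    then show ?thesis using G_le[OF p, of x] G_ge[of n x] by auto
  qed
  have G_lip: "G n x \<le> G n y + real n * d x y" for n x y
  proof -
    have "G n x - real n * d x y \<le> g n y p" if "p \<in> I n" for p
    proof -
      obtain t \<omega> where p: "p = (t, \<omega>)" by (cases p)
      have "real n * d x (V t \<omega>) \<le> real n * (d x y + d y (V t \<omega>))"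
        using d(5) by (intro mult_left_mono) auto
      then show ?thesis using G_le[OF that, of x] unfolding g_def p by (simp add: algebra_simps)
    qed
    then have "G n x - real n * d x y \<le> G n y"
      unfolding G_def[of n y] by (intro cINF_greatest I_ne)
    then show ?thesis by simp
  qed
  \<comment> \<open>\<open>G n\<close> is Lipschitz with constant \<open>n\<close> for
    \<open>d\<close>, and \<open>d\<close> is small on open neighbourhoods of each point;
    \<open>n + 1\<close> in place of \<open>n\<close> avoids a division by zero.\<close>
  have G_cont: "continuous_map T euclideanreal (G n)" for n
  proof -
    have "openin T {x \<in> topspace T. G n x \<in> S}" if "open S" for S
    proof (subst openin_subopen, intro ballI)
      fix x assume x: "x \<in> {x \<in> topspace T. G n x \<in> S}"
      then obtain e where e: "0 < e" "\<And>r. \<bar>r - G n x\<bar> < e \<Longrightarrow> r \<in> S"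
        using \<open>open S\<close> unfolding open_dist dist_real_def by blast
      obtain U where U: "openin T U" "x \<in> U" "\<And>y. y \<in> U \<Longrightarrow> d x y < e / (real n + 1)"
        using d_cont[of x "e / (real n + 1)"] x e(1) by fastforce
      have "U \<subseteq> {x \<in> topspace T. G n x \<in> S}"
      proof
        fix y assume y: "y \<in> U"
        have "(real n + 1) * d x y < e" using U(3)[OF y] by (simp add: field_simps)
        then have "real n * d x y < e" using d(1)[of x y] by (simp add: algebra_simps)
        then have "\<bar>G n y - G n x\<bar> < e"
          using G_lip[of n x y] G_lip[of n y x] d(3)[of x y] by auto
        then show "y \<in> {x \<in> topspace T. G n x \<in> S}"
          using e(2) y U(1) openin_subset by fastforce
      qed
      then show "\<exists>Ta. openin T Ta \<and> x \<in> Ta \<and> Ta \<subseteq> {x \<in> topspace T. G n x \<in> S}"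
        using U by blast
    qed
    then show ?thesis unfolding continuous_map by auto
  qed
  obtain W' where W': "W' \<in> M' \<rightarrow>\<^sub>M borel_of T" "AE \<omega> in M'. W \<omega> = W' \<omega>"
    using conv unfolding converges_weakly_def random_element_def by blast
  obtain Y' where Y': "Y' \<in> M' \<rightarrow>\<^sub>M borel_of T'" "AE \<omega> in M'. Y \<omega> = Y' \<omega>"
    using Y unfolding random_element_def by blast
  have GW: "(\<lambda>\<omega>. G n (W' \<omega>)) \<in> borel_measurable M'" for n
    using measurable_compose[OF W'(1) borel_measurable_continuous_map[OF G_cont]] .
  have fY: "(\<lambda>\<omega>. f (Y' \<omega>)) \<in> borel_measurable M'"
    using measurable_compose[OF Y'(1) borel_measurable_continuous_map[OF f(1)]] .
  have Y'space: "Y' \<omega> \<in> topspace T'" if "\<omega> \<in> space M'" for \<omega>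
    using measurable_space[OF Y'(1) that] by simp
  \<comment> \<open>The minimum with \<open>f (Y' \<omega>)\<close> keeps the integrands within
    \<open>B\<close>, as dominated convergence needs; from above, \<open>G n\<close> alone is
    bounded only by \<open>B + n\<close>. A pair with \<open>V t\<close> within
    \<open>\<eta>\<close> of the limit path has \<open>f (Z t)\<close> above
    \<open>f Y - r / 2\<close> by \<open>near\<close>; any other pair pays a penalty of at least
    \<open>2 * B\<close>, so its value is at least \<open>B\<close> and hence at least
    \<open>f Y\<close>.\<close>
  have liminf: "AE \<omega> in M'. (\<lambda>n. min (G n (W' \<omega>)) (f (Y' \<omega>))) \<longlonglongrightarrow> f (Y' \<omega>)"
    using near W'(2) Y'(2) AE_space
  proof eventually_elim
    case (elim \<omega>)
    show ?case
    proof (rule LIMSEQ_I)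
      fix r :: real assume "0 < r"
      let ?U = "{y \<in> topspace T'. f y \<in> {f (Y \<omega>) - r / 2 <..}}"
      have "openin T' ?U"
        using f(1) by (intro openin_continuous_map_preimage[of T' euclideanreal]) auto
      moreover have "Y \<omega> \<in> ?U" using Y'space elim \<open>0 < r\<close> by auto
      ultimately obtain \<eta> where \<eta>: "0 < \<eta>"
        "\<forall>\<^sub>F t in at_top. \<forall>\<omega>'\<in>\<Omega>. d (W \<omega>) (V t \<omega>') < \<eta> \<longrightarrow> Z t \<omega>' \<in> ?U"
        using elim(1) by blast
      then obtain t\<^sub>1 where t1: "\<And>t \<omega>'. t \<ge> t\<^sub>1 \<Longrightarrow> \<omega>' \<in> \<Omega> \<Longrightarrow> d (W \<omega>) (V t \<omega>') < \<eta> \<Longrightarrow> Z t \<omega>' \<in> ?U"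
        unfolding eventually_at_top_linorder by blast
      obtain n\<^sub>1 where n1: "t\<^sub>1 \<le> real n\<^sub>1" "2 * B / \<eta> \<le> real n\<^sub>1"
        using real_arch_simple[of "max t\<^sub>1 (2 * B / \<eta>)"] by auto
      have "norm (min (G n (W' \<omega>)) (f (Y' \<omega>)) - f (Y' \<omega>)) < r" if "n \<ge> n\<^sub>1" for n
      proof -
        have "f (Y \<omega>) - r / 2 \<le> g n (W \<omega>) p" if "p \<in> I n" for p
        proof -
          obtain t \<omega>' where p: "p = (t, \<omega>')" "real n \<le> t" "t\<^sub>0 \<le> t" "\<omega>' \<in> \<Omega>"
            using \<open>p \<in> I n\<close> unfolding I_def by auto
          show ?thesis
          proof (cases "d (W \<omega>) (V t \<omega>') < \<eta>")
            case True
            then have "Z t \<omega>' \<in> ?U"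
              using t1[of t \<omega>'] p n1(1) \<open>n \<ge> n\<^sub>1\<close> by (meson of_nat_le_iff order_trans)
            moreover have "0 \<le> real n * d (W \<omega>) (V t \<omega>')" using d(1) by simp
            ultimately show ?thesis unfolding g_def p prod.case by auto
          next
            case False
            have "2 * B \<le> real n\<^sub>1 * \<eta>" using n1(2) \<eta>(1) by (simp add: field_simps)
            also have "\<dots> \<le> real n * d (W \<omega>) (V t \<omega>')"
              using False \<open>n \<ge> n\<^sub>1\<close> \<eta>(1) by (intro mult_mono) auto
            finally have "B \<le> g n (W \<omega>) p"
              unfolding g_def p prod.case using f(2)[OF Zspace[OF p(3,4)]] by auto
            then show ?thesis using f(2)[OF Y'space[of \<omega>]] elim \<open>0 < r\<close> by auto
          qed
        qed
        then have "f (Y \<omega>) - r / 2 \<le> G n (W \<omega>)"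
          unfolding G_def by (intro cINF_greatest I_ne)
        then show ?thesis using elim \<open>0 < r\<close> by (auto simp: min_def)
      qed
      then show "\<exists>no. \<forall>n\<ge>no. norm (min (G n (W' \<omega>)) (f (Y' \<omega>)) - f (Y' \<omega>)) < r" by blast
    qed
  qed
  have "(\<lambda>n. \<integral>\<omega>. min (G n (W' \<omega>)) (f (Y' \<omega>)) \<partial>M') \<longlonglongrightarrow> (\<integral>\<omega>. f (Y' \<omega>) \<partial>M')"
  proof (rule integral_dominated_convergence[where w = "\<lambda>_. B"])
    show "AE \<omega> in M'. norm (min (G n (W' \<omega>)) (f (Y' \<omega>))) \<le> B" for n
      using AE_space
    proof eventually_elim
      case (elim \<omega>)
      then show ?case using f(2)[OF Y'space[of \<omega>]] G_ge[of n "W' \<omega>"] by auto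
    qed
  qed (use GW fY liminf in auto)
  then have "\<forall>\<^sub>F n in sequentially. (\<integral>\<omega>. f (Y' \<omega>) \<partial>M') - \<epsilon> / 2 < (\<integral>\<omega>. min (G n (W' \<omega>)) (f (Y' \<omega>)) \<partial>M')"
    using \<open>0 < \<epsilon>\<close> by (intro order_tendstoD) auto
  then obtain n where n: "(\<integral>\<omega>. f (Y' \<omega>) \<partial>M') - \<epsilon> / 2 < (\<integral>\<omega>. min (G n (W' \<omega>)) (f (Y' \<omega>)) \<partial>M')"
    by (auto simp: eventually_sequentially)
  also have "\<dots> \<le> (\<integral>\<omega>. G n (W' \<omega>) \<partial>M')"
  proof (rule integral_mono)
    show "integrable M' (\<lambda>\<omega>. G n (W' \<omega>))"
      using G_bound by (intro M'.integrable_const_bound[of _ "B + real n"] GW) auto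
    show "integrable M' (\<lambda>\<omega>. min (G n (W' \<omega>)) (f (Y' \<omega>)))"
    proof (rule M'.integrable_const_bound[of _ "B"])
      show "AE \<omega> in M'. norm (min (G n (W' \<omega>)) (f (Y' \<omega>))) \<le> B"
        using AE_space
      proof eventually_elim
        case (elim \<omega>)
        then show ?case using f(2)[OF Y'space[of \<omega>]] G_ge[of n "W' \<omega>"] by auto
      qed
    qed (use GW fY in auto)
  qed simp
  also have "\<dots> = (\<integral>\<omega>. G n (W \<omega>) \<partial>completion M')"
    using W'(2) by (intro integral_completion_AE[symmetric] GW) auto
  finally have GWlow: "(\<integral>\<omega>. f (Y' \<omega>) \<partial>M') - \<epsilon> / 2 < (\<integral>\<omega>. G n (W \<omega>) \<partial>completion M')" .
  \<comment> \<open>With \<open>n\<close> now fixed, \<open>G n\<close> is a bounded continuous test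
    function, so the hypothesis on \<open>V\<close> applies to it.\<close>
  have "bounded (G n ` topspace T)"
    unfolding bounded_iff using G_bound by auto
  then have "((\<lambda>t. \<integral>\<omega>. G n (V t \<omega>) \<partial>completion M) \<longlongrightarrow> (\<integral>\<omega>. G n (W \<omega>) \<partial>completion M')) at_top"
    using conv G_cont unfolding converges_weakly_def by blast
  then have ev1: "\<forall>\<^sub>F t in at_top. (\<integral>\<omega>. G n (W \<omega>) \<partial>completion M') - \<epsilon> / 2 < (\<integral>\<omega>. G n (V t \<omega>) \<partial>completion M)"
    using \<open>0 < \<epsilon>\<close> by (intro order_tendstoD) auto
  have ev2: "\<forall>\<^sub>F t in at_top. random_element M T (V t)"
    using conv unfolding converges_weakly_def by blast
  show ?thesis
    using ev1 ev2 Z eventually_ge_at_top[of "real n"] eventually_ge_at_top[of t\<^sub>0]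
  proof eventually_elim
    case (elim t)
    obtain V' where V': "V' \<in> M \<rightarrow>\<^sub>M borel_of T" "AE \<omega> in M. V t \<omega> = V' \<omega>"
      using elim(2) unfolding random_element_def by blast
    obtain Z' where Z': "Z' \<in> M \<rightarrow>\<^sub>M borel_of T'" "AE \<omega> in M. Z t \<omega> = Z' \<omega>"
      using elim(3) unfolding random_element_def by blast
    have GV: "(\<lambda>\<omega>. G n (V' \<omega>)) \<in> borel_measurable M"
      using measurable_compose[OF V'(1) borel_measurable_continuous_map[OF G_cont]] .
    have fZ: "(\<lambda>\<omega>. f (Z' \<omega>)) \<in> borel_measurable M"
      using measurable_compose[OF Z'(1) borel_measurable_continuous_map[OF f(1)]] .
    have "(\<integral>\<omega>. G n (V t \<omega>) \<partial>completion M) = (\<integral>\<omega>. G n (V' \<omega>) \<partial>M)"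
      using V'(2) by (intro integral_completion_AE GV) auto
    also have "\<dots> \<le> (\<integral>\<omega>. f (Z' \<omega>) \<partial>M)"
    proof (rule integral_mono_AE)
      show "integrable M (\<lambda>\<omega>. G n (V' \<omega>))"
        using G_bound by (intro M.integrable_const_bound[of _ "B + real n"] GV) auto
      have "norm (f (Z' \<omega>)) \<le> B" if "\<omega> \<in> space M" for \<omega>
        using f(2) measurable_space[OF Z'(1) that] by simp
      then show "integrable M (\<lambda>\<omega>. f (Z' \<omega>))"
        by (intro M.integrable_const_bound[of _ B] fZ AE_I2)
      show "AE \<omega> in M. G n (V' \<omega>) \<le> f (Z' \<omega>)"
        using V'(2) Z'(2) \<Omega>
      proof eventually_elim
        case e: (elim \<omega>)
        have "(t, \<omega>) \<in> I n" unfolding I_def using elim e by auto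
        from G_le[OF this, of "V t \<omega>"]
        have "G n (V t \<omega>) \<le> f (Z t \<omega>) + real n * d (V t \<omega>) (V t \<omega>)" unfolding g_def by simp
        then show ?case using e d(4)[of "V t \<omega>"] by simp
      qed
    qed
    also have "\<dots> = (\<integral>\<omega>. f (Z t \<omega>) \<partial>completion M)"
      using Z'(2) by (intro integral_completion_AE[symmetric] fZ) auto
    finally have "(\<integral>\<omega>. G n (V t \<omega>) \<partial>completion M) \<le> (\<integral>\<omega>. f (Z t \<omega>) \<partial>completion M)" .
    moreover have "(\<integral>\<omega>. f (Y \<omega>) \<partial>completion M') = (\<integral>\<omega>. f (Y' \<omega>) \<partial>M')"
      using Y'(2) by (intro integral_completion_AE fY) auto
    ultimately show ?case using elim(1) GWlow by linarith
  qed
qed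

text \<open>This is an extended continuous mapping theorem: \<open>Z t\<close> need not be a
  function of \<open>V t\<close>, and closeness is required only around limit paths, uniformly over
  \<open>\<Omega>\<close> for late \<open>t\<close>. The lower bounds for \<open>f\<close> and for
  \<open>- f\<close> together give convergence of the expectations.\<close>

lemma converges_weakly_transfer:
  fixes d :: "'x \<Rightarrow> 'x \<Rightarrow> real" and V :: "real \<Rightarrow> 'a \<Rightarrow> 'x" and W :: "'b \<Rightarrow> 'x"
    and Z :: "real \<Rightarrow> 'a \<Rightarrow> 'y" and Y :: "'b \<Rightarrow> 'y"
  assumes M: "prob_space M" and M': "prob_space M'"
    and d: "\<And>x y. 0 \<le> d x y" "\<And>x y. d x y \<le> 1" "\<And>x y. d x y = d y x" "\<And>x. d x x = 0"
      "\<And>x y z. d x z \<le> d x y + d y z"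
    and d_cont: "\<And>x e. x \<in> topspace T \<Longrightarrow> 0 < e \<Longrightarrow> \<exists>U. openin T U \<and> x \<in> U \<and> (\<forall>y\<in>U. d x y < e)"
    and conv: "converges_weakly T M V M' W at_top"
    and Z: "\<forall>\<^sub>F t in at_top. random_element M T' (Z t)" and Y: "random_element M' T' Y"
    and \<Omega>: "AE \<omega> in M. \<omega> \<in> \<Omega>" and Zspace: "\<And>t \<omega>. t \<ge> t\<^sub>0 \<Longrightarrow> \<omega> \<in> \<Omega> \<Longrightarrow> Z t \<omega> \<in> topspace T'"
    and near: "AE \<omega>' in M'. \<forall>U. openin T' U \<and> Y \<omega>' \<in> U \<longrightarrow>
        (\<exists>\<eta>>0. \<forall>\<^sub>F t in at_top. \<forall>\<omega>\<in>\<Omega>. d (W \<omega>') (V t \<omega>) < \<eta> \<longrightarrow> Z t \<omega> \<in> U)"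
  shows "converges_weakly T' M Z M' Y at_top"
  unfolding converges_weakly_def
proof (intro conjI allI impI Z Y)
  fix f assume f: "continuous_map T' euclideanreal f \<and> bounded (f ` topspace T')"
  then obtain B where B: "\<And>x. x \<in> topspace T' \<Longrightarrow> \<bar>f x\<bar> \<le> B"
    unfolding bounded_iff by auto
  have f': "continuous_map T' euclideanreal (\<lambda>x. - f x)"
    using f by (intro continuous_map_minus) auto
  note low = converges_weakly_transfer_lower[OF M M' d(1-5) d_cont conv Z Y \<Omega> Zspace near]
  show "((\<lambda>t. \<integral>\<omega>. f (Z t \<omega>) \<partial>completion M) \<longlongrightarrow> (\<integral>\<omega>. f (Y \<omega>) \<partial>completion M')) at_top"
    unfolding tendsto_iff
  proof (intro allI impI)
    fix e :: real assume "0 < e"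
    have "\<forall>\<^sub>F t in at_top. (\<integral>\<omega>. f (Y \<omega>) \<partial>completion M') - e < (\<integral>\<omega>. f (Z t \<omega>) \<partial>completion M)"
      by (rule low[where f = f and B = B]) (use f B \<open>0 < e\<close> in auto)
    moreover have "\<forall>\<^sub>F t in at_top. (\<integral>\<omega>. - f (Y \<omega>) \<partial>completion M') - e < (\<integral>\<omega>. - f (Z t \<omega>) \<partial>completion M)"
      by (rule low[where f = "\<lambda>x. - f x" and B = B]) (use f' B \<open>0 < e\<close> in auto)
    ultimately show "\<forall>\<^sub>F t in at_top. dist (\<integral>\<omega>. f (Z t \<omega>) \<partial>completion M) (\<integral>\<omega>. f (Y \<omega>) \<partial>completion M') < e"
      by eventually_elim (auto simp: dist_real_def)
  qed
qed

section \<open>A pseudometric comparing graphs\<close>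

text \<open>A test function is maximised along the graph, so a time change hardly affects the value. The
  resulting pseudometric is coarser than \<open>J1\<close>, but near a continuous function it controls the
  locally uniform distance.\<close>

definition graph_tests :: "(real \<times> real \<Rightarrow> real) set" where
  "graph_tests = {\<theta>. (\<forall>p q. \<bar>\<theta> p - \<theta> q\<bar> \<le> dist p q) \<and>
     (\<forall>t\<ge>0. \<forall>v. 0 \<le> \<theta> (t, v) \<and> \<theta> (t, v) \<le> 1 / (1 + t))}"

definition graph_sup :: "(real \<times> real \<Rightarrow> real) \<Rightarrow> (real \<Rightarrow> real) \<Rightarrow> real" where
  "graph_sup \<theta> x = (SUP t\<in>{0..}. \<theta> (t, x t))"

definition graph_dist :: "(real \<Rightarrow> real) \<Rightarrow> (real \<Rightarrow> real) \<Rightarrow> real" where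
  "graph_dist x y = (SUP \<theta>\<in>graph_tests. \<bar>graph_sup \<theta> x - graph_sup \<theta> y\<bar>)"

lemma graph_testsD:
  assumes "\<theta> \<in> graph_tests"
  shows "\<bar>\<theta> p - \<theta> q\<bar> \<le> dist p q"
    and "0 \<le> t \<Longrightarrow> 0 \<le> \<theta> (t, v)" and "0 \<le> t \<Longrightarrow> \<theta> (t, v) \<le> 1 / (1 + t)"
  using assms unfolding graph_tests_def by (blast, auto)

lemma graph_tests_le_1: "\<theta> \<in> graph_tests \<Longrightarrow> 0 \<le> t \<Longrightarrow> \<theta> (t, v) \<le> 1"
  using graph_testsD(3)[of \<theta> t v] by (rule order_trans) auto

lemma graph_sup_upper: "\<theta> \<in> graph_tests \<Longrightarrow> 0 \<le> t \<Longrightarrow> \<theta> (t, x t) \<le> graph_sup \<theta> x"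
  unfolding graph_sup_def
  by (intro cSUP_upper bdd_aboveI2[of _ _ 1]) (auto intro: graph_tests_le_1)

lemma graph_sup_least: "(\<And>t. 0 \<le> t \<Longrightarrow> \<theta> (t, x t) \<le> c) \<Longrightarrow> graph_sup \<theta> x \<le> c"
  unfolding graph_sup_def by (intro cSUP_least) auto

lemma graph_sup_bounds:
  assumes "\<theta> \<in> graph_tests"
  shows "0 \<le> graph_sup \<theta> x" "graph_sup \<theta> x \<le> 1"
  using order_trans[OF graph_testsD(2)[OF assms order_refl] graph_sup_upper[OF assms order_refl]]
    graph_sup_least[of \<theta> x 1] graph_tests_le_1[OF assms] by blast+

lemma graph_tests_nonempty: "graph_tests \<noteq> {}"
  unfolding graph_tests_def by (auto intro!: exI[of _ "\<lambda>_. 0"])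

lemma graph_dist_upper:
  assumes "\<theta> \<in> graph_tests"
  shows "\<bar>graph_sup \<theta> x - graph_sup \<theta> y\<bar> \<le> graph_dist x y"
  unfolding graph_dist_def
proof (intro cSUP_upper assms bdd_aboveI2[of _ _ 1])
  show "\<bar>graph_sup \<theta> x - graph_sup \<theta> y\<bar> \<le> 1" if "\<theta> \<in> graph_tests" for \<theta>
    using graph_sup_bounds[OF that, of x] graph_sup_bounds[OF that, of y] by linarith
qed

lemma graph_dist_least:
  "(\<And>\<theta>. \<theta> \<in> graph_tests \<Longrightarrow> \<bar>graph_sup \<theta> x - graph_sup \<theta> y\<bar> \<le> c) \<Longrightarrow> graph_dist x y \<le> c"
  unfolding graph_dist_def by (intro cSUP_least graph_tests_nonempty)

lemma graph_dist_pseudometric: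
  "0 \<le> graph_dist x y" "graph_dist x y \<le> 1" "graph_dist x y = graph_dist y x"
  "graph_dist x x = 0" "graph_dist x z \<le> graph_dist x y + graph_dist y z"
proof -
  show nonneg: "0 \<le> graph_dist x y" for x y
    using graph_tests_nonempty graph_dist_upper[of _ x y] by (meson abs_ge_zero ex_in_conv order_trans)
  show "graph_dist x y \<le> 1"
  proof (rule graph_dist_least)
    show "\<bar>graph_sup \<theta> x - graph_sup \<theta> y\<bar> \<le> 1" if "\<theta> \<in> graph_tests" for \<theta>
      using graph_sup_bounds[OF that, of x] graph_sup_bounds[OF that, of y] by linarith
  qed
  show "graph_dist x y = graph_dist y x"
    unfolding graph_dist_def by (simp add: abs_minus_commute)
  show "graph_dist x x = 0"
    using graph_dist_least[of x x 0] nonneg[of x x] by simp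
  show "graph_dist x z \<le> graph_dist x y + graph_dist y z"
  proof (rule graph_dist_least)
    show "\<bar>graph_sup \<theta> x - graph_sup \<theta> z\<bar> \<le> graph_dist x y + graph_dist y z"
      if "\<theta> \<in> graph_tests" for \<theta>
      using graph_dist_upper[OF that, of x y] graph_dist_upper[OF that, of y z] by linarith
  qed
qed

lemma dist_Pair_le_sum: "dist (a, b) (c, d) \<le> \<bar>a - c\<bar> + \<bar>b - d\<bar>" for a b c d :: real
  unfolding dist_Pair_Pair dist_real_def
  using sqrt_sum_squares_le_sum[of "\<bar>a - c\<bar>" "\<bar>b - d\<bar>"] by simp

text \<open>Up to \<open>T\<close>, the time change matches points of the two graphs at distance at
  most \<open>2 * e\<close>, and tests are 1-Lipschitz. All other points lie after time
  \<open>T - e\<close>, where tests are at most \<open>1 / (1 + T - e)\<close>; this decay makes up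
  for the neighbourhood saying nothing about later times. Surjectivity of the time change reaches
  every point of the second graph.\<close>

lemma graph_dist_J1_nbhd:
  assumes "y \<in> J1_nbhd x T e" "0 \<le> T" "e \<le> T"
  shows "graph_dist x y \<le> 2 * e + 1 / (1 + T - e)"
proof (rule graph_dist_least)
  fix \<theta> assume \<theta>: "\<theta> \<in> graph_tests"
  obtain l d where l: "time_change l" "d < e" "\<And>t. 0 \<le> t \<Longrightarrow> \<bar>l t - t\<bar> \<le> d"
    "\<And>t. t \<in> {0..T} \<Longrightarrow> \<bar>y (l t) - x t\<bar> \<le> d"
    using assms(1) unfolding J1_nbhd_def by blast
  have e: "0 < e" using l(2) l(3)[of 0] by simp
  let ?c = "2 * e + 1 / (1 + T - e)"
  have near: "\<bar>\<theta> (t, x t) - \<theta> (l t, y (l t))\<bar> \<le> ?c" if "0 \<le> t" "t \<le> T" for t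
  proof -
    have "\<bar>\<theta> (t, x t) - \<theta> (l t, y (l t))\<bar> \<le> \<bar>t - l t\<bar> + \<bar>x t - y (l t)\<bar>"
      by (rule order_trans[OF graph_testsD(1)[OF \<theta>] dist_Pair_le_sum])
    also have "\<dots> \<le> 2 * e" using l(2) l(3)[of t] l(4)[of t] that by auto
    finally show ?thesis using assms(3) by (simp add: add_increasing2)
  qed
  have far: "\<theta> (s, v) \<le> ?c" if "T - e \<le> s" "0 \<le> s" for s v
  proof -
    have "\<theta> (s, v) \<le> 1 / (1 + s)" by (rule graph_testsD(3)[OF \<theta> that(2)])
    also have "\<dots> \<le> 1 / (1 + T - e)" using that assms(3) by (intro divide_left_mono) auto
    finally show ?thesis using e by simp
  qed
  have "graph_sup \<theta> x \<le> graph_sup \<theta> y + ?c"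
  proof (rule graph_sup_least)
    fix t :: real assume t: "0 \<le> t"
    show "\<theta> (t, x t) \<le> graph_sup \<theta> y + ?c"
    proof (cases "t \<le> T")
      case True
      then show ?thesis
        using near[OF t True] graph_sup_upper[OF \<theta> time_change_nonneg[OF l(1) t], of y] by linarith
    next
      case False
      then show ?thesis using far[of t "x t"] t e graph_sup_bounds(1)[OF \<theta>, of y] by linarith
    qed
  qed
  moreover have "graph_sup \<theta> y \<le> graph_sup \<theta> x + ?c"
  proof (rule graph_sup_least)
    fix s :: real assume s: "0 \<le> s"
    then obtain t where t: "0 \<le> t" "s = l t"
      using l(1) unfolding time_change_def by (metis atLeast_iff imageE)
    show "\<theta> (s, y s) \<le> graph_sup \<theta> x + ?c"
    proof (cases "t \<le> T")
      case True
      then show ?thesis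
        using near[OF t(1) True] graph_sup_upper[OF \<theta> t(1), of x] unfolding t(2) by linarith
    next
      case False
      then have "T - e \<le> s" using l(2) l(3)[OF t(1)] t(2) by auto
      then show ?thesis using far[of s "y s"] s graph_sup_bounds(1)[OF \<theta>, of x] by linarith
    qed
  qed
  ultimately show "\<bar>graph_sup \<theta> x - graph_sup \<theta> y\<bar> \<le> ?c" by linarith
qed

lemma graph_dist_J1_continuous:
  assumes "x \<in> topspace J1_topology" "0 < e"
  shows "\<exists>U. openin J1_topology U \<and> x \<in> U \<and> (\<forall>y\<in>U. graph_dist x y < e)"
proof -
  \<comment> \<open>With the horizon \<open>4 / e + 1\<close> the tail term is at most
    \<open>e / 4\<close>, and \<open>d \<le> e / 8\<close> makes the term \<open>2 * d\<close> at
    most \<open>e / 4\<close>.\<close>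
  define d where "d = min 1 (e / 8)"
  have d: "0 < d" "d \<le> 1" "d \<le> e / 8" unfolding d_def using assms(2) by auto
  have "graph_dist x y < e" if "y \<in> J1_nbhd x (4 / e + 1) d" for y
  proof -
    have "graph_dist x y \<le> 2 * d + 1 / (1 + (4 / e + 1) - d)"
      using assms(2) d by (intro graph_dist_J1_nbhd[OF that]) (auto intro: order_trans[OF d(2)])
    also have "1 / (1 + (4 / e + 1) - d) \<le> 1 / (4 / e)"
    proof (rule divide_left_mono)
      show le: "4 / e \<le> 1 + (4 / e + 1) - d" using d by simp
      have "0 < 4 / e" using assms(2) by simp
      with le show "0 < (1 + (4 / e + 1) - d) * (4 / e)" by (intro mult_pos_pos) linarith+
    qed simp
    finally show ?thesis using d(3) assms(2) by simp
  qed
  then show ?thesis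
    using openin_J1_nbhd centre_in_J1_nbhd assms(1) d(1) by (metis topspace_J1_topology)
qed

text \<open>One test suffices: the distance to the graph of \<open>x\<close>, cut off at
  \<open>1 / (1 + t)\<close>. It vanishes on that graph, so a small \<open>graph_dist x y\<close>
  puts every \<open>(t, y t)\<close> close to some \<open>(s, x s)\<close>, and uniform continuity
  of \<open>x\<close> allows \<open>s\<close> to be replaced by \<open>t\<close>.\<close>

lemma graph_dist_imp_uniform:
  assumes x: "continuous_on {0..} x" and T: "0 \<le> T" and "0 < \<epsilon>"
  shows "\<exists>\<eta>>0. \<forall>y. graph_dist x y < \<eta> \<longrightarrow> (\<forall>t\<in>{0..T}. \<bar>y t - x t\<bar> < \<epsilon>)"
proof -
  have "uniformly_continuous_on {0..T + 1} x"
    by (intro compact_uniformly_continuous continuous_on_subset[OF x]) auto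
  then obtain \<delta> where \<delta>: "0 < \<delta>"
    "\<And>s t. s \<in> {0..T + 1} \<Longrightarrow> t \<in> {0..T + 1} \<Longrightarrow> \<bar>s - t\<bar> < \<delta> \<Longrightarrow> \<bar>x s - x t\<bar> < \<epsilon> / 2"
    unfolding uniformly_continuous_on_def dist_real_def using half_gt_zero[OF \<open>0 < \<epsilon>\<close>] by metis
  \<comment> \<open>The term \<open>1 / (2 + T)\<close> lies strictly below the cutoff at all times
    up to \<open>T\<close>, so a test value below \<open>\<eta>\<close> must come from the distance.
    It is also below 1, which keeps \<open>s\<close> in \<open>[0, T + 1]\<close>.\<close>
  define \<eta> where "\<eta> = min (min \<delta> (\<epsilon> / 2)) (1 / (2 + T))"
  have \<eta>: "0 < \<eta>" "\<eta> \<le> \<delta>" "\<eta> \<le> \<epsilon> / 2" "\<eta> \<le> 1 / (2 + T)"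
    unfolding \<eta>_def using \<delta>(1) \<open>0 < \<epsilon>\<close> T by auto
  have "1 / (2 + T) < 1 / (1 + T)" using T by (simp add: field_simps)
  then have \<eta>1: "\<eta> < 1 / (1 + T)" using \<eta>(4) by simp
  moreover have "1 / (1 + T) \<le> 1" using T by simp
  ultimately have \<eta>2: "\<eta> < 1" by simp
  define A where "A = (\<lambda>s. (s, x s)) ` {0..}"
  \<comment> \<open>The absolute value extends the cutoff to negative times, since tests have to be
    Lipschitz on the whole plane.\<close>
  define \<theta> where "\<theta> = (\<lambda>p::real \<times> real. min (infdist p A) (1 / (1 + \<bar>fst p\<bar>)))"
  have A: "A \<noteq> {}" unfolding A_def by simp
  have \<theta>: "\<theta> \<in> graph_tests"
    unfolding graph_tests_def
  proof (intro CollectI conjI allI impI)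
    fix p q :: "real \<times> real"
    have "\<bar>1 / (1 + \<bar>fst p\<bar>) - 1 / (1 + \<bar>fst q\<bar>)\<bar> \<le> dist p q"
    proof -
      have "\<bar>1 / (1 + \<bar>fst p\<bar>) - 1 / (1 + \<bar>fst q\<bar>)\<bar> = \<bar>\<bar>fst q\<bar> - \<bar>fst p\<bar>\<bar> / ((1 + \<bar>fst p\<bar>) * (1 + \<bar>fst q\<bar>))"
        by (subst diff_frac_eq) (auto simp: abs_divide abs_mult)
      also have "\<dots> \<le> \<bar>\<bar>fst q\<bar> - \<bar>fst p\<bar>\<bar> / 1"
        by (intro divide_left_mono) (auto simp: algebra_simps intro!: add_nonneg_nonneg add_pos_nonneg)
      also have "\<dots> \<le> dist (fst p) (fst q)" by (auto simp: dist_real_def)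
      also have "\<dots> \<le> dist p q" by (rule dist_fst_le)
      finally show ?thesis .
    qed
    with infdist_triangle_abs[of p A q] show "\<bar>\<theta> p - \<theta> q\<bar> \<le> dist p q"
      unfolding \<theta>_def by (auto simp: min_def abs_le_iff)
  qed (auto simp: \<theta>_def infdist_nonneg)
  have "graph_sup \<theta> x \<le> 0"
  proof (rule graph_sup_least)
    fix t :: real assume "0 \<le> t"
    then have "(t, x t) \<in> A" unfolding A_def by auto
    then show "\<theta> (t, x t) \<le> 0" unfolding \<theta>_def by (simp add: min_le_iff_disj)
  qed
  then have sup_x: "graph_sup \<theta> x = 0" using graph_sup_bounds(1)[OF \<theta>] by (simp add: order_antisym)
  show ?thesis
  proof (intro exI[of _ \<eta>] conjI allI impI ballI \<eta>(1))
    fix y t assume y: "graph_dist x y < \<eta>" and t: "t \<in> {0..T}"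
    have "\<theta> (t, y t) \<le> graph_sup \<theta> y" using t by (intro graph_sup_upper \<theta>) auto
    also have "\<dots> \<le> graph_dist x y" using graph_dist_upper[OF \<theta>, of x y] sup_x by simp
    finally have "\<theta> (t, y t) < \<eta>" using y by simp
    moreover have "\<eta> < 1 / (1 + \<bar>t\<bar>)"
    proof -
      have "1 / (1 + T) \<le> 1 / (1 + \<bar>t\<bar>)" using t by (intro divide_left_mono) auto
      then show ?thesis using \<eta>1 by simp
    qed
    ultimately have "infdist (t, y t) A < \<eta>" unfolding \<theta>_def by auto
    then obtain a where "a \<in> A" "dist (t, y t) a < \<eta>"
      using A unfolding infdist_notempty[OF A] by (subst (asm) cINF_less_iff) auto
    then obtain s where s: "0 \<le> s" "dist (t, y t) (s, x s) < \<eta>" unfolding A_def by auto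
    have "\<bar>t - s\<bar> < \<eta>" "\<bar>y t - x s\<bar> < \<eta>"
      using s(2) dist_fst_le[of "(t, y t)" "(s, x s)"] dist_snd_le[of "(t, y t)" "(s, x s)"]
      by (auto simp: dist_real_def)
    moreover from this have "\<bar>x s - x t\<bar> < \<epsilon> / 2"
      using t s(1) \<eta> \<eta>2 by (intro \<delta>(2)) auto
    ultimately show "\<bar>y t - x t\<bar> < \<epsilon>" using \<eta>(3) by linarith
  qed
qed

section \<open>Borel measurability in the Skorokhod space\<close>

text \<open>The time changes are composed; the first moves \<open>[0, T]\<close> by less than
  \<open>d\<close>, hence into the range \<open>[0, T']\<close> controlled by the second.\<close>

lemma J1_nbhd_trans:
  assumes "y \<in> J1_nbhd x T d" "z \<in> J1_nbhd y T' e" "T + d \<le> T'"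
  shows "z \<in> J1_nbhd x T (d + e)"
proof -
  obtain l d' where l: "time_change l" "d' < d" "\<And>t. 0 \<le> t \<Longrightarrow> \<bar>l t - t\<bar> \<le> d'"
    "\<And>t. t \<in> {0..T} \<Longrightarrow> \<bar>y (l t) - x t\<bar> \<le> d'"
    using assms(1) unfolding J1_nbhd_def by blast
  obtain k e' where k: "z \<in> skorokhod_space" "time_change k" "e' < e" "\<And>t. 0 \<le> t \<Longrightarrow> \<bar>k t - t\<bar> \<le> e'"
    "\<And>t. t \<in> {0..T'} \<Longrightarrow> \<bar>z (k t) - y t\<bar> \<le> e'"
    using assms(2) unfolding J1_nbhd_def by blast
  have "\<bar>k (l t) - t\<bar> \<le> d' + e'" if "0 \<le> t" for t
    using k(4)[OF time_change_nonneg[OF l(1) that]] l(3)[OF that] by linarith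
  moreover have "\<bar>z (k (l t)) - x t\<bar> \<le> d' + e'" if t: "t \<in> {0..T}" for t
  proof -
    have "0 \<le> l t" "\<bar>l t - t\<bar> \<le> d'" using l(3) t time_change_nonneg[OF l(1)] by auto
    then have "l t \<in> {0..T'}" using t l(2) assms(3) by auto
    from k(5)[OF this] l(4)[OF t] show ?thesis by linarith
  qed
  moreover have "d' + e' < d + e" using l(2) k(3) by simp
  ultimately show ?thesis
    unfolding J1_nbhd_def using k(1) time_change_compose[OF k(2) l(1)] by blast
qed

text \<open>The inverse time change has the same displacement. The horizon drops by \<open>d\<close>
  because the inverse may carry points of \<open>[0, T']\<close> almost that far to the
  right.\<close>

lemma J1_nbhd_sym:
  assumes "y \<in> J1_nbhd x T d" "x \<in> skorokhod_space" "T' + d \<le> T"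
  shows "x \<in> J1_nbhd y T' d"
proof -
  obtain l d' where l: "time_change l" "d' < d" "\<And>t. 0 \<le> t \<Longrightarrow> \<bar>l t - t\<bar> \<le> d'"
    "\<And>t. t \<in> {0..T} \<Longrightarrow> \<bar>y (l t) - x t\<bar> \<le> d'"
    using assms(1) unfolding J1_nbhd_def by blast
  have l': "strict_mono_on {0..} l" "continuous_on {0..} l" "l ` {0..} = {0..}"
    using l(1) unfolding time_change_def by auto
  have "path_connected {0::real..}" by (intro convex_imp_path_connected) auto
  then obtain m where "homeomorphism {0..} {0..} l m"
    using homeomorphism_into_1d l' strict_mono_on_imp_inj_on by blast
  then have m: "\<And>t. 0 \<le> t \<Longrightarrow> l (m t) = t" "m ` {0..} = {0..}" "continuous_on {0..} m"
    unfolding homeomorphism_def by auto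
  have m0: "0 \<le> m t" if "0 \<le> t" for t using m(2) that by auto
  have "time_change m"
    unfolding time_change_def
  proof (intro conjI m strict_mono_onI)
    fix r s :: real assume rs: "r \<in> {0..}" "s \<in> {0..}" "r < s"
    show "m r < m s"
    proof (rule ccontr)
      assume "\<not> m r < m s"
      then have "l (m s) \<le> l (m r)"
        using m0 rs l'(1) by (meson atLeast_iff leI strict_mono_on_leD)
      then show False using m(1) rs by simp
    qed
  qed
  moreover have dm: "\<bar>m t - t\<bar> \<le> d'" if "0 \<le> t" for t
    using l(3)[OF m0[OF that]] m(1)[OF that] by simp
  moreover have "\<bar>x (m t) - y t\<bar> \<le> d'" if t: "t \<in> {0..T'}" for t
  proof -
    have "m t \<in> {0..T}" using m0[of t] dm[of t] t l(2) assms(3) by auto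
    from l(4)[OF this] m(1)[of t] t show ?thesis by simp
  qed
  ultimately show ?thesis unfolding J1_nbhd_def using l(2) assms(2) by blast
qed

section \<open>Approximation of cadlag paths by step functions on grids\<close>

lemma cadlag_oscillation_right:
  assumes "cadlag x" "0 \<le> t" "0 < \<epsilon>"
  shows "\<exists>\<delta>>0. \<forall>r\<in>{t..<t + \<delta>}. \<forall>s\<in>{t..<t + \<delta>}. \<bar>x r - x s\<bar> < \<epsilon>"
proof -
  have "(x \<longlongrightarrow> x t) (at_right t)" using assms unfolding cadlag_def continuous_within by blast
  then have "\<forall>\<^sub>F s in at_right t. dist (x s) (x t) < \<epsilon> / 2"
    using \<open>0 < \<epsilon>\<close> by (intro tendstoD) auto
  then obtain c where c: "t < c" "\<And>s. t < s \<Longrightarrow> s < c \<Longrightarrow> dist (x s) (x t) < \<epsilon> / 2"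
    unfolding eventually_at_right_field by blast
  have near: "\<bar>x s - x t\<bar> < \<epsilon> / 2" if "s \<in> {t..<t + (c - t)}" for s
    using c(2)[of s] that \<open>0 < \<epsilon>\<close> by (cases "s = t") (auto simp: dist_real_def)
  have "\<bar>x r - x s\<bar> < \<epsilon>" if "r \<in> {t..<t + (c - t)}" "s \<in> {t..<t + (c - t)}" for r s
    using near[OF that(1)] near[OF that(2)] by linarith
  then show ?thesis using c(1) by (intro exI[of _ "c - t"]) auto
qed

lemma cadlag_oscillation_left:
  assumes "cadlag x" "0 < t" "0 < \<epsilon>"
  shows "\<exists>\<delta>>0. \<forall>r\<in>{t - \<delta><..<t}. \<forall>s\<in>{t - \<delta><..<t}. \<bar>x r - x s\<bar> < \<epsilon>"
proof -
  obtain L where "(x \<longlongrightarrow> L) (at_left t)" using assms unfolding cadlag_def by blast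
  then have "\<forall>\<^sub>F s in at_left t. dist (x s) L < \<epsilon> / 2"
    using \<open>0 < \<epsilon>\<close> by (intro tendstoD) auto
  then obtain c where c: "c < t" "\<And>s. c < s \<Longrightarrow> s < t \<Longrightarrow> dist (x s) L < \<epsilon> / 2"
    unfolding eventually_at_left_field by blast
  have "\<bar>x r - x s\<bar> < \<epsilon>" if "r \<in> {t - (t - c)<..<t}" "s \<in> {t - (t - c)<..<t}" for r s
  proof -
    have "\<bar>x r - L\<bar> < \<epsilon> / 2" "\<bar>x s - L\<bar> < \<epsilon> / 2"
      using c(2)[of r] c(2)[of s] that by (auto simp: dist_real_def)
    then show ?thesis by linarith
  qed
  then show ?thesis using c(1) by (intro exI[of _ "t - c"]) auto
qed

definition grid_ceiling :: "nat \<Rightarrow> real \<Rightarrow> real" where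
  "grid_ceiling n t = real_of_int \<lceil>real n * t\<rceil> / real n"

lemma grid_ceiling_bounds:
  assumes "0 < n"
  shows "t \<le> grid_ceiling n t" "grid_ceiling n t \<le> t + 1 / real n"
  using assms ceiling_correct[of "real n * t"] unfolding grid_ceiling_def by (auto simp: field_simps)

text \<open>Partial time changes on \<open>[a, b]\<close>, moving the end points to the next grid points, after which
  the values of \<open>x\<close> on the grid \<open>1/n\<close> reproduce \<open>x\<close> up to \<open>\<epsilon>\<close>.\<close>

definition grid_change :: "(real \<Rightarrow> real) \<Rightarrow> real \<Rightarrow> nat \<Rightarrow> real \<Rightarrow> real \<Rightarrow> (real \<Rightarrow> real) \<Rightarrow> bool" where
  "grid_change x \<epsilon> n a b l \<longleftrightarrow> strict_mono_on {a..b} l \<and> continuous_on {a..b} l \<and>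
     l a = grid_ceiling n a \<and> l b = grid_ceiling n b \<and> (\<forall>t\<in>{a..b}. \<bar>l t - t\<bar> \<le> 1 / real n) \<and>
     (\<forall>t\<in>{a..<b}. \<bar>x (real_of_int \<lfloor>real n * l t\<rfloor> / real n) - x t\<bar> < \<epsilon>)"

text \<open>Both changes send \<open>b\<close> to the same grid point, so the glued function is
  continuous and strictly increasing. Closeness is asked on half-open intervals only, so a jump of
  \<open>x\<close> at \<open>b\<close> belongs to the second piece.\<close>

lemma grid_change_join:
  assumes l: "grid_change x \<epsilon> n a b l" and k: "grid_change x \<epsilon> n b c k" and "a \<le> b" "b \<le> c"
  shows "grid_change x \<epsilon> n a c (\<lambda>t. if t < b then l t else k t)"
proof -
  have lk: "l b = k b" using l k unfolding grid_change_def by simp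
  have "strict_mono_on {a..c} (\<lambda>t. if t < b then l t else k t)"
  proof (rule strict_mono_onI)
    fix r s assume rs: "r \<in> {a..c}" "s \<in> {a..c}" "r < s"
    have lm: "l p < l q" if "a \<le> p" "p < q" "q \<le> b" for p q
      using l that unfolding grid_change_def strict_mono_on_def by auto
    have km: "k p < k q" if "b \<le> p" "p < q" "q \<le> c" for p q
      using k that unfolding grid_change_def strict_mono_on_def by auto
    have "l r < l b" if "r < b" using lm[of r b] that rs by auto
    moreover have "k b \<le> k s" if "b \<le> s" using km[of b s] that rs by (cases "s = b") auto
    ultimately show "(if r < b then l r else k r) < (if s < b then l s else k s)"
      using lm[of r s] km[of r s] lk rs by (auto simp: not_less)
  qed
  moreover have "continuous_on {a..c} (\<lambda>t. if t < b then l t else k t)"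
  proof -
    have "continuous_on ({a..b} \<union> {b..c}) (\<lambda>t. if t < b then l t else k t)"
      using l k lk unfolding grid_change_def
      by (intro continuous_on_If) auto
    moreover have "{a..b} \<union> {b..c} = {a..c}" using assms(3,4) by auto
    ultimately show ?thesis by simp
  qed
  ultimately show ?thesis
    using l k lk assms(3,4) unfolding grid_change_def by auto
qed

text \<open>The displacement is a convex combination of those at the end points, hence lies in
  \<open>[0, 1 / n]\<close>. On \<open>[a, b)\<close> the values stay in
  \<open>[grid_ceiling n a, grid_ceiling n b)\<close>; rounding them down to the grid gives points
  of \<open>[a, b)\<close>, where the oscillation of \<open>x\<close> is below
  \<open>\<epsilon>\<close>.\<close>

lemma grid_change_linear:
  assumes "a < b" and osc: "\<And>r s. r \<in> {a..<b} \<Longrightarrow> s \<in> {a..<b} \<Longrightarrow> \<bar>x r - x s\<bar> < \<epsilon>"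
    and n: "1 / (b - a) < real n"
  shows "grid_change x \<epsilon> n a b
    (\<lambda>t. grid_ceiling n a + (t - a) / (b - a) * (grid_ceiling n b - grid_ceiling n a))"
    (is "grid_change x \<epsilon> n a b ?l")
proof -
  let ?A = "grid_ceiling n a" and ?B = "grid_ceiling n b"
  have "0 < 1 / (b - a)" using assms(1) by simp
  then have n0: "0 < real n" using n by linarith
  then have n0: "0 < real n" "0 < n" by auto
  \<comment> \<open>The mesh is finer than the interval, so \<open>a\<close> and \<open>b\<close>
    are rounded to different grid points.\<close>
  have "1 < real n * (b - a)" using n assms(1) by (simp add: field_simps)
  then have "\<lceil>real n * a\<rceil> < \<lceil>real n * b\<rceil>"
    using ceiling_correct[of "real n * a"] ceiling_correct[of "real n * b"]
    by (simp add: right_diff_distrib) linarith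
  then have AB: "?A < ?B" unfolding grid_ceiling_def using n0 by (simp add: divide_strict_right_mono)
  have mono: "?l s < ?l t" if "s < t" for s t
    using that AB assms(1) by (simp add: divide_strict_right_mono)
  have la: "?l a = ?A" and lb: "?l b = ?B" using assms(1) by auto
  have conv: "\<bar>?l t - t\<bar> \<le> 1 / real n" if "t \<in> {a..b}" for t
  proof -
    define c where "c = (t - a) / (b - a)"
    have c: "0 \<le> c" "c \<le> 1" unfolding c_def using that assms(1) by auto
    have "c * (b - a) = t - a" unfolding c_def using assms(1) by simp
    then have "t = a + c * (b - a)" by simp
    then have eq: "?l t - t = (1 - c) * (?A - a) + c * (?B - b)"
      unfolding c_def[symmetric] by (simp add: algebra_simps)
    have "0 \<le> (1 - c) * (?A - a) + c * (?B - b)"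
      using c grid_ceiling_bounds(1)[OF n0(2)] by (intro add_nonneg_nonneg mult_nonneg_nonneg) auto
    moreover have "(1 - c) * (?A - a) + c * (?B - b) \<le> (1 - c) * (1 / real n) + c * (1 / real n)"
      using c grid_ceiling_bounds(2)[OF n0(2), of a] grid_ceiling_bounds(2)[OF n0(2), of b]
      by (intro add_mono mult_left_mono) auto
    moreover have "(1 - c) * (1 / real n) + c * (1 / real n) = 1 / real n"
      by (subst distrib_right[symmetric]) simp
    ultimately show ?thesis using eq by simp
  qed
  have close: "\<bar>x (real_of_int \<lfloor>real n * ?l t\<rfloor> / real n) - x t\<bar> < \<epsilon>" if t: "t \<in> {a..<b}" for t
  proof (rule osc[OF _ t])
    have "?A \<le> ?l t" using mono[of a t] t la by (cases "t = a") auto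
    then have "real n * ?A \<le> real n * ?l t" using n0 by simp
    then have "real_of_int \<lceil>real n * a\<rceil> \<le> real n * ?l t" unfolding grid_ceiling_def using n0 by simp
    then have 1: "\<lceil>real n * a\<rceil> \<le> \<lfloor>real n * ?l t\<rfloor>" by (simp add: le_floor_iff)
    have "?l t < ?B" using mono[of t b] t lb by auto
    then have "real n * ?l t < real n * ?B" using n0 by simp
    then have "real n * ?l t < real_of_int \<lceil>real n * b\<rceil>" unfolding grid_ceiling_def using n0 by simp
    then have 2: "\<lfloor>real n * ?l t\<rfloor> < \<lceil>real n * b\<rceil>" by (simp add: floor_less_iff)
    from 1 have "real n * a \<le> real_of_int \<lfloor>real n * ?l t\<rfloor>" by (simp add: ceiling_le_iff)
    moreover from 2 have "real_of_int \<lfloor>real n * ?l t\<rfloor> < real n * b" by (simp add: less_ceiling_iff)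
    ultimately show "real_of_int \<lfloor>real n * ?l t\<rfloor> / real n \<in> {a..<b}"
      using n0 by (simp add: field_simps)
  qed
  show ?thesis
    unfolding grid_change_def
    by (intro conjI strict_mono_onI ballI la lb conv close mono continuous_intros) (use assms(1) in auto)
qed

text \<open>Bisection (\<open>Bolzano\<close>) replaces the choice of a finite partition with small
  oscillations. A short interval around \<open>t\<close> is cut at \<open>t\<close>:
  right-continuity controls the part from \<open>t\<close> on, the left limit the part before
  it.\<close>

lemma cadlag_grid_change:
  assumes x: "cadlag x" and "0 < \<epsilon>" and "0 \<le> T"
  shows "\<exists>N. \<forall>n\<ge>N. 0 < n \<longrightarrow> (\<exists>l. grid_change x \<epsilon> n 0 T l)"
proof -
  \<comment> \<open>The conditions on \<open>a\<close> and \<open>b\<close> are built into the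
    predicate because \<open>Bolzano\<close> also asks about intervals reaching to the left of
    0.\<close>
  let ?P = "\<lambda>a b. 0 \<le> a \<longrightarrow> a \<le> b \<longrightarrow> (\<exists>N. \<forall>n\<ge>N. 0 < n \<longrightarrow> (\<exists>l. grid_change x \<epsilon> n a b l))"
  have P_trans: "?P a c" if P1: "?P a b" and P2: "?P b c" and ab: "a \<le> b" "b \<le> c" for a b c
  proof (intro impI)
    assume "0 \<le> a" "a \<le> c"
    obtain N1 where N1: "\<And>n. n \<ge> N1 \<Longrightarrow> 0 < n \<Longrightarrow> \<exists>l. grid_change x \<epsilon> n a b l"
      using P1 \<open>0 \<le> a\<close> ab by metis
    obtain N2 where N2: "\<And>n. n \<ge> N2 \<Longrightarrow> 0 < n \<Longrightarrow> \<exists>l. grid_change x \<epsilon> n b c l"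
      using P2 \<open>0 \<le> a\<close> ab by (meson order_trans)
    have "\<exists>l. grid_change x \<epsilon> n a c l" if "n \<ge> max N1 N2" "0 < n" for n
      using N1[of n] N2[of n] that grid_change_join ab by (metis max.bounded_iff)
    then show "\<exists>N. \<forall>n\<ge>N. 0 < n \<longrightarrow> (\<exists>l. grid_change x \<epsilon> n a c l)" by blast
  qed
  have triv: "?P a a" for a
  proof (intro impI exI[of _ "0::nat"] allI)
    fix n :: nat assume "0 < n"
    then show "\<exists>l. grid_change x \<epsilon> n a a l"
      using grid_ceiling_bounds[of n a]
      by (intro exI[of _ "\<lambda>_. grid_ceiling n a"]) (auto simp: grid_change_def strict_mono_on_def)
  qed
  have piece: "?P a b" if "\<And>r s. r \<in> {a..<b} \<Longrightarrow> s \<in> {a..<b} \<Longrightarrow> \<bar>x r - x s\<bar> < \<epsilon>" for a b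
  proof (cases "a < b")
    case True
    obtain N where N: "1 / (b - a) < real N" using reals_Archimedean2 by blast
    have "grid_change x \<epsilon> n a b
        (\<lambda>t. grid_ceiling n a + (t - a) / (b - a) * (grid_ceiling n b - grid_ceiling n a))"
      if "N \<le> n" for n
      using N that by (intro grid_change_linear[OF True]) (use \<open>\<And>r s. _ \<Longrightarrow> _ \<Longrightarrow> \<bar>x r - x s\<bar> < \<epsilon>\<close> in auto)
    then show ?thesis by blast
  next
    case False
    show ?thesis
    proof (intro impI)
      assume "a \<le> b"
      with False have "a = b" by simp
      assume "0 \<le> a"
      then show "\<exists>N. \<forall>n\<ge>N. 0 < n \<longrightarrow> (\<exists>l. grid_change x \<epsilon> n a b l)"
        using triv[of a] \<open>a = b\<close> by auto
    qed
  qed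
  have "?P 0 T"
  proof (rule Bolzano[OF \<open>0 \<le> T\<close>, where P = ?P])
    show "?P a c" if "?P a b" "?P b c" "a \<le> b" "b \<le> c" for a b c
      using that by (rule P_trans)
  next
    fix t assume local: "0 \<le> t" "t \<le> T"
    obtain d1 where d1: "0 < d1" "\<And>r s. r \<in> {t..<t + d1} \<Longrightarrow> s \<in> {t..<t + d1} \<Longrightarrow> \<bar>x r - x s\<bar> < \<epsilon>"
      using cadlag_oscillation_right[OF x local(1) \<open>0 < \<epsilon>\<close>] by blast
    obtain d2 where d2: "0 < d2"
      "0 < t \<longrightarrow> (\<forall>r\<in>{t - d2<..<t}. \<forall>s\<in>{t - d2<..<t}. \<bar>x r - x s\<bar> < \<epsilon>)"
      using cadlag_oscillation_left[OF x _ \<open>0 < \<epsilon>\<close>, of t] by (cases "0 < t") (blast, meson zero_less_one)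
    show "\<exists>d>0. \<forall>a b. a \<le> t \<and> t \<le> b \<and> b - a < d \<longrightarrow> ?P a b"
    proof (intro exI[of _ "min d1 d2"] conjI allI impI)
      show "0 < min d1 d2" using d1(1) d2(1) by simp
      fix a b assume ab: "a \<le> t \<and> t \<le> b \<and> b - a < min d1 d2" and "0 \<le> a" "a \<le> b"
      have "?P t b" using ab by (intro piece d1(2)) auto
      moreover have "?P a t"
      proof (cases "a < t")
        case True
        then show ?thesis using ab \<open>0 \<le> a\<close> by (intro piece d2(2)[rule_format]) auto
      next
        case False
        then have "a = t" using ab by simp
        then show ?thesis using triv[of t] by simp
      qed
      ultimately have "?P a b" using ab by (intro P_trans[of a t b]) auto
      then show "\<exists>N. \<forall>n\<ge>N. 0 < n \<longrightarrow> (\<exists>l. grid_change x \<epsilon> n a b l)"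
        using \<open>0 \<le> a\<close> \<open>a \<le> b\<close> by blast
    qed
  qed
  then show ?thesis using \<open>0 \<le> T\<close> by blast
qed

text \<open>Step functions with integer multiples of \<open>1/n\<close> as jump times and values; the list makes
  their countability evident.\<close>

definition grid_step :: "nat \<Rightarrow> int list \<Rightarrow> real \<Rightarrow> real" where
  "grid_step n vs = (\<lambda>t\<in>{0..}. let i = nat \<lfloor>real n * t\<rfloor> in
     if i < length vs then real_of_int (vs ! i) / real n else 0)"

text \<open>The \<open>n * n\<close> samples of mesh \<open>1 / n\<close> reach up to time
  \<open>n\<close>, so every fixed horizon is eventually covered; rounding the values leaves only
  countably many lists.\<close>

definition grid_values :: "nat \<Rightarrow> (real \<Rightarrow> real) \<Rightarrow> int list" where
  "grid_values n x = map (\<lambda>i. \<lfloor>real n * x (real i / real n)\<rfloor>) [0..<n * n]"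

lemma grid_step_skorokhod:
  assumes "0 < n"
  shows "grid_step n vs \<in> skorokhod_space"
proof -
  let ?v = "\<lambda>i::int. if nat i < length vs then real_of_int (vs ! nat i) / real n else 0"
  have val: "grid_step n vs t = ?v \<lfloor>real n * t\<rfloor>" if "0 \<le> t" for t
    using that unfolding grid_step_def by (simp add: Let_def)
  have n: "0 < real n" using assms by simp
  have "continuous (at_right t) (grid_step n vs)" if t: "0 \<le> t" for t
  proof -
    have "\<forall>\<^sub>F s in at_right t. grid_step n vs s = grid_step n vs t"
      unfolding eventually_at_right_field
    proof (intro exI conjI allI impI)
      show "t < (real_of_int \<lfloor>real n * t\<rfloor> + 1) / real n"
        using n floor_correct[of "real n * t"] by (simp add: field_simps)
      fix s assume s: "t < s" "s < (real_of_int \<lfloor>real n * t\<rfloor> + 1) / real n"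
      have "real n * s < real_of_int \<lfloor>real n * t\<rfloor> + 1" using s(2) n by (simp add: field_simps)
      moreover have "real_of_int \<lfloor>real n * t\<rfloor> \<le> real n * s"
        using n s(1) floor_correct[of "real n * t"] by (meson less_imp_le mult_left_mono order_trans)
      ultimately have "\<lfloor>real n * s\<rfloor> = \<lfloor>real n * t\<rfloor>" by (intro floor_unique) auto
      then show "grid_step n vs s = grid_step n vs t" using val t s by simp
    qed
    then show ?thesis unfolding continuous_within by (rule tendsto_eventually)
  qed
  moreover have "\<exists>l. (grid_step n vs \<longlongrightarrow> l) (at_left t)" if t: "0 < t" for t
  proof -
    have "\<forall>\<^sub>F s in at_left t. grid_step n vs s = ?v (\<lceil>real n * t\<rceil> - 1)"
      unfolding eventually_at_left_field
    proof (intro exI conjI allI impI)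
      show "(real_of_int \<lceil>real n * t\<rceil> - 1) / real n < t"
        using n ceiling_correct[of "real n * t"] by (simp add: field_simps)
      fix s assume s: "(real_of_int \<lceil>real n * t\<rceil> - 1) / real n < s" "s < t"
      have "0 < \<lceil>real n * t\<rceil>" using n t by (simp add: less_ceiling_iff)
      then have "0 \<le> (real_of_int \<lceil>real n * t\<rceil> - 1) / real n" using n by simp
      then have s0: "0 \<le> s" using s(1) by linarith
      have "real_of_int \<lceil>real n * t\<rceil> - 1 < real n * s" using s(1) n by (simp add: field_simps)
      moreover have "real n * s < real_of_int \<lceil>real n * t\<rceil>"
        using n s(2) ceiling_correct[of "real n * t"] by (meson less_le_trans mult_strict_left_mono)
      ultimately have "\<lfloor>real n * s\<rfloor> = \<lceil>real n * t\<rceil> - 1" by (intro floor_unique) auto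
      then show "grid_step n vs s = ?v (\<lceil>real n * t\<rceil> - 1)" using val[OF s0] by simp
    qed
    then show ?thesis using tendsto_eventually by blast
  qed
  moreover have "grid_step n vs \<in> extensional {0..}" unfolding grid_step_def by simp
  ultimately show ?thesis unfolding skorokhod_space_def cadlag_def by blast
qed

lemma grid_step_J1_approx:
  assumes x: "x \<in> skorokhod_space" and e: "0 < e"
  shows "\<forall>\<^sub>F n in sequentially. grid_step n (grid_values n x) \<in> J1_nbhd x T e"
proof -
  \<comment> \<open>A horizon beyond \<open>T\<close>: grid changes control only the half-open
    \<open>[0, T')\<close>, while the neighbourhood asks about all of \<open>[0, T]\<close>. The
    accuracy \<open>e / 4\<close> leaves another \<open>e / 4\<close> for rounding the
    values.\<close>
  define T' where "T' = \<bar>T\<bar> + 1"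
  have T': "0 < T'" "T < T'" unfolding T'_def by auto
  have "cadlag x" using x unfolding skorokhod_space_def by simp
  then obtain N where N: "\<And>n. n \<ge> N \<Longrightarrow> 0 < n \<Longrightarrow> \<exists>l. grid_change x (e / 4) n 0 T' l"
    using cadlag_grid_change[of x "e / 4" T'] e T' by auto
  obtain N' where N': "max (4 / e) (T' + 1) < real N'" using reals_Archimedean2 by blast
  show ?thesis
    unfolding eventually_sequentially
  proof (intro exI[of _ "max N (max N' 1)"] allI impI)
    fix n assume "max N (max N' 1) \<le> n"
    then have n: "N \<le> n" "N' \<le> n" "0 < n" by auto
    have "real N' \<le> real n" using n by simp
    then have n': "4 / e < real n" "T' + 1 < real n" "0 < real n" using N' n by linarith+
    then have ne: "1 / real n < e / 4" using e by (simp add: field_simps)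
    obtain l where "grid_change x (e / 4) n 0 T' l" using N n by blast
    then have l: "strict_mono_on {0..T'} l" "continuous_on {0..T'} l" "l 0 = 0"
      "\<And>t. t \<in> {0..T'} \<Longrightarrow> \<bar>l t - t\<bar> \<le> 1 / real n"
      "\<And>t. t \<in> {0..<T'} \<Longrightarrow> \<bar>x (real_of_int \<lfloor>real n * l t\<rfloor> / real n) - x t\<bar> < e / 4"
      unfolding grid_change_def by (auto simp: grid_ceiling_def)
    \<comment> \<open>Continuing with slope 1 keeps the displacement at its value in
      \<open>T'\<close> and makes the change onto.\<close>
    define k where "k t = (if t \<le> T' then l t else l T' + (t - T'))" for t
    have mono: "strict_mono_on {0..} k"
    proof (rule strict_mono_onI)
      fix r s :: real assume rs: "r \<in> {0..}" "s \<in> {0..}" "r < s"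
      have lm: "l p < l q" if "0 \<le> p" "p < q" "q \<le> T'" for p q
        using l(1) that unfolding strict_mono_on_def by auto
      have "l r \<le> l T'" if "r \<le> T'" using lm[of r T'] that rs by (cases "r = T'") auto
      then show "k r < k s" unfolding k_def using lm[of r s] rs by auto
    qed
    have cont: "continuous_on {0..} k"
    proof -
      have "continuous_on ({0..T'} \<union> {T'..}) k"
        unfolding k_def using l(2) by (intro continuous_on_If continuous_intros) auto
      moreover have "{0..T'} \<union> {T'..} = {0..}" using T' by auto
      ultimately show ?thesis by simp
    qed
    have kt: "\<bar>k t - t\<bar> \<le> 1 / real n" if "0 \<le> t" for t
      using l(4)[of t] l(4)[of T'] that T' unfolding k_def by auto
    have "k ` {0..} = {0..}"
    proof (intro equalityI subsetI)
      fix y assume "y \<in> k ` {0..}"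
      then obtain t where t: "0 \<le> t" "y = k t" by auto
      have "k 0 = 0" unfolding k_def using l(3) T' by simp
      then show "y \<in> {0..}" using strict_mono_on_leD[OF mono, of 0 t] t by auto
    next
      fix y :: real assume "y \<in> {0..}"
      then have y: "0 \<le> y" by simp
      have "1 / real n \<le> 1" using n(3) by simp
      then have "y \<le> k (y + 1)" using kt[of "y + 1"] y by linarith
      moreover have "k 0 \<le> y" unfolding k_def using l(3) T' y by simp
      ultimately obtain t where "0 \<le> t" "t \<le> y + 1" "k t = y"
        using IVT'[of k 0 y "y + 1"] continuous_on_subset[OF cont] y by auto
      then show "y \<in> k ` {0..}" by auto
    qed
    then have tc: "time_change k" unfolding time_change_def using mono cont by simp
    have close: "\<bar>grid_step n (grid_values n x) (k t) - x t\<bar> \<le> e / 2" if t: "t \<in> {0..T}" for t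
    proof -
      have t': "t \<in> {0..<T'}" using t T' by auto
      have kl: "k t = l t" unfolding k_def using t' by simp
      have l0: "0 \<le> l t" using time_change_nonneg[OF tc, of t] t kl by simp
      define i where "i = nat \<lfloor>real n * l t\<rfloor>"
      have i: "real i = real_of_int \<lfloor>real n * l t\<rfloor>" unfolding i_def using l0 by simp
      have "l t < real n" using l(4)[of t] t' n'(2) n(3) ne e
        by (auto simp: abs_le_iff) (smt (verit) divide_le_eq_1_pos n'(3) of_nat_1 of_nat_le_iff Suc_leI One_nat_def)
      then have "real n * l t < real n * real n" using n' by simp
      then have "real i < real (n * n)" unfolding i using floor_correct[of "real n * l t"] by simp linarith
      then have "i < n * n" by linarith
      then have "grid_step n (grid_values n x) (k t) = real_of_int \<lfloor>real n * x (real i / real n)\<rfloor> / real n"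
        unfolding grid_step_def grid_values_def kl using l0 by (simp add: Let_def i_def)
      moreover have "\<bar>real_of_int \<lfloor>real n * x (real i / real n)\<rfloor> / real n - x (real i / real n)\<bar> \<le> 1 / real n"
      proof -
        have "\<bar>real_of_int \<lfloor>real n * x (real i / real n)\<rfloor> - real n * x (real i / real n)\<bar> / real n \<le> 1 / real n"
          using floor_correct[of "real n * x (real i / real n)"] n' by (intro divide_right_mono) linarith+
        also have "\<bar>real_of_int \<lfloor>real n * x (real i / real n)\<rfloor> - real n * x (real i / real n)\<bar> / real n =
            \<bar>(real_of_int \<lfloor>real n * x (real i / real n)\<rfloor> - real n * x (real i / real n)) / real n\<bar>"
          by (simp add: abs_divide)
        finally show ?thesis using n'(3) by (simp add: diff_divide_distrib)
      qed
      ultimately show ?thesis using l(5)[OF t'] ne unfolding i[symmetric] by linarith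
    qed
    have "\<bar>k t - t\<bar> \<le> e / 2" if "0 \<le> t" for t using kt[OF that] ne e by linarith
    moreover have "e / 2 < e" using e by simp
    ultimately show "grid_step n (grid_values n x) \<in> J1_nbhd x T e"
      unfolding J1_nbhd_def using grid_step_skorokhod[OF n(3)] tc close by blast
  qed
qed

text \<open>Each approximation \<open>A n\<close> is determined by finitely many coordinates of
  \<open>Z\<close> and takes countably many values, so \<open>A n \<omega> \<in> B\<close> is
  measurable for every set \<open>B\<close>. An open \<open>U\<close> is recovered from step
  functions as centres: \<open>Z \<omega>\<close> lies in \<open>U\<close> exactly when
  \<open>A n \<omega>\<close> eventually stays close to some centre that has a larger neighbourhood
  inside \<open>U\<close>, and there are countably many centres and sizes.\<close>

lemma measurable_J1:
  assumes meas: "\<And>u. 0 \<le> u \<Longrightarrow> (\<lambda>\<omega>. Z \<omega> u) \<in> borel_measurable M"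
    and space: "\<And>\<omega>. \<omega> \<in> space M \<Longrightarrow> Z \<omega> \<in> skorokhod_space"
  shows "Z \<in> M \<rightarrow>\<^sub>M borel_of J1_topology"
  unfolding borel_of_def
proof (rule measurable_measure_of)
  show "{U. openin J1_topology U} \<subseteq> Pow (topspace J1_topology)"
    using openin_subset[of J1_topology] by blast
  show "Z \<in> space M \<rightarrow> topspace J1_topology" using space by auto
  fix U assume "U \<in> {U. openin J1_topology U}"
  then have U: "openin J1_topology U" by simp
  define A where "A n \<omega> = grid_step n (grid_values n (Z \<omega>))" for n \<omega>
  have vals: "{\<omega> \<in> space M. grid_values n (Z \<omega>) = vs} \<in> sets M" for n vs
  proof (cases "length vs = n * n")
    case True
    have "{\<omega> \<in> space M. grid_values n (Z \<omega>) = vs} =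
        {\<omega> \<in> space M. \<forall>i\<in>{..<n * n}. \<lfloor>real n * Z \<omega> (real i / real n)\<rfloor> = vs ! i}"
      using True unfolding grid_values_def by (auto simp: list_eq_iff_nth_eq)
    also have "\<dots> \<in> sets M"
    proof (intro sets.sets_Collect_finite_All)
      fix i assume "i \<in> {..<n * n}"
      have [measurable]: "(\<lambda>\<omega>. Z \<omega> (real i / real n)) \<in> borel_measurable M" by (rule meas) simp
      show "{\<omega> \<in> space M. \<lfloor>real n * Z \<omega> (real i / real n)\<rfloor> = vs ! i} \<in> sets M"
        unfolding floor_eq_iff by measurable
    qed auto
    finally show ?thesis .
  next
    case False
    then have "{\<omega> \<in> space M. grid_values n (Z \<omega>) = vs} = {}" unfolding grid_values_def by auto
    then show ?thesis by (simp only: sets.empty_sets)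
  qed
  have A_meas: "{\<omega> \<in> space M. A n \<omega> \<in> B} \<in> sets M" for n B
  proof -
    have "{\<omega> \<in> space M. A n \<omega> \<in> B} =
        (\<Union>vs\<in>{vs. grid_step n vs \<in> B}. {\<omega> \<in> space M. grid_values n (Z \<omega>) = vs})"
      unfolding A_def by auto
    also have "\<dots> \<in> sets M" using vals by (intro sets.countable_UN') auto
    finally show ?thesis .
  qed
  have A_lim: "\<forall>\<^sub>F n in sequentially. A n \<omega> \<in> J1_nbhd (Z \<omega>) T e" if "\<omega> \<in> space M" "0 < e" for \<omega> T e
    unfolding A_def using grid_step_J1_approx[OF space[OF that(1)] that(2)] .
  \<comment> \<open>The gap between \<open>1 / m\<close> and \<open>3 / m\<close> is room for the
    limit: if \<open>A n \<omega>\<close> is within \<open>1 / m\<close> of the centre, then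
    \<open>Z \<omega>\<close> is within \<open>2 / m\<close>. The horizons from \<open>m\<close> to
    \<open>m + 4\<close> allow for the loss, at most one unit, in each inversion or composition of
    time changes.\<close>
  define I where "I = {(k, vs, m). 0 < m \<and> J1_nbhd (grid_step k vs) (real m) (3 / real m) \<subseteq> U}"
  have "Z -` U \<inter> space M = (\<Union>(k, vs, m)\<in>I. {\<omega> \<in> space M.
      \<forall>\<^sub>F n in sequentially. A n \<omega> \<in> J1_nbhd (grid_step k vs) (real m + 2) (1 / real m)})"
    (is "_ = ?R")
  proof (intro equalityI subsetI)
    fix \<omega> assume "\<omega> \<in> Z -` U \<inter> space M"
    then have \<omega>: "Z \<omega> \<in> U" "\<omega> \<in> space M" by auto
    obtain T e where Te: "0 < T" "0 < e" "J1_nbhd (Z \<omega>) T e \<subseteq> U"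
      using U \<omega>(1) unfolding openin_J1_topology by blast
    \<comment> \<open>The bound \<open>4 / m < e\<close> accommodates a centre within
      \<open>1 / (2 * m)\<close> of \<open>Z \<omega>\<close> together with its neighbourhood of
      size \<open>3 / m\<close>.\<close>
    obtain m where m: "max (T + 1) (4 / e) < real m" using reals_Archimedean2 by blast
    then have m0: "1 < real m" and "4 / e < real m" using Te by auto
    then have me: "4 / real m < e" using Te(2) by (simp add: field_simps)
    have mpos: "0 < 1 / (2 * real m)" "1 / (2 * real m) \<le> 1" "1 / (2 * real m) + 1 / (2 * real m) = 1 / real m"
      using m0 by (auto simp: field_simps)
    have lim: "\<forall>\<^sub>F n in sequentially. A n \<omega> \<in> J1_nbhd (Z \<omega>) (real m + 4) (1 / (2 * real m))"
      using A_lim[OF \<omega>(2) mpos(1)] .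
    then obtain k where k: "A k \<omega> \<in> J1_nbhd (Z \<omega>) (real m + 4) (1 / (2 * real m))"
      by (meson eventually_happens' sequentially_bot)
    have Zk: "Z \<omega> \<in> J1_nbhd (A k \<omega>) (real m + 3) (1 / (2 * real m))"
      using mpos by (intro J1_nbhd_sym[OF k space[OF \<omega>(2)]]) auto
    define vs where "vs = grid_values k (Z \<omega>)"
    have Ak: "A k \<omega> = grid_step k vs" unfolding A_def vs_def ..
    have "J1_nbhd (A k \<omega>) (real m) (3 / real m) \<subseteq> U"
    proof
      fix y assume y: "y \<in> J1_nbhd (A k \<omega>) (real m) (3 / real m)"
      have "A k \<omega> \<in> J1_nbhd (Z \<omega>) T (1 / (2 * real m))"
        using k m J1_nbhd_mono[of T "real m + 4" "1 / (2 * real m)" "1 / (2 * real m)"] by auto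
      moreover have "T + 1 / (2 * real m) \<le> real m" using m mpos(2) by linarith
      ultimately have "y \<in> J1_nbhd (Z \<omega>) T (1 / (2 * real m) + 3 / real m)"
        using J1_nbhd_trans y by blast
      moreover have "1 / (2 * real m) + 3 / real m \<le> 4 / real m" using m0 by (simp add: field_simps)
      then have "1 / (2 * real m) + 3 / real m \<le> e" using me by linarith
      ultimately show "y \<in> U"
        using Te(3) J1_nbhd_mono[of T T "1 / (2 * real m) + 3 / real m" e "Z \<omega>"] by auto
    qed
    then have "(k, vs, m) \<in> I" unfolding I_def using m0 Ak by auto
    moreover have "\<forall>\<^sub>F n in sequentially. A n \<omega> \<in> J1_nbhd (grid_step k vs) (real m + 2) (1 / real m)"
      using lim
    proof eventually_elim
      case (elim n)
      have "Z \<omega> \<in> J1_nbhd (A k \<omega>) (real m + 2) (1 / (2 * real m))"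
        using Zk J1_nbhd_mono[of "real m + 2" "real m + 3" "1 / (2 * real m)" "1 / (2 * real m)"] by auto
      from J1_nbhd_trans[OF this elim] show ?case using mpos Ak by auto
    qed
    ultimately show "\<omega> \<in> ?R" using \<omega>(2) by auto
  next
    fix \<omega> assume "\<omega> \<in> ?R"
    then obtain k vs m where \<omega>: "(k, vs, m) \<in> I" "\<omega> \<in> space M"
      "\<forall>\<^sub>F n in sequentially. A n \<omega> \<in> J1_nbhd (grid_step k vs) (real m + 2) (1 / real m)" by auto
    have m: "0 < m" "J1_nbhd (grid_step k vs) (real m) (3 / real m) \<subseteq> U" using \<omega>(1) unfolding I_def by auto
    then have m1: "0 < 1 / real m" "1 / real m \<le> 1" "1 \<le> real m" by auto
    obtain n where n: "A n \<omega> \<in> J1_nbhd (grid_step k vs) (real m + 2) (1 / real m)"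
      "A n \<omega> \<in> J1_nbhd (Z \<omega>) (real m + 4) (1 / real m)"
      using eventually_happens'[OF sequentially_bot eventually_conj[OF \<omega>(3) A_lim[OF \<omega>(2) m1(1)]]] by blast
    have "Z \<omega> \<in> J1_nbhd (A n \<omega>) (real m + 3) (1 / real m)"
      using m1 by (intro J1_nbhd_sym[OF n(2) space[OF \<omega>(2)]]) auto
    from J1_nbhd_trans[OF n(1) this] have "Z \<omega> \<in> J1_nbhd (grid_step k vs) (real m + 2) (1 / real m + 1 / real m)"
      using m1 by auto
    moreover have "1 / real m + 1 / real m \<le> 3 / real m" using m1 by (simp add: field_simps)
    ultimately have "Z \<omega> \<in> U"
      using m(2) J1_nbhd_mono[of "real m" "real m + 2" "1 / real m + 1 / real m" "3 / real m" "grid_step k vs"] by auto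
    then show "\<omega> \<in> Z -` U \<inter> space M" using \<omega>(2) by simp
  qed
  also have "\<dots> \<in> sets M"
  proof (intro sets.countable_UN')
    show "(\<lambda>(k, vs, m). {\<omega> \<in> space M. \<forall>\<^sub>F n in sequentially.
        A n \<omega> \<in> J1_nbhd (grid_step k vs) (real m + 2) (1 / real m)}) ` I \<subseteq> sets M"
      unfolding eventually_sequentially
      by (auto intro!: sets.sets_Collect_countable_Ex sets.sets_Collect_countable_All
          sets.sets_Collect_imp A_meas sets.sets_Collect_const)
  qed auto
  finally show "Z -` U \<inter> space M \<in> sets M" .
qed

section \<open>Summation by parts for integrals of functions of bounded variation\<close>

text \<open>In contrast to \<open>bounded_variation_on\<close>, the bound is a parameter, because
  its growth compared with \<open>h R\<close> decides whether the normalised variation stays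
  bounded.\<close>

definition partition_sum_le :: "(real \<Rightarrow> real) \<Rightarrow> real \<Rightarrow> real \<Rightarrow> bool" where
  "partition_sum_le h R V \<longleftrightarrow> (\<forall>n p. mono_on {..n::nat} p \<and> p ` {..n} \<subseteq> {0..R} \<longrightarrow>
     (\<Sum>i<n. \<bar>h (p (Suc i)) - h (p i)\<bar>) \<le> V)"

lemma partition_sum_leD:
  assumes "partition_sum_le h R V" "\<And>i j. i \<le> j \<Longrightarrow> j \<le> n \<Longrightarrow> p i \<le> p j" "0 \<le> p 0" "p n \<le> R"
  shows "(\<Sum>i<n::nat. \<bar>h (p (Suc i)) - h (p i)\<bar>) \<le> V"
proof -
  have "mono_on {..n} p" using assms(2) by (intro mono_onI) auto
  moreover have "p i \<in> {0..R}" if "i \<le> n" for i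
    using assms(2)[of 0 i] assms(2)[of i n] assms(3,4) that by auto
  ultimately show ?thesis using assms(1) unfolding partition_sum_le_def by blast
qed

lemma partition_sum_le_bound:
  assumes "partition_sum_le h R V" "0 \<le> s" "s \<le> R"
  shows "\<bar>h s\<bar> \<le> \<bar>h 0\<bar> + V"
proof -
  have "(\<Sum>i<1::nat. \<bar>h (if Suc i = 0 then 0 else s) - h (if i = 0 then 0 else s)\<bar>) \<le> V"
    using assms(2,3) by (intro partition_sum_leD[OF assms(1)]) auto
  then show ?thesis by simp
qed

text \<open>Clipping at a point \<open>t1\<close> beyond which \<open>h\<close> is nondecreasing
  gives \<open>h s = h (min s t1) + h (max s t1) - h t1\<close>. The first part has a fixed
  variation, the second telescopes to at most \<open>h R - h t1\<close>. For \<open>t * R\<close> in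
  place of \<open>R\<close> and after division by \<open>h t\<close>, the bound converges by regular
  variation and divergence of \<open>h\<close>.\<close>

lemma partition_sum_le_eventually_nondecreasing:
  assumes bv: "\<And>T. 0 \<le> T \<Longrightarrow> bounded_variation_on 0 T h" and mono: "eventually_nondecreasing h"
  shows "\<exists>C R\<^sub>0. \<forall>R\<ge>R\<^sub>0. partition_sum_le h R (C + h R)"
proof -
  obtain t0 where t0: "0 < t0" "mono_on {t0<..} h" using mono unfolding eventually_nondecreasing_def by blast
  define t1 where "t1 = t0 + 1"
  have t1: "0 \<le> t1" "t0 < t1" unfolding t1_def using t0(1) by auto
  obtain V where V: "\<And>n p. mono_on {..n::nat} p \<Longrightarrow> p ` {..n} \<subseteq> {0..t1} \<Longrightarrow>
      (\<Sum>i<n. \<bar>h (p (Suc i)) - h (p i)\<bar>) \<le> V"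
    using bv[OF t1(1)] unfolding bounded_variation_on_def by metis
  have hm: "h r \<le> h s" if "t1 \<le> r" "r \<le> s" for r s
    using mono_onD[OF t0(2), of r s] that t1(2) by auto
  have "partition_sum_le h R (V - h t1 + h R)" if R: "t1 \<le> R" for R
    unfolding partition_sum_le_def
  proof (intro allI impI)
    fix n and p :: "nat \<Rightarrow> real" assume p: "mono_on {..n} p \<and> p ` {..n} \<subseteq> {0..R}"
    let ?l = "\<lambda>i. min (p i) t1" and ?u = "\<lambda>i. max (p i) t1"
    have pm: "p i \<le> p (Suc i)" if "i < n" for i using p that by (auto intro!: mono_onD[of _ p])
    have split: "h (p i) = h (?l i) + h (?u i) - h t1" for i by (auto simp: min_def max_def)
    have "(\<Sum>i<n. \<bar>h (p (Suc i)) - h (p i)\<bar>) \<le>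
        (\<Sum>i<n. \<bar>h (?l (Suc i)) - h (?l i)\<bar> + (h (?u (Suc i)) - h (?u i)))"
    proof (rule sum_mono)
      fix i assume "i \<in> {..<n}"
      then have "h (?u i) \<le> h (?u (Suc i))" using pm[of i] by (intro hm) auto
      then show "\<bar>h (p (Suc i)) - h (p i)\<bar> \<le> \<bar>h (?l (Suc i)) - h (?l i)\<bar> + (h (?u (Suc i)) - h (?u i))"
        using split[of i] split[of "Suc i"] by linarith
    qed
    also have "\<dots> = (\<Sum>i<n. \<bar>h (?l (Suc i)) - h (?l i)\<bar>) + (h (?u n) - h (?u 0))"
      by (simp only: sum.distrib sum_lessThan_telescope[of "\<lambda>i. h (?u i)"])
    also have "(\<Sum>i<n. \<bar>h (?l (Suc i)) - h (?l i)\<bar>) \<le> V"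
    proof (rule V)
      show "mono_on {..n} ?l" using p unfolding mono_on_def by (auto simp: min_le_iff_disj)
      show "?l ` {..n} \<subseteq> {0..t1}" using p t1(1) by auto
    qed
    also have "h (?u n) \<le> h R" using p R by (intro hm) auto
    finally have "(\<Sum>i<n. \<bar>h (p (Suc i)) - h (p i)\<bar>) \<le> V + (h R - h (?u 0))" by simp
    moreover have "h t1 \<le> h (?u 0)" by (intro hm) auto
    ultimately show "(\<Sum>i<n. \<bar>h (p (Suc i)) - h (p i)\<bar>) \<le> V - h t1 + h R" by simp
  qed
  then show ?thesis by (metis add_uminus_conv_diff)
qed

text \<open>The right end of the cell of the grid of mesh \<open>w\<close> that contains \<open>s\<close>; being strictly to the
  right of \<open>s\<close>, it is compatible with right-continuity.\<close>

definition grid_right :: "real \<Rightarrow> real \<Rightarrow> real" where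
  "grid_right w s = (real_of_int \<lfloor>s / w\<rfloor> + 1) * w"

lemma grid_right_bounds:
  assumes "0 < w"
  shows "s < grid_right w s" "grid_right w s \<le> s + w"
proof -
  have "s / w < real_of_int \<lfloor>s / w\<rfloor> + 1" "real_of_int \<lfloor>s / w\<rfloor> + 1 \<le> s / w + 1"
    using floor_correct[of "s / w"] by auto
  then show "s < grid_right w s" "grid_right w s \<le> s + w"
    using assms unfolding grid_right_def by (auto simp: field_simps)
qed

lemma tendsto_grid_right:
  assumes "continuous (at_right s) h" "0 < w"
  shows "(\<lambda>n. h (grid_right (w / real (Suc n)) s)) \<longlonglongrightarrow> h s"
proof -
  let ?g = "\<lambda>n. grid_right (w / real (Suc n)) s"
  have g: "s < ?g n" "?g n \<le> s + w / real (Suc n)" for n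
    using grid_right_bounds[of "w / real (Suc n)" s] assms(2) by simp_all
  have "(\<lambda>n. s + w / real (Suc n)) \<longlonglongrightarrow> s + 0"
    by (intro tendsto_add tendsto_const LIMSEQ_Suc[OF lim_const_over_n])
  then have "?g \<longlonglongrightarrow> s"
    using g by (intro tendsto_sandwich[of "\<lambda>_. s" ?g sequentially "\<lambda>n. s + w / real (Suc n)"])
      (auto intro!: always_eventually less_imp_le simp del: of_nat_Suc)
  then have "filterlim ?g (at_right s) sequentially"
    using g(1) by (auto simp only: filterlim_at greaterThan_iff intro!: always_eventually) (metis less_irrefl)
  with assms(1) show ?thesis
    unfolding continuous_within by (rule filterlim_compose)
qed

text \<open>The source of integration by parts: each increment of \<open>h\<close> is paired with
  the event \<open>i * w \<le> s\<close>. For \<open>s = U - y\<close>, summing or integrating over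
  \<open>y\<close> turns these events into values of the distribution function at
  \<open>U - i * w\<close>.\<close>

lemma grid_right_telescope:
  fixes h :: "real \<Rightarrow> real"
  assumes "0 < w" "0 \<le> s" "s < real m * w"
  shows "h (grid_right w s) = h 0 + (\<Sum>i<m. (h (real (Suc i) * w) - h (real i * w)) * of_bool (real i * w \<le> s))"
proof -
  define k where "k = nat \<lfloor>s / w\<rfloor>"
  have k: "real_of_int \<lfloor>s / w\<rfloor> = real k" unfolding k_def using assms by simp
  then have fl: "\<lfloor>s / w\<rfloor> = int k" by linarith
  have iff: "real i * w \<le> s \<longleftrightarrow> i < Suc k" for i
  proof -
    have "real i * w \<le> s \<longleftrightarrow> real i \<le> s / w" using assms(1) by (simp add: field_simps)
    also have "\<dots> \<longleftrightarrow> int i \<le> \<lfloor>s / w\<rfloor>" by (simp add: le_floor_iff)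
    also have "\<dots> \<longleftrightarrow> i < Suc k" unfolding fl by auto
    finally show ?thesis .
  qed
  have "Suc k \<le> m"
  proof -
    have "real k * w \<le> s" using iff[of k] by simp
    then have "real k * w < real m * w" using assms(3) by simp
    then show ?thesis using assms(1) by simp
  qed
  then have "(\<Sum>i<m. (h (real (Suc i) * w) - h (real i * w)) * of_bool (real i * w \<le> s)) =
      (\<Sum>i<Suc k. h (real (Suc i) * w) - h (real i * w))"
    unfolding iff by (intro sum.mono_neutral_cong_right) auto
  also have "\<dots> = h (real (Suc k) * w) - h 0"
    by (subst sum_lessThan_telescope[of "\<lambda>i. h (real i * w)"]) simp
  finally show ?thesis unfolding grid_right_def k by (simp add: add.commute)
qed

text \<open>Stands for the formula in which \<open>I U\<close> is \<open>h 0 * D U\<close> plus the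
  integral of \<open>D (U - s)\<close> against \<open>d h s\<close>, without constructing
  \<open>d h\<close>. Only meshes \<open>w / (n + 1)\<close> occur, so every grid refines the one of
  mesh \<open>w\<close> and can be compared with it block by block. Grid points beyond
  \<open>U\<close> evaluate \<open>D\<close> at negative arguments, where the instances below
  vanish.\<close>

definition summation_by_parts :: "(real \<Rightarrow> real) \<Rightarrow> (real \<Rightarrow> real) \<Rightarrow> (real \<Rightarrow> real) \<Rightarrow> bool" where
  "summation_by_parts h I D \<longleftrightarrow> (\<forall>U w m. 0 \<le> U \<longrightarrow> 0 < w \<longrightarrow> U < real m * w \<longrightarrow>
     (\<lambda>n. h 0 * D U + (\<Sum>i<m * Suc n. (h (real (Suc i) * (w / real (Suc n))) - h (real i * (w / real (Suc n)))) *
        D (U - real i * (w / real (Suc n))))) \<longlonglongrightarrow> I U)"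

lemma summation_by_parts_diff:
  assumes "summation_by_parts h I D" "summation_by_parts h I' D'"
  shows "summation_by_parts h (\<lambda>U. I U - I' U) (\<lambda>y. D y - D' y)"
  unfolding summation_by_parts_def
proof (intro allI impI)
  fix U w :: real and m :: nat assume *: "0 \<le> U" "0 < w" "U < real m * w"
  show "(\<lambda>n. h 0 * (D U - D' U) + (\<Sum>i<m * Suc n. (h (real (Suc i) * (w / real (Suc n))) - h (real i * (w / real (Suc n)))) *
        (D (U - real i * (w / real (Suc n))) - D' (U - real i * (w / real (Suc n)))))) \<longlonglongrightarrow> I U - I' U"
    using tendsto_diff[OF assms(1)[unfolded summation_by_parts_def, rule_format, OF *]
        assms(2)[unfolded summation_by_parts_def, rule_format, OF *]]
    by (simp only: right_diff_distrib sum_subtractf add_diff_add)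
qed

text \<open>Telescoping each \<open>h (grid_right v (U - \<sigma> k))\<close> and exchanging the two
  finite sums leaves the number of \<open>k\<close> with \<open>\<sigma> k \<le> U - i * v\<close>.
  As \<open>grid_right\<close> approaches from the right, the limit is correct even if some
  \<open>U - \<sigma> k\<close> is a jump point of \<open>h\<close>.\<close>

lemma summation_by_parts_sum:
  fixes \<sigma> :: "nat \<Rightarrow> real"
  assumes h: "cadlag h" and pos: "\<And>k. 0 \<le> \<sigma> k" and fin: "\<And>t. finite {k. \<sigma> k \<le> t}"
  shows "summation_by_parts h (\<lambda>U. \<Sum>k | \<sigma> k \<le> U. h (U - \<sigma> k)) (\<lambda>y. real (card {k. \<sigma> k \<le> y}))"
  unfolding summation_by_parts_def
proof (intro allI impI)
  fix U w :: real and m :: nat assume U: "0 \<le> U" "0 < w" "U < real m * w"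
  let ?K = "\<lambda>y. {k. \<sigma> k \<le> y}"
  have eq: "(\<Sum>k\<in>?K U. h (grid_right (w / real (Suc n)) (U - \<sigma> k))) =
      h 0 * real (card (?K U)) + (\<Sum>i<m * Suc n. (h (real (Suc i) * (w / real (Suc n))) - h (real i * (w / real (Suc n)))) *
        real (card (?K (U - real i * (w / real (Suc n))))))" for n
  proof -
    define v where "v = w / real (Suc n)"
    define \<Delta> where "\<Delta> i = h (real (Suc i) * v) - h (real i * v)" for i
    have v: "0 < v" "real (Suc n) * v = w" unfolding v_def using U(2) by auto
    have mv: "real (m * Suc n) * v = real m * w" unfolding of_nat_mult mult.assoc v(2) ..
    have card_eq: "(\<Sum>k\<in>?K U. of_bool (real i * v \<le> U - \<sigma> k)) = real (card (?K (U - real i * v)))" for i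
    proof -
      have "0 \<le> real i * v" using v(1) by simp
      then have "?K U \<inter> {k. real i * v \<le> U - \<sigma> k} = ?K (U - real i * v)" by auto
      then show ?thesis using fin[of U] by (simp add: sum_of_bool_eq)
    qed
    have "(\<Sum>k\<in>?K U. h (grid_right v (U - \<sigma> k))) =
        (\<Sum>k\<in>?K U. h 0 + (\<Sum>i<m * Suc n. \<Delta> i * of_bool (real i * v \<le> U - \<sigma> k)))"
    proof (rule sum.cong)
      fix k assume k: "k \<in> ?K U"
      show "h (grid_right v (U - \<sigma> k)) = h 0 + (\<Sum>i<m * Suc n. \<Delta> i * of_bool (real i * v \<le> U - \<sigma> k))"
        unfolding \<Delta>_def using k pos[of k] U v(1) mv by (intro grid_right_telescope) auto
    qed simp
    also have "\<dots> = h 0 * real (card (?K U)) + (\<Sum>i<m * Suc n. \<Delta> i * (\<Sum>k\<in>?K U. of_bool (real i * v \<le> U - \<sigma> k)))"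
      unfolding sum.distrib sum_distrib_left by (subst sum.swap) simp
    also have "\<dots> = h 0 * real (card (?K U)) + (\<Sum>i<m * Suc n. \<Delta> i * real (card (?K (U - real i * v))))"
      by (simp only: card_eq)
    finally show ?thesis unfolding v_def \<Delta>_def .
  qed
  have "(\<lambda>n. \<Sum>k\<in>?K U. h (grid_right (w / real (Suc n)) (U - \<sigma> k))) \<longlonglongrightarrow> (\<Sum>k\<in>?K U. h (U - \<sigma> k))"
    using h U(2) unfolding cadlag_def by (intro tendsto_sum tendsto_grid_right) auto
  then show "(\<lambda>n. h 0 * real (card (?K U)) + (\<Sum>i<m * Suc n. (h (real (Suc i) * (w / real (Suc n))) - h (real i * (w / real (Suc n)))) *
        real (card (?K (U - real i * (w / real (Suc n))))))) \<longlonglongrightarrow> (\<Sum>k\<in>?K U. h (U - \<sigma> k))"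
    unfolding eq .
qed

text \<open>The telescoping used for finite sums works under the integral as well; dominated
  convergence replaces the termwise limit, with a constant supplied by the variation of
  \<open>h\<close>.\<close>

lemma summation_by_parts_integral:
  assumes h: "cadlag h" and V: "\<And>T. 0 \<le> T \<Longrightarrow> \<exists>V. partition_sum_le h T V"
    and sets[measurable_cong]: "sets \<mu> = sets borel" and fin: "\<And>t. emeasure \<mu> {0..t} < \<infinity>"
  shows "summation_by_parts h (\<lambda>U. LINT y:{0..U}|\<mu>. h (U - y)) (\<lambda>y. measure \<mu> {0..y})"
  unfolding summation_by_parts_def
proof (intro allI impI)
  fix U w :: real and m :: nat assume U: "0 \<le> U" "0 < w" "U < real m * w"
  define v where "v n = w / real (Suc n)" for n
  define \<Delta> where "\<Delta> n i = h (real (Suc i) * v n) - h (real i * v n)" for n i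
  have v: "0 < v n" "v n \<le> w" "real (Suc n) * v n = w" for n unfolding v_def using U(2) by (auto simp: field_simps)
  have mv: "real (m * Suc n) * v n = real m * w" for n unfolding of_nat_mult mult.assoc v(3) ..
  define f where "f n y = indicator {0..U} y * h (grid_right (v n) (U - y))" for n y
  have int: "integrable \<mu> (\<lambda>y. indicator {0..t} y :: real)" for t
    using fin[of t] sets by (intro integrable_real_indicator) auto
  have f: "f n y = h 0 * indicator {0..U} y + (\<Sum>i<m * Suc n. \<Delta> n i * indicator {0..U - real i * v n} y)" for n y
  proof (cases "y \<in> {0..U}")
    case True
    have "h (grid_right (v n) (U - y)) = h 0 + (\<Sum>i<m * Suc n. \<Delta> n i * of_bool (real i * v n \<le> U - y))"
      unfolding \<Delta>_def using True U v(1)[of n] mv[of n] by (intro grid_right_telescope) auto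
    also have "\<dots> = h 0 + (\<Sum>i<m * Suc n. \<Delta> n i * indicator {0..U - real i * v n} y)"
      using True by (intro arg_cong2[of _ _ _ _ "(+)"] sum.cong) (auto simp: indicator_def)
    finally show ?thesis unfolding f_def using True by simp
  next
    case False
    have "0 \<le> real i * v n" for i using v(1)[of n] by simp
    then have "y \<notin> {0..U - real i * v n}" for i
      using False by (metis atLeastAtMost_iff diff_add_cancel le_add_same_cancel1 order_trans)
    then show ?thesis unfolding f_def using False by simp
  qed
  \<comment> \<open>\<open>grid_right\<close> can overshoot \<open>U\<close> by as much as
    \<open>w\<close>.\<close>
  obtain V where V: "partition_sum_le h (U + w) V" using V[of "U + w"] U by auto
  have bound: "norm (f n y) \<le> (\<bar>h 0\<bar> + V) * indicator {0..U} y" for n y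
  proof (cases "y \<in> {0..U}")
    case True
    have "\<bar>h (grid_right (v n) (U - y))\<bar> \<le> \<bar>h 0\<bar> + V"
      using True grid_right_bounds[OF v(1)[of n], of "U - y"] v(2)[of n]
      by (intro partition_sum_le_bound[OF V]) auto
    then show ?thesis unfolding f_def using True by simp
  qed (simp add: f_def)
  have "(\<lambda>n. \<integral>y. f n y \<partial>\<mu>) \<longlonglongrightarrow> (\<integral>y. indicator {0..U} y * h (U - y) \<partial>\<mu>)"
  proof (rule integral_dominated_convergence)
    show fm: "f n \<in> borel_measurable \<mu>" for n
      unfolding f[abs_def] by measurable
    have lim: "(\<lambda>n. f n y) \<longlonglongrightarrow> indicator {0..U} y * h (U - y)" for y
    proof (cases "y \<in> {0..U}")
      case True
      have "(\<lambda>n. h (grid_right (w / real (Suc n)) (U - y))) \<longlonglongrightarrow> h (U - y)"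
        using True h U unfolding cadlag_def by (intro tendsto_grid_right) auto
      then show ?thesis unfolding f_def v_def using True by simp
    qed (simp add: f_def)
    then show "AE y in \<mu>. (\<lambda>n. f n y) \<longlonglongrightarrow> indicator {0..U} y * h (U - y)" by simp
    show "(\<lambda>y. indicator {0..U} y * h (U - y)) \<in> borel_measurable \<mu>"
      using fm lim by (rule borel_measurable_LIMSEQ_real[rotated])
    show "integrable \<mu> (\<lambda>y. (\<bar>h 0\<bar> + V) * indicator {0..U} y)" using int by simp
    show "AE y in \<mu>. norm (f n y) \<le> (\<bar>h 0\<bar> + V) * indicator {0..U} y" for n using bound by simp
  qed
  moreover have "(\<integral>y. f n y \<partial>\<mu>) = h 0 * measure \<mu> {0..U} + (\<Sum>i<m * Suc n. \<Delta> n i * measure \<mu> {0..U - real i * v n})" for n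
  proof -
    have ind: "(\<integral>y. indicator {0..t} y \<partial>\<mu>) = measure \<mu> {0..t}" for t
      using sets_eq_imp_space_eq[OF sets] by simp
    have "(\<integral>y. f n y \<partial>\<mu>) = (\<integral>y. h 0 * indicator {0..U} y \<partial>\<mu>) +
        (\<integral>y. (\<Sum>i<m * Suc n. \<Delta> n i * indicator {0..U - real i * v n} y) \<partial>\<mu>)"
      unfolding f[abs_def]
      by (intro Bochner_Integration.integral_add Bochner_Integration.integrable_sum integrable_mult_right int)
    also have "(\<integral>y. (\<Sum>i<m * Suc n. \<Delta> n i * indicator {0..U - real i * v n} y) \<partial>\<mu>) =
        (\<Sum>i<m * Suc n. \<integral>y. \<Delta> n i * indicator {0..U - real i * v n} y \<partial>\<mu>)"
      by (intro Bochner_Integration.integral_sum integrable_mult_right int)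
    finally show ?thesis by (simp only: integral_mult_right_zero ind)
  qed
  ultimately show "(\<lambda>n. h 0 * measure \<mu> {0..U} + (\<Sum>i<m * Suc n. (h (real (Suc i) * (w / real (Suc n))) -
      h (real i * (w / real (Suc n)))) * measure \<mu> {0..U - real i * (w / real (Suc n))})) \<longlonglongrightarrow> (LINT y:{0..U}|\<mu>. h (U - y))"
    unfolding set_lebesgue_integral_def v_def \<Delta>_def by simp
qed

text \<open>On a refined grid, replacing \<open>D (U - s)\<close> by the constant
  \<open>\<xi> j\<close> throughout block \<open>j\<close> costs at most \<open>\<eta>\<close> times
  the variation of \<open>h\<close>, and the increments then telescope within the block. The bound
  is the same for all refinements and so passes to the limit.\<close>

lemma summation_by_parts_block:
  assumes parts: "summation_by_parts h I D" and V: "partition_sum_le h (real m * w) V"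
    and U: "0 \<le> U" "0 < w" "U < real m * w" and "0 \<le> \<eta>"
    and \<xi>: "\<And>j s. j < m \<Longrightarrow> real j * w \<le> s \<Longrightarrow> s < real (Suc j) * w \<Longrightarrow> \<bar>D (U - s) - \<xi> j\<bar> \<le> \<eta>"
  shows "\<bar>I U - h 0 * D U - (\<Sum>j<m. (h (real (Suc j) * w) - h (real j * w)) * \<xi> j)\<bar> \<le> \<eta> * V"
proof -
  let ?c = "h 0 * D U + (\<Sum>j<m. (h (real (Suc j) * w) - h (real j * w)) * \<xi> j)"
  define A where "A n = h 0 * D U + (\<Sum>i<m * Suc n. (h (real (Suc i) * (w / real (Suc n))) -
      h (real i * (w / real (Suc n)))) * D (U - real i * (w / real (Suc n))))" for n
  have "A \<longlonglongrightarrow> I U" using parts U unfolding summation_by_parts_def A_def by blast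
  then have lim: "(\<lambda>n. \<bar>A n - ?c\<bar>) \<longlonglongrightarrow> \<bar>I U - ?c\<bar>" by (intro tendsto_intros)
  have "\<bar>A n - ?c\<bar> \<le> \<eta> * V" for n
  proof -
    define q where "q = Suc n"
    define v where "v = w / real q"
    have q: "0 < q" unfolding q_def by simp
    have v: "0 < v" "real q * v = w" unfolding v_def using q U(2) by auto
    define \<Delta> where "\<Delta> i = h (real (Suc i) * v) - h (real i * v)" for i
    have block: "(\<Sum>i\<in>{j * q..<j * q + q}. \<Delta> i) = h (real (Suc j) * w) - h (real j * w)" for j
    proof -
      have "(\<Sum>i\<in>{j * q..<j * q + q}. \<Delta> i) = h (real (j * q + q) * v) - h (real (j * q) * v)"
        unfolding \<Delta>_def by (rule sum_Suc_diff'[of _ _ "\<lambda>i. h (real i * v)"]) simp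
      also have "real (j * q + q) * v = real (Suc j) * w" using v(2) by (simp add: algebra_simps)
      also have "real (j * q) * v = real j * w" using v(2) by (simp add: algebra_simps)
      finally show ?thesis .
    qed
    have "A n - ?c = (\<Sum>i<m * q. \<Delta> i * D (U - real i * v)) - (\<Sum>j<m. (h (real (Suc j) * w) - h (real j * w)) * \<xi> j)"
      unfolding A_def \<Delta>_def v_def q_def by simp
    also have "\<dots> = (\<Sum>j<m. \<Sum>i\<in>{j * q..<j * q + q}. \<Delta> i * (D (U - real i * v) - \<xi> j))"
      unfolding sum.nat_group[symmetric] block[symmetric] sum_distrib_right
      by (simp add: sum_subtractf[symmetric] algebra_simps)
    finally have "\<bar>A n - ?c\<bar> \<le> (\<Sum>j<m. \<Sum>i\<in>{j * q..<j * q + q}. \<bar>\<Delta> i * (D (U - real i * v) - \<xi> j)\<bar>)"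
      by (auto intro!: order_trans[OF sum_abs] sum_mono)
    also have "\<dots> \<le> (\<Sum>j<m. \<Sum>i\<in>{j * q..<j * q + q}. \<bar>\<Delta> i\<bar> * \<eta>)"
    proof (intro sum_mono)
      fix j i assume j: "j \<in> {..<m}" and i: "i \<in> {j * q..<j * q + q}"
      have "real (j * q) * v \<le> real i * v" using i v(1) by (intro mult_right_mono) (auto simp del: of_nat_mult)
      moreover have "real i * v < real (j * q + q) * v" using i v(1) by (intro mult_strict_right_mono) (auto simp del: of_nat_mult of_nat_add)
      ultimately have "real j * w \<le> real i * v" "real i * v < real (Suc j) * w"
        using v(2) by (auto simp: algebra_simps)
      then show "\<bar>\<Delta> i * (D (U - real i * v) - \<xi> j)\<bar> \<le> \<bar>\<Delta> i\<bar> * \<eta>"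
        unfolding abs_mult using \<xi> j by (intro mult_left_mono) auto
    qed
    also have "\<dots> = (\<Sum>i<m * q. \<bar>h (real (Suc i) * v) - h (real i * v)\<bar>) * \<eta>"
      unfolding sum.nat_group sum_distrib_right[symmetric] \<Delta>_def ..
    also have "(\<Sum>i<m * q. \<bar>h (real (Suc i) * v) - h (real i * v)\<bar>) \<le> V"
      using v by (intro partition_sum_leD[OF V]) (auto simp: mult.assoc intro!: mult_right_mono)
    finally show ?thesis using \<open>0 \<le> \<eta>\<close> by (simp add: mult.commute mult_right_mono)
  qed
  then have "\<bar>I U - ?c\<bar> \<le> \<eta> * V" by (intro LIMSEQ_le_const2[OF lim]) auto
  then show ?thesis by (simp add: algebra_simps)
qed

text \<open>For \<open>q\<close> strictly between 1 and \<open>2 powr \<beta>\<close>, regular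
  variation gives \<open>h (2 * t) > q * h t\<close> for large \<open>t\<close>. Hence
  \<open>h\<close> grows geometrically along \<open>t * 2 ^ k\<close>, and monotonicity fills the
  gaps.\<close>

lemma filterlim_regularly_varying_at_top:
  assumes rv: "regularly_varying h \<beta>" and mono: "eventually_nondecreasing h" and "0 < \<beta>"
  shows "filterlim h at_top at_top"
proof -
  obtain t0 where t0: "0 < t0" "mono_on {t0<..} h" using mono unfolding eventually_nondecreasing_def by blast
  define q where "q = (1 + 2 powr \<beta>) / 2"
  have p: "1 < (2::real) powr \<beta>" using \<open>0 < \<beta>\<close> by simp
  then have q: "1 < q" "q < 2 powr \<beta>" unfolding q_def by auto
  have "((\<lambda>t. h (t * 2) / h t) \<longlongrightarrow> 2 powr \<beta>) at_top"
    using rv unfolding regularly_varying_def by simp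
  then have "\<forall>\<^sub>F t in at_top. q < h (t * 2) / h t" using q(2) by (rule order_tendstoD)
  moreover have "\<forall>\<^sub>F t in at_top. 0 < h t" using rv unfolding regularly_varying_def by simp
  ultimately obtain t1 where t1: "\<And>t. t \<ge> t1 \<Longrightarrow> q < h (t * 2) / h t \<and> 0 < h t"
    unfolding eventually_at_top_linorder by (metis (no_types, lifting) le_max_iff_disj linorder_le_cases max.cobounded1 max.cobounded2 order_trans)
  define t where "t = max t1 (t0 + 1)"
  have t: "t \<ge> t1" "t > t0" "t > 0" unfolding t_def using t0(1) by auto
  have pow: "q ^ k * h t \<le> h (t * 2 ^ k)" for k
  proof (induction k)
    case (Suc k)
    have "t * 1 \<le> t * 2 ^ k" using t(3) by (intro mult_left_mono) auto
    then have "t1 \<le> t * 2 ^ k" using t(1) by simp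
    then have *: "q < h (t * 2 ^ k * 2) / h (t * 2 ^ k)" "0 < h (t * 2 ^ k)" using t1 by blast+
    have "q * (q ^ k * h t) \<le> q * h (t * 2 ^ k)" using Suc q(1) by (intro mult_left_mono) auto
    also have "\<dots> \<le> h (t * 2 ^ k * 2)" using * by (simp add: field_simps)
    finally show ?case by (simp add: mult_ac)
  qed simp
  have ht: "0 < h t" using t1 t(1) by blast
  show ?thesis
    unfolding filterlim_at_top
  proof
    fix Z :: real
    obtain k where k: "Z / h t < q ^ k" using real_arch_pow[OF q(1)] by blast
    have "t * 1 \<le> t * 2 ^ k" using t(3) by (intro mult_left_mono) auto
    then have tk: "t0 < t * 2 ^ k" using t(2) by simp
    show "\<forall>\<^sub>F s in at_top. Z \<le> h s"
      using eventually_ge_at_top[of "t * 2 ^ k"]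
    proof eventually_elim
      case (elim s)
      have "Z \<le> q ^ k * h t" using k ht by (simp add: field_simps)
      also have "\<dots> \<le> h (t * 2 ^ k)" by (rule pow)
      also have "\<dots> \<le> h s" using tk elim by (intro mono_onD[OF t0(2)]) auto
      finally show ?case .
    qed
  qed
qed

text \<open>Grid arguments \<open>u - j * \<delta>\<close> may be negative, so the modulus of
  continuity has to hold on the whole ray. Compactness gives it on \<open>[-1, R]\<close>, and a
  step of at most 1/2 that touches the region below -1 stays where \<open>x\<close>
  vanishes.\<close>

lemma uniformly_continuous_left_ray:
  fixes x :: "real \<Rightarrow> real"
  assumes "continuous_on UNIV x" "\<And>r. r \<le> 0 \<Longrightarrow> x r = 0" "0 < \<omega>"
  shows "\<exists>\<delta>>0. \<forall>r\<le>R. \<forall>s\<le>R. \<bar>r - s\<bar> \<le> \<delta> \<longrightarrow> \<bar>x r - x s\<bar> \<le> \<omega>"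
proof -
  have "uniformly_continuous_on {-1..R} x"
    by (intro compact_uniformly_continuous continuous_on_subset[OF assms(1)]) auto
  then obtain d where d: "0 < d"
    "\<And>r s. r \<in> {-1..R} \<Longrightarrow> s \<in> {-1..R} \<Longrightarrow> \<bar>r - s\<bar> < d \<Longrightarrow> \<bar>x r - x s\<bar> < \<omega>"
    unfolding uniformly_continuous_on_def dist_real_def using assms(3) by metis
  have "\<bar>x r - x s\<bar> \<le> \<omega>" if rs: "r \<le> R" "s \<le> R" "\<bar>r - s\<bar> \<le> min (1 / 2) (d / 2)" for r s
  proof (cases "-1 \<le> r \<and> -1 \<le> s")
    case True
    then show ?thesis using d(2)[of r s] rs d(1) by auto
  next
    case False
    moreover have "\<bar>r - s\<bar> \<le> 1 / 2" using rs(3) by simp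
    ultimately have "r \<le> 0" "s \<le> 0" by linarith+
    then show ?thesis using assms(2,3) by simp
  qed
  then show ?thesis using d(1) by (intro exI[of _ "min (1 / 2) (d / 2)"]) auto
qed

text \<open>\<open>A\<close> plays the role of \<open>a t\<close>; it need not be related to \<open>t\<close>.\<close>

lemma rescaled_integral_close:
  fixes h x Y :: "real \<Rightarrow> real" and \<beta> T \<epsilon> :: real
  assumes h_mono: "eventually_nondecreasing h"
    and h_bv: "\<And>T. 0 \<le> T \<Longrightarrow> bounded_variation_on 0 T h"
    and h_rv: "regularly_varying h \<beta>" and h_top: "filterlim h at_top at_top"
    and x: "continuous_on UNIV x" "\<And>r. r \<le> 0 \<Longrightarrow> x r = 0"
    and Y: "\<And>R m \<omega> u. 0 < R \<Longrightarrow> 0 < m \<Longrightarrow> 0 \<le> u \<Longrightarrow> u < R \<Longrightarrow>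
      (\<And>r s. r \<le> R \<Longrightarrow> s \<le> R \<Longrightarrow> \<bar>r - s\<bar> \<le> R / real m \<Longrightarrow> \<bar>x r - x s\<bar> \<le> \<omega>) \<Longrightarrow>
      \<bar>(\<Sum>j<m. ((real (Suc j) * (R / real m)) powr \<beta> - (real j * (R / real m)) powr \<beta>) *
        x (u - real j * (R / real m))) - Y u\<bar> \<le> \<omega> * R powr \<beta>"
    and T: "0 < T" and \<epsilon>: "0 < \<epsilon>"
  shows "\<exists>\<eta>>0. \<forall>\<^sub>F t in at_top. \<forall>I D A. summation_by_parts h I D \<longrightarrow> (\<forall>y<0. D y = 0) \<longrightarrow> 0 < A \<longrightarrow>
    (\<forall>v\<in>{0..T}. \<bar>D (t * v) / A - x v\<bar> \<le> \<eta>) \<longrightarrow> (\<forall>u\<in>{0..T}. \<bar>I (t * u) / (A * h t) - Y u\<bar> \<le> \<epsilon>)"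
proof -
  \<comment> \<open>\<open>R > T\<close> provides the strict inequality \<open>U < m * w\<close> in
    \<open>summation_by_parts\<close>, and \<open>C\<close> will bound the normalised variation of
    \<open>h\<close> on \<open>[0, t * R]\<close>. The error budget behind \<open>\<omega>\<close>:
    \<open>2 * \<omega> * C = \<epsilon> / 4\<close> for the blocks, \<open>\<epsilon> / 4\<close>
    each for the boundary term and the increments of \<open>h\<close>, and
    \<open>\<epsilon> / 8\<close> for the Riemann sum of the limit.\<close>
  define R where "R = T + 1"
  define C where "C = R powr \<beta> + 1"
  define \<omega> where "\<omega> = \<epsilon> / (8 * C)"
  have R: "0 < R" "T < R" unfolding R_def using T by auto
  have C: "0 < C" "R powr \<beta> \<le> C" unfolding C_def using powr_ge_zero[of R \<beta>] by linarith+
  have \<omega>: "0 < \<omega>" unfolding \<omega>_def using \<epsilon> C by simp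
  have \<omega>C: "\<omega> * C = \<epsilon> / 8" unfolding \<omega>_def using C by simp
  have "bounded (x ` {0..R})"
    by (intro compact_imp_bounded compact_continuous_image continuous_on_subset[OF x(1)]) auto
  then obtain B where B: "\<And>r. r \<in> {0..R} \<Longrightarrow> \<bar>x r\<bar> \<le> B"
    unfolding bounded_iff by fastforce
  have B0: "0 \<le> B" using B[of 0] R by auto
  have xB: "\<bar>x r\<bar> \<le> B" if "r \<le> R" for r
    using B[of r] x(2)[of r] B0 that by (cases "0 \<le> r") auto
  obtain \<delta>0 where \<delta>0: "0 < \<delta>0"
    "\<And>r s. r \<le> R \<Longrightarrow> s \<le> R \<Longrightarrow> \<bar>r - s\<bar> \<le> \<delta>0 \<Longrightarrow> \<bar>x r - x s\<bar> \<le> \<omega>"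
    using uniformly_continuous_left_ray[OF x \<omega>, of R] by blast
  obtain m where m: "R / \<delta>0 < real m" using reals_Archimedean2 by blast
  moreover have "0 < R / \<delta>0" using R \<delta>0(1) by simp
  ultimately have m0: "0 < real m" by linarith
  define \<delta> where "\<delta> = R / real m"
  have \<delta>: "0 < \<delta>" "\<delta> \<le> \<delta>0" "real m * \<delta> = R"
    unfolding \<delta>_def using R m m0 \<delta>0(1) by (auto simp: field_simps)
  have osc: "\<bar>x r - x s\<bar> \<le> \<omega>" if "r \<le> R" "s \<le> R" "\<bar>r - s\<bar> \<le> \<delta>" for r s
    using \<delta>0(2)[of r s] that \<delta>(2) by simp
  \<comment> \<open>Since \<open>0 powr 0 = 0\<close>, for \<beta> = 0 these values are 0 at
    \<open>j = 0\<close> and 1 afterwards: the increments put unit mass on the first block, in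
    accordance with the limit being the path itself.\<close>
  define c where "c j = (real j * \<delta>) powr \<beta>" for j
  have h_pos: "\<forall>\<^sub>F t in at_top. 0 < h t" using h_rv unfolding regularly_varying_def by simp
  have inv: "((\<lambda>t. K / h t) \<longlongrightarrow> 0) at_top" for K
    using h_top filterlim_at_top_imp_at_infinity by (intro tendsto_divide_0[OF tendsto_const]) blast
  \<comment> \<open>Regular variation speaks of positive factors only; at \<open>j = 0\<close> the
    limit 0 comes from the divergence of \<open>h\<close>.\<close>
  have hlim: "((\<lambda>t. h (t * (real j * \<delta>)) / h t) \<longlongrightarrow> c j) at_top" for j
  proof (cases "j = 0")
    case True
    then show ?thesis unfolding c_def using inv[of "h 0"] by simp
  next
    case False
    then show ?thesis using h_rv \<delta>(1) unfolding regularly_varying_def c_def by simp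
  qed
  have ev1: "\<forall>\<^sub>F t in at_top. \<bar>h 0\<bar> * (B + \<omega>) / h t < \<epsilon> / 4"
    using order_tendstoD(2)[OF inv[of "\<bar>h 0\<bar> * (B + \<omega>)"], of "\<epsilon> / 4"] \<epsilon> by simp
  obtain C0 R0 where C0: "\<And>r. R0 \<le> r \<Longrightarrow> partition_sum_le h r (C0 + h r)"
    using partition_sum_le_eventually_nondecreasing[OF h_bv h_mono] by blast
  have "((\<lambda>t. C0 / h t + h (t * R) / h t) \<longlongrightarrow> 0 + R powr \<beta>) at_top"
    using h_rv R(1) unfolding regularly_varying_def by (intro tendsto_add inv) auto
  then have ev2: "\<forall>\<^sub>F t in at_top. C0 / h t + h (t * R) / h t < C"
    unfolding C_def by (rule order_tendstoD) simp
  have ev3: "\<forall>\<^sub>F t in at_top. R0 \<le> t * R"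
    using eventually_ge_at_top[of "R0 / R"] by eventually_elim (use R in \<open>simp add: field_simps\<close>)
  define E where "E t j = (h (t * (real (Suc j) * \<delta>)) / h t - h (t * (real j * \<delta>)) / h t) - (c (Suc j) - c j)" for t j
  have "((\<lambda>t. \<Sum>j<m. \<bar>E t j\<bar> * B) \<longlongrightarrow> (\<Sum>j<m. \<bar>(c (Suc j) - c j) - (c (Suc j) - c j)\<bar> * B)) at_top"
    unfolding E_def by (intro tendsto_intros hlim)
  then have "((\<lambda>t. \<Sum>j<m. \<bar>E t j\<bar> * B) \<longlongrightarrow> 0) at_top" by simp
  then have ev4: "\<forall>\<^sub>F t in at_top. (\<Sum>j<m. \<bar>E t j\<bar> * B) < \<epsilon> / 4"
    using \<epsilon> by (intro order_tendstoD) auto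
  show ?thesis
  proof (intro exI[of _ \<omega>] conjI \<omega>)
    show "\<forall>\<^sub>F t in at_top. \<forall>I D A. summation_by_parts h I D \<longrightarrow> (\<forall>y<0. D y = 0) \<longrightarrow> 0 < A \<longrightarrow>
      (\<forall>v\<in>{0..T}. \<bar>D (t * v) / A - x v\<bar> \<le> \<omega>) \<longrightarrow> (\<forall>u\<in>{0..T}. \<bar>I (t * u) / (A * h t) - Y u\<bar> \<le> \<epsilon>)"
      using ev1 ev2 ev3 ev4 h_pos eventually_gt_at_top[of 0]
    proof eventually_elim
      case (elim t)
      show ?case
      proof (intro allI impI ballI)
        fix I D A u assume parts: "summation_by_parts h I D" and D0: "\<forall>y<0. D y = 0" and A: "0 < A"
          and D: "\<forall>v\<in>{0..T}. \<bar>D (t * v) / A - x v\<bar> \<le> \<omega>" and u: "u \<in> {0..T}"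
        have ht: "0 < h t" and t: "0 < t" using elim by auto
        have Dx: "\<bar>D (t * v) / A - x v\<bar> \<le> \<omega>" if "v \<le> T" for v
        proof (cases "0 \<le> v")
          case False
          then have "t * v < 0" using t by (simp add: mult_pos_neg)
          then show ?thesis using D0 x(2)[of v] False \<omega> by simp
        qed (use D that in auto)
        \<comment> \<open>Two errors of size \<open>\<omega>\<close>: from \<open>D / A\<close> to
          \<open>x\<close> at the same point, and from that point to the one given by the left end
          of the block, which is within the modulus of continuity by the choice of
          \<open>\<delta>\<close>.\<close>
        have xi: "\<bar>D (t * u - s) - A * x (u - real j * \<delta>)\<bar> \<le> A * (2 * \<omega>)"
          if s: "real j * (t * \<delta>) \<le> s" "s < real (Suc j) * (t * \<delta>)" and "j < m" for j s
        proof -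
          define v where "v = s / t"
          have sv: "s = t * v" unfolding v_def using t by simp
          have "t * (real j * \<delta>) \<le> t * v" "t * v < t * (real (Suc j) * \<delta>)"
            using s unfolding sv by (simp_all only: mult.left_commute[of t])
          then have v: "real j * \<delta> \<le> v" "v < real (Suc j) * \<delta>" using t by simp_all
          have jd: "0 \<le> real j * \<delta>" using \<delta>(1) by simp
          then have v': "0 \<le> v" "\<bar>v - real j * \<delta>\<bar> \<le> \<delta>"
            using v by (linarith, simp add: algebra_simps)
          have "\<bar>D (t * (u - v)) / A - x (u - v)\<bar> \<le> \<omega>" using u v' by (intro Dx) auto
          moreover have "u - v \<le> R" "u - real j * \<delta> \<le> R" "\<bar>u - v - (u - real j * \<delta>)\<bar> \<le> \<delta>"
            using u v' R(2) jd unfolding atLeastAtMost_iff by linarith+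
          then have "\<bar>x (u - v) - x (u - real j * \<delta>)\<bar> \<le> \<omega>" by (rule osc)
          ultimately have "\<bar>D (t * (u - v)) / A - x (u - real j * \<delta>)\<bar> \<le> 2 * \<omega>" by linarith
          then have "A * \<bar>D (t * (u - v)) / A - x (u - real j * \<delta>)\<bar> \<le> A * (2 * \<omega>)"
            using A by (intro mult_left_mono) auto
          moreover have "A * \<bar>D (t * (u - v)) / A - x (u - real j * \<delta>)\<bar> = \<bar>D (t * (u - v)) - A * x (u - real j * \<delta>)\<bar>"
            using A by (simp add: abs_mult[symmetric, of A, unfolded abs_of_pos[OF A]] abs_of_pos[symmetric] right_diff_distrib)
          ultimately show ?thesis unfolding sv by (simp add: right_diff_distrib)
        qed
        have mR: "real m * (t * \<delta>) = t * R" using \<delta>(3) by (simp add: mult.left_commute)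
        define S where "S = (\<Sum>j<m. (h (real (Suc j) * (t * \<delta>)) - h (real j * (t * \<delta>))) * (A * x (u - real j * \<delta>)))"
        have main: "\<bar>I (t * u) - h 0 * D (t * u) - S\<bar> \<le> A * (2 * \<omega>) * (C0 + h (t * R))"
          unfolding S_def
        proof (rule summation_by_parts_block[OF parts])
          show "partition_sum_le h (real m * (t * \<delta>)) (C0 + h (t * R))" unfolding mR using C0 elim by auto
          show "t * u < real m * (t * \<delta>)" unfolding mR using u t R by simp
        qed (use u t \<delta> A \<omega> xi in auto)
        \<comment> \<open>\<open>F\<close> is the boundary term, negligible because
          \<open>h t\<close> diverges; \<open>P\<close> carries the normalised increments of
          \<open>h\<close>, and \<open>Q\<close> carries their limits.\<close>
        define Z where "Z = I (t * u) / (A * h t)"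
        define F where "F = h 0 * D (t * u) / (A * h t)"
        define P where "P = (\<Sum>j<m. (h (t * (real (Suc j) * \<delta>)) / h t - h (t * (real j * \<delta>)) / h t) * x (u - real j * \<delta>))"
        define Q where "Q = (\<Sum>j<m. (c (Suc j) - c j) * x (u - real j * \<delta>))"
        have SP: "S / (A * h t) = P"
          unfolding S_def P_def sum_divide_distrib
          using A ht by (intro sum.cong) (auto simp: field_simps)
        have "\<bar>Z - F - P\<bar> = \<bar>(I (t * u) - h 0 * D (t * u) - S) / (A * h t)\<bar>"
          unfolding Z_def F_def SP[symmetric] by (simp add: diff_divide_distrib)
        also have "\<dots> = \<bar>I (t * u) - h 0 * D (t * u) - S\<bar> / (A * h t)"
          using A ht by (simp add: abs_divide)
        also have "\<dots> \<le> A * (2 * \<omega>) * (C0 + h (t * R)) / (A * h t)"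
          using main A ht by (intro divide_right_mono) auto
        also have "\<dots> = 2 * \<omega> * (C0 / h t + h (t * R) / h t)"
          using A ht by (simp add: field_simps)
        also have "\<dots> \<le> 2 * \<omega> * C" using elim \<omega> by (intro mult_left_mono) auto
        finally have 1: "\<bar>Z - F - P\<bar> \<le> \<epsilon> / 4" using \<omega>C by simp
        have "\<bar>D (t * u) / A\<bar> \<le> B + \<omega>" using Dx[of u] xB[of u] u R by auto
        then have "\<bar>h 0\<bar> * \<bar>D (t * u) / A\<bar> / h t \<le> \<bar>h 0\<bar> * (B + \<omega>) / h t"
          using ht by (intro divide_right_mono mult_left_mono) auto
        moreover have "\<bar>F\<bar> = \<bar>h 0\<bar> * \<bar>D (t * u) / A\<bar> / h t"
          unfolding F_def using A ht by (simp add: abs_divide abs_mult)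
        ultimately have 2: "\<bar>F\<bar> \<le> \<epsilon> / 4" using elim by linarith
        have "P - Q = (\<Sum>j<m. E t j * x (u - real j * \<delta>))"
          unfolding P_def Q_def E_def sum_subtractf[symmetric] by (simp only: left_diff_distrib)
        also have "\<bar>\<dots>\<bar> \<le> (\<Sum>j<m. \<bar>E t j\<bar> * B)"
        proof (intro order_trans[OF sum_abs] sum_mono)
          fix j
          have "0 \<le> real j * \<delta>" using \<delta>(1) by simp
          then have "u - real j * \<delta> \<le> R" using u R(2) unfolding atLeastAtMost_iff by linarith
          then show "\<bar>E t j * x (u - real j * \<delta>)\<bar> \<le> \<bar>E t j\<bar> * B"
            unfolding abs_mult by (intro mult_left_mono xB) auto
        qed
        finally have 3: "\<bar>P - Q\<bar> \<le> \<epsilon> / 4" using elim by linarith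
        have "\<bar>Q - Y u\<bar> \<le> \<omega> * R powr \<beta>"
          unfolding Q_def c_def \<delta>_def
          using osc unfolding \<delta>_def using u R m0 by (intro Y) auto
        also have "\<dots> \<le> \<omega> * C" using \<omega> C by (intro mult_left_mono) auto
        finally have 4: "\<bar>Q - Y u\<bar> \<le> \<epsilon> / 8" using \<omega>C by simp
        show "\<bar>I (t * u) / (A * h t) - Y u\<bar> \<le> \<epsilon>"
          unfolding Z_def[symmetric] using 1 2 3 4 \<epsilon> by linarith
      qed
    qed
  qed
qed

section \<open>Fractional integrals\<close>

text \<open>For \<beta> < 1 the density is singular at 0. The integral over \<open>[0, c]\<close> is
  known as a gauge integral, which for nonnegative integrands yields the Lebesgue one; other
  intervals are differences. Half-open intervals let the blocks of a grid partition
  \<open>[0, R)\<close>.\<close>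

lemma has_bochner_integral_powr_deriv:
  fixes \<beta> a b :: real
  assumes "0 < \<beta>" "0 \<le> a" "a \<le> b"
  shows "has_bochner_integral lborel (\<lambda>s. indicator {a..<b} s * (\<beta> * s powr (\<beta> - 1))) (b powr \<beta> - a powr \<beta>)"
proof -
  let ?k = "\<lambda>s::real. \<beta> * s powr (\<beta> - 1)"
  have from0: "has_bochner_integral lborel (\<lambda>s. indicator {0..c} s * ?k s) (c powr \<beta>)" if "0 \<le> c" for c
  proof -
    have "((\<lambda>s. s powr (\<beta> - 1)) has_integral (c powr (\<beta> - 1 + 1) / (\<beta> - 1 + 1))) {0..c}"
      using assms(1) that by (intro has_integral_powr_from_0) auto
    from has_integral_mult_right[OF this, of \<beta>]
    have "(?k has_integral c powr \<beta>) {0..c}" using assms(1) by simp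
    then have "(\<integral>\<^sup>+s. ennreal (?k s) * indicator {0..c} s \<partial>lborel) = ennreal (c powr \<beta>)"
      using assms(1) by (intro nn_integral_has_integral_lebesgue') (auto intro: has_integral_cong)
    then have "(\<integral>\<^sup>+s. ennreal (indicator {0..c} s * ?k s) \<partial>lborel) = ennreal (c powr \<beta>)"
      by (simp add: mult.commute ennreal_mult' ennreal_indicator[symmetric] del: ennreal_indicator)
    then show ?thesis
      using assms(1) by (intro has_bochner_integral_nn_integral) auto
  qed
  have "has_bochner_integral lborel (\<lambda>s. indicator {0..b} s * ?k s - indicator {0..a} s * ?k s) (b powr \<beta> - a powr \<beta>)"
    using assms by (intro has_bochner_integral_diff from0) auto
  moreover have "AE s in lborel. indicator {0..b} s * ?k s - indicator {0..a} s * ?k s = indicator {a..<b} s * ?k s"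
    using AE_lborel_singleton[of a] AE_lborel_singleton[of b]
    by eventually_elim (use assms in \<open>auto simp: indicator_def\<close>)
  ultimately show ?thesis
    by (subst (asm) has_bochner_integral_cong_AE) auto
qed

text \<open>Here \<open>x\<close> is a path extended by \<open>0\<close> to the negative half-line.\<close>

definition fractional_integral :: "real \<Rightarrow> (real \<Rightarrow> real) \<Rightarrow> real \<Rightarrow> real" where
  "fractional_integral \<beta> x u = (if \<beta> = 0 then x u
     else \<beta> * (LINT y:{0..u}|lborel. (u - y) powr (\<beta> - 1) * x y))"

text \<open>The substitution \<open>s = u - y\<close> moves the dependence on \<open>u\<close> out
  of the kernel and into \<open>x (u - s)\<close>; as \<open>x\<close> vanishes on the negative
  half-line, the domain can be enlarged to \<open>[0, R)\<close>, the same for all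
  \<open>u\<close>.\<close>

lemma fractional_integral_reflect:
  assumes "0 < \<beta>" "\<And>r. r \<le> 0 \<Longrightarrow> x r = 0" "0 \<le> u" "u < R"
  shows "fractional_integral \<beta> x u = (\<integral>s. indicator {0..<R} s * (\<beta> * s powr (\<beta> - 1)) * x (u - s) \<partial>lborel)"
proof -
  have "(LINT y:{0..u}|lborel. (u - y) powr (\<beta> - 1) * x y) =
      (\<integral>s. indicator {0..u} (u - s) * (s powr (\<beta> - 1) * x (u - s)) \<partial>lborel)"
    unfolding set_lebesgue_integral_def
    by (subst lborel_integral_real_affine[where c = "-1" and t = u]) auto
  also have "\<dots> = (\<integral>s. indicator {0..<R} s * s powr (\<beta> - 1) * x (u - s) \<partial>lborel)"
  proof (intro Bochner_Integration.integral_cong refl)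
    fix s
    show "indicator {0..u} (u - s) * (s powr (\<beta> - 1) * x (u - s)) = indicator {0..<R} s * s powr (\<beta> - 1) * x (u - s)"
      using assms(2)[of "u - s"] assms(3,4) by (auto simp: indicator_def)
  qed
  also have "\<beta> * \<dots> = (\<integral>s. \<beta> * (indicator {0..<R} s * s powr (\<beta> - 1) * x (u - s)) \<partial>lborel)" by simp
  also have "\<dots> = (\<integral>s. indicator {0..<R} s * (\<beta> * s powr (\<beta> - 1)) * x (u - s) \<partial>lborel)"
    by (intro Bochner_Integration.integral_cong refl) simp
  finally show ?thesis unfolding fractional_integral_def using assms(1) by simp
qed

text \<open>For \<beta> > 0 the sum is the exact integral of the density against the step function
  \<open>p\<close> that freezes \<open>x (u - s)\<close> at the left end of each block. Freezing
  costs at most \<open>\<omega>\<close>, and the density has total mass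
  \<open>R powr \<beta>\<close>.\<close>

lemma fractional_integral_riemann_sum:
  assumes \<beta>: "0 \<le> \<beta>" and x: "continuous_on UNIV x" "\<And>r. r \<le> 0 \<Longrightarrow> x r = 0"
    and R: "0 < R" and m: "0 < m" and u: "0 \<le> u" "u < R"
    and osc: "\<And>r s. r \<le> R \<Longrightarrow> s \<le> R \<Longrightarrow> \<bar>r - s\<bar> \<le> R / real m \<Longrightarrow> \<bar>x r - x s\<bar> \<le> \<omega>"
  shows "\<bar>(\<Sum>j<m. ((real (Suc j) * (R / real m)) powr \<beta> - (real j * (R / real m)) powr \<beta>) *
        x (u - real j * (R / real m))) - fractional_integral \<beta> x u\<bar> \<le> \<omega> * R powr \<beta>"
proof (cases "\<beta> = 0")
  case True
  \<comment> \<open>As \<open>0 powr 0 = 0\<close>, the increment is 1 for \<open>j = 0\<close> and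
    0 for every later \<open>j\<close>.\<close>
  have "(\<Sum>j<m. ((real (Suc j) * (R / real m)) powr \<beta> - (real j * (R / real m)) powr \<beta>) * x (u - real j * (R / real m)))
      = (\<Sum>j<m. if j = 0 then x u else 0)"
    using True R m by (intro sum.cong) auto
  also have "\<dots> = x u" using m by (simp add: sum.delta)
  finally show ?thesis
    using True osc[of 0 0] R unfolding fractional_integral_def by simp
next
  case False
  then have \<beta>0: "0 < \<beta>" using \<beta> by simp
  define \<delta> where "\<delta> = R / real m"
  have \<delta>: "0 < \<delta>" "real m * \<delta> = R" unfolding \<delta>_def using R m by auto
  let ?k = "\<lambda>s::real. \<beta> * s powr (\<beta> - 1)"
  let ?J = "\<lambda>j. {real j * \<delta>..<real (Suc j) * \<delta>}"
  define p where "p s = (\<Sum>j<m. indicator (?J j) s * x (u - real j * \<delta>))" for s :: real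
  have [measurable]: "x \<in> borel_measurable borel" using x(1) by (rule borel_measurable_continuous_onI)
  have hb: "has_bochner_integral lborel (\<lambda>s. indicator (?J j) s * ?k s)
      ((real (Suc j) * \<delta>) powr \<beta> - (real j * \<delta>) powr \<beta>)" for j
    using \<beta>0 \<delta>(1) by (intro has_bochner_integral_powr_deriv) (auto intro: mult_right_mono)
  have "has_bochner_integral lborel (\<lambda>s. \<Sum>j<m. indicator (?J j) s * ?k s * x (u - real j * \<delta>))
      (\<Sum>j<m. ((real (Suc j) * \<delta>) powr \<beta> - (real j * \<delta>) powr \<beta>) * x (u - real j * \<delta>))"
    by (intro has_bochner_integral_sum has_bochner_integral_mult_left hb)
  moreover have pw: "(\<Sum>j<m. indicator (?J j) s * ?k s * x (u - real j * \<delta>)) = indicator {0..<R} s * ?k s * p s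
      \<and> \<bar>indicator {0..<R} s * ?k s * p s - indicator {0..<R} s * ?k s * x (u - s)\<bar> \<le> \<omega> * (indicator {0..<R} s * ?k s)" for s
  proof (cases "s \<in> {0..<R}")
    case True
    define k where "k = nat \<lfloor>s / \<delta>\<rfloor>"
    have "\<lfloor>s / \<delta>\<rfloor> = int k" unfolding k_def using True \<delta> by simp
    then have "real k \<le> s / \<delta>" "s / \<delta> < real (Suc k)" by linarith+
    then have k: "real k * \<delta> \<le> s" "s < real (Suc k) * \<delta>" using \<delta>(1) by (auto simp: field_simps)
    have "real k * \<delta> < real m * \<delta>" using k(1) True \<delta>(2) by simp
    then have km: "k < m" using \<delta>(1) by simp
    have ind: "indicator (?J j) s = (if j = k then 1 else 0 :: real)" for j
    proof (cases "j = k")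
      case False
      have "s \<notin> ?J j"
      proof
        assume "s \<in> ?J j"
        then have "real j * \<delta> < real (Suc k) * \<delta>" "real k * \<delta> < real (Suc j) * \<delta>" using k by auto
        then have "j < Suc k" "k < Suc j" using \<delta>(1) by (simp_all only: mult_less_cancel_right_pos of_nat_less_iff)
        then show False using False by simp
      qed
      then show ?thesis using False by simp
    qed (use k in simp)
    have eq: "p s = x (u - real k * \<delta>)" "(\<Sum>j<m. indicator (?J j) s * ?k s * x (u - real j * \<delta>)) = ?k s * x (u - real k * \<delta>)"
      unfolding p_def ind using km by (simp_all add: if_distrib[of "\<lambda>z. z * _"] if_distribR sum.delta cong: if_cong)
    have "\<bar>x (u - real k * \<delta>) - x (u - s)\<bar> \<le> \<omega>"
    proof (rule osc)
      have "0 \<le> real k * \<delta>" using \<delta>(1) by simp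
      then show "u - real k * \<delta> \<le> R" "u - s \<le> R" using u True by auto
      show "\<bar>u - real k * \<delta> - (u - s)\<bar> \<le> R / real m"
        unfolding \<delta>_def[symmetric] using k by (simp add: algebra_simps)
    qed
    then have "?k s * \<bar>x (u - real k * \<delta>) - x (u - s)\<bar> \<le> ?k s * \<omega>"
      using \<beta>0 by (intro mult_left_mono) auto
    moreover have "\<bar>?k s * x (u - real k * \<delta>) - ?k s * x (u - s)\<bar> = ?k s * \<bar>x (u - real k * \<delta>) - x (u - s)\<bar>"
      unfolding right_diff_distrib[symmetric] abs_mult using \<beta>0 by simp
    ultimately show ?thesis using eq True by (simp add: mult.commute)
  next
    case False
    have "s \<notin> ?J j" if "j < m" for j
    proof
      assume s: "s \<in> ?J j"
      have "0 \<le> real j * \<delta>" using \<delta>(1) by simp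
      moreover have "real (Suc j) * \<delta> \<le> real m * \<delta>" using that \<delta>(1) by (intro mult_right_mono) auto
      ultimately show False using s False \<delta>(2) by auto
    qed
    then show ?thesis using False by simp
  qed
  ultimately have Q: "has_bochner_integral lborel (\<lambda>s. indicator {0..<R} s * ?k s * p s)
      (\<Sum>j<m. ((real (Suc j) * \<delta>) powr \<beta> - (real j * \<delta>) powr \<beta>) * x (u - real j * \<delta>))" by simp
  have kint: "has_bochner_integral lborel (\<lambda>s. indicator {0..<R} s * ?k s) (R powr \<beta>)"
    using has_bochner_integral_powr_deriv[OF \<beta>0, of 0 R] R by simp
  define g where "g s = indicator {0..<R} s * ?k s * p s - indicator {0..<R} s * ?k s * x (u - s)" for s
  have g_le: "\<bar>g s\<bar> \<le> \<omega> * (indicator {0..<R} s * ?k s)" for s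
    unfolding g_def using pw[of s] by simp
  have [measurable]: "p \<in> borel_measurable borel" unfolding p_def[abs_def] by measurable
  have wint: "integrable lborel (\<lambda>s. \<omega> * (indicator {0..<R} s * ?k s))"
    using kint by (intro integrable_mult_right) (rule integrable.intros)
  have gint: "integrable lborel g"
  proof (rule Bochner_Integration.integrable_bound[OF wint])
    show "g \<in> borel_measurable lborel" unfolding g_def[abs_def] by measurable
    show "AE s in lborel. norm (g s) \<le> norm (\<omega> * (indicator {0..<R} s * ?k s))"
      using g_le by (auto intro!: AE_I2 intro: order_trans[OF _ abs_ge_self])
  qed
  have "(\<integral>s. g s \<partial>lborel) = (\<Sum>j<m. ((real (Suc j) * \<delta>) powr \<beta> - (real j * \<delta>) powr \<beta>) * x (u - real j * \<delta>)) -
      fractional_integral \<beta> x u"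
  proof -
    have "integrable lborel (\<lambda>s. indicator {0..<R} s * ?k s * p s - g s)"
      using Q gint by (intro Bochner_Integration.integrable_diff) (auto intro: integrable.intros)
    then have "integrable lborel (\<lambda>s. indicator {0..<R} s * ?k s * x (u - s))" unfolding g_def by simp
    then have "(\<integral>s. g s \<partial>lborel) = (\<integral>s. indicator {0..<R} s * ?k s * p s \<partial>lborel) -
        (\<integral>s. indicator {0..<R} s * ?k s * x (u - s) \<partial>lborel)"
      unfolding g_def using Q by (intro Bochner_Integration.integral_diff) (auto intro: integrable.intros)
    then show ?thesis
      using has_bochner_integral_integral_eq[OF Q] fractional_integral_reflect[OF \<beta>0 x(2) u] by simp
  qed
  moreover have "\<bar>\<integral>s. g s \<partial>lborel\<bar> \<le> \<omega> * R powr \<beta>"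
  proof -
    have "\<bar>\<integral>s. g s \<partial>lborel\<bar> \<le> (\<integral>s. \<bar>g s\<bar> \<partial>lborel)" by (rule integral_abs_bound)
    also have "\<dots> \<le> (\<integral>s. \<omega> * (indicator {0..<R} s * ?k s) \<partial>lborel)"
      using gint g_le wint by (intro integral_mono) auto
    also have "\<dots> = \<omega> * R powr \<beta>" using has_bochner_integral_integral_eq[OF kint] by simp
    finally show ?thesis .
  qed
  ultimately show ?thesis unfolding \<delta>_def by simp
qed

text \<open>The approximants are finite linear combinations of values of \<open>x\<close>.
  Continuity in \<open>u\<close>, and measurability when \<open>x\<close> is a random path,
  therefore pass to the limit even if the kernel is singular.\<close>

lemma fractional_integral_uniform_limit:
  assumes \<beta>: "0 \<le> \<beta>" and x: "continuous_on UNIV x" "\<And>r. r \<le> 0 \<Longrightarrow> x r = 0" and R: "0 < R"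
  shows "uniform_limit {0..<R}
    (\<lambda>n u. \<Sum>j<Suc n. ((real (Suc j) * (R / real (Suc n))) powr \<beta> - (real j * (R / real (Suc n))) powr \<beta>) *
        x (u - real j * (R / real (Suc n))))
    (fractional_integral \<beta> x) sequentially" (is "uniform_limit _ ?S _ _")
  unfolding uniform_limit_iff
proof (intro allI impI)
  fix e :: real assume e: "0 < e"
  define \<omega> where "\<omega> = e / (2 * (R powr \<beta> + 1))"
  have Rb: "0 < R powr \<beta> + 1" using powr_ge_zero[of R \<beta>] by linarith
  have \<omega>: "0 < \<omega>" unfolding \<omega>_def using e Rb by simp
  have "\<omega> * R powr \<beta> \<le> \<omega> * (R powr \<beta> + 1)" using \<omega> by (intro mult_left_mono) auto
  also have "\<dots> = e / 2" unfolding \<omega>_def using Rb by (simp add: field_simps)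
  finally have small: "\<omega> * R powr \<beta> < e" using e by simp
  obtain d where d: "0 < d" "\<And>r s. r \<le> R \<Longrightarrow> s \<le> R \<Longrightarrow> \<bar>r - s\<bar> \<le> d \<Longrightarrow> \<bar>x r - x s\<bar> \<le> \<omega>"
    using uniformly_continuous_left_ray[OF x \<omega>, of R] by blast
  obtain N where N: "R / d < real N" using reals_Archimedean2 by blast
  have "dist (?S n u) (fractional_integral \<beta> x u) < e" if n: "N \<le> n" and u: "u \<in> {0..<R}" for n u
  proof -
    have "R / d < real (Suc n)" using N n by simp
    then have "R / real (Suc n) \<le> d" using d(1) by (simp add: field_simps)
    then have "\<bar>?S n u - fractional_integral \<beta> x u\<bar> \<le> \<omega> * R powr \<beta>"
      using u R d(2) by (intro fractional_integral_riemann_sum[OF \<beta> x]) auto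
    then show ?thesis using small unfolding dist_real_def by linarith
  qed
  then show "\<forall>\<^sub>F n in sequentially. \<forall>u\<in>{0..<R}. dist (?S n u) (fractional_integral \<beta> x u) < e"
    unfolding eventually_sequentially by blast
qed

lemma fractional_integral_continuous:
  assumes \<beta>: "0 \<le> \<beta>" and x: "continuous_on UNIV x" "\<And>r. r \<le> 0 \<Longrightarrow> x r = 0"
  shows "continuous_on {0..} (fractional_integral \<beta> x)"
proof -
  have cont: "continuous_on {0..<R} (fractional_integral \<beta> x)" if R: "0 < R" for R
  proof -
    have "\<forall>\<^sub>F n in sequentially. continuous_on {0..<R} (\<lambda>u. \<Sum>j<Suc n. ((real (Suc j) * (R / real (Suc n))) powr \<beta> -
        (real j * (R / real (Suc n))) powr \<beta>) * x (u - real j * (R / real (Suc n))))"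
      by (intro always_eventually allI continuous_intros continuous_on_compose2[OF x(1)]) auto
    from uniform_limit_theorem[OF this fractional_integral_uniform_limit[OF \<beta> x R] sequentially_bot]
    show ?thesis .
  qed
  show ?thesis
    unfolding continuous_on_eq_continuous_within
  proof
    fix u :: real assume "u \<in> {0..}"
    then have "continuous (at u within {0..<u + 1}) (fractional_integral \<beta> x)"
      using cont[of "u + 1"] by (auto simp: continuous_on_eq_continuous_within)
    moreover have "at u within {0..} = at u within {0..<u + 1}"
      by (rule at_within_nhd[of _ "{..<u + 1}"]) auto
    ultimately show "continuous (at u within {0..}) (fractional_integral \<beta> x)"
      by (simp add: continuous_within)
  qed
qed

lemma fractional_integral_0: "x 0 = 0 \<Longrightarrow> fractional_integral \<beta> x 0 = 0"
proof -
  assume "x 0 = 0"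
  moreover have "(LINT y:{0..0}|lborel. (0 - y) powr (\<beta> - 1) * x y) = (\<integral>y. 0 \<partial>(lborel :: real measure))"
    unfolding set_lebesgue_integral_def
    by (intro Bochner_Integration.integral_cong refl) (use \<open>x 0 = 0\<close> in \<open>auto simp: indicator_def\<close>)
  ultimately show ?thesis unfolding fractional_integral_def by simp
qed

section \<open>Shot noise processes\<close>

lemma cadlag_locally:
  assumes "\<And>T. 0 < T \<Longrightarrow> \<exists>g. cadlag g \<and> (\<forall>u\<in>{0..T}. f u = g u)"
  shows "cadlag f"
  unfolding cadlag_def
proof (intro conjI allI impI)
  fix t :: real assume t: "0 \<le> t"
  obtain g where g: "cadlag g" "\<And>u. u \<in> {0..t + 1} \<Longrightarrow> f u = g u"
    using assms[of "t + 1"] t by auto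
  have "\<forall>\<^sub>F u in at_right t. g u = f u"
    unfolding eventually_at_right_field using g(2) t by (intro exI[of _ "t + 1"]) auto
  moreover have "(g \<longlongrightarrow> f t) (at_right t)"
    using g t unfolding cadlag_def continuous_within by auto
  ultimately show "continuous (at_right t) f"
    unfolding continuous_within by (simp add: tendsto_cong)
next
  fix t :: real assume t: "0 < t"
  obtain g where g: "cadlag g" "\<And>u. u \<in> {0..t} \<Longrightarrow> f u = g u" using assms[OF t] by auto
  have "\<forall>\<^sub>F u in at_left t. f u = g u"
    unfolding eventually_at_left_field using g(2) t by (intro exI[of _ 0]) auto
  moreover obtain l where "(g \<longlongrightarrow> l) (at_left t)" using g(1) t unfolding cadlag_def by blast
  ultimately show "\<exists>l. (f \<longlongrightarrow> l) (at_left t)" using tendsto_cong[of f g] by blast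
qed

lemma restrict_skorokhod: "cadlag f \<Longrightarrow> (\<lambda>u\<in>{0..}. f u) \<in> skorokhod_space"
  unfolding skorokhod_space_def by (auto intro!: cadlag_locally exI[of _ f])

lemma cadlag_continuous_on: "continuous_on {0..} f \<Longrightarrow> cadlag f"
proof -
  assume f: "continuous_on {0..} f"
  have "continuous (at_right t) f" if "0 \<le> t" for t
  proof (rule continuous_within_subset)
    show "continuous (at t within {0..}) f" using f that by (simp add: continuous_on_eq_continuous_within)
    show "{t<..} \<subseteq> {0..}" using that by auto
  qed
  moreover have "(f \<longlongrightarrow> f t) (at_left t)" if "0 < t" for t
  proof -
    have "(f \<longlongrightarrow> f t) (at t within {0..})"
      using f that unfolding continuous_on by auto
    then have "(f \<longlongrightarrow> f t) (at t within {0<..<t})" by (rule tendsto_within_subset) auto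
    moreover have "at t within {0<..<t} = at_left t" by (rule at_within_nhd[of _ "{0<..}"]) (use that in auto)
    ultimately show ?thesis by simp
  qed
  ultimately show ?thesis unfolding cadlag_def by blast
qed

lemma cadlag_diff:
  assumes "cadlag f" "cadlag g" shows "cadlag (\<lambda>u. f u - g u)"
  using assms unfolding cadlag_def by (blast intro: continuous_diff tendsto_diff)

lemma cadlag_sum:
  assumes "\<And>k. k \<in> K \<Longrightarrow> cadlag (f k)" shows "cadlag (\<lambda>u. \<Sum>k\<in>K. f k u)"
proof -
  have "\<exists>l. ((\<lambda>u. \<Sum>k\<in>K. f k u) \<longlongrightarrow> l) (at_left t)" if "0 < t" for t
  proof -
    have "\<forall>k\<in>K. \<exists>l. (f k \<longlongrightarrow> l) (at_left t)" using assms that unfolding cadlag_def by blast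
    then obtain l where "\<And>k. k \<in> K \<Longrightarrow> (f k \<longlongrightarrow> l k) (at_left t)" by metis
    then show ?thesis using tendsto_sum[of K f l] by blast
  qed
  then show ?thesis using assms unfolding cadlag_def by (auto intro: continuous_sum)
qed

lemma cadlag_divide: "cadlag f \<Longrightarrow> cadlag (\<lambda>u. f u / c)"
proof -
  assume f: "cadlag f"
  have "continuous (at_right t) (\<lambda>u. f u * inverse c)" if "0 \<le> t" for t
    using f that unfolding cadlag_def by (intro continuous_mult continuous_const) auto
  moreover have "\<exists>l. ((\<lambda>u. f u * inverse c) \<longlongrightarrow> l) (at_left t)" if "0 < t" for t
    using f that unfolding cadlag_def by (blast intro: tendsto_mult_right)
  ultimately show ?thesis unfolding cadlag_def divide_inverse by blast
qed

text \<open>With \<open>c = 1\<close> and \<open>d = - S k\<close> this is a single summand of the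
  shot noise, which is 0 before \<open>S k\<close> and starts there with the value
  \<open>h 0\<close>; with \<open>d = 0\<close> it rescales time.\<close>

lemma cadlag_affine:
  assumes f: "cadlag f" and c: "0 < c"
  shows "cadlag (\<lambda>u. if 0 \<le> c * u + d then f (c * u + d) else 0)" (is "cadlag ?g")
proof -
  have lim: "((\<lambda>u. c * u + d) \<longlongrightarrow> c * t + d) (at t within A)" for t A by (intro tendsto_intros)
  have "continuous (at_right t) ?g" for t
  proof (cases "0 \<le> c * t + d")
    case True
    have gt: "c * t < c * u" if "t < u" for u using that c by simp
    have "filterlim (\<lambda>u. c * u + d) (at_right (c * t + d)) (at_right t)"
      using lim gt unfolding filterlim_at eventually_at_right_field
      by (auto intro!: exI[of _ "t + 1"])
    moreover have "(f \<longlongrightarrow> f (c * t + d)) (at_right (c * t + d))"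
      using f True unfolding cadlag_def continuous_within by blast
    ultimately have "((\<lambda>u. f (c * u + d)) \<longlongrightarrow> f (c * t + d)) (at_right t)"
      by (rule filterlim_compose[rotated])
    moreover have "\<forall>\<^sub>F u in at_right t. f (c * u + d) = ?g u"
      using gt True unfolding eventually_at_right_field by (intro exI[of _ "t + 1"]) fastforce
    ultimately show ?thesis using True unfolding continuous_within by (simp add: tendsto_cong)
  next
    case False
    then have "\<forall>\<^sub>F u in at_right t. c * u + d < 0" using lim by (intro order_tendstoD(2)) auto
    then have "\<forall>\<^sub>F u in at_right t. ?g u = 0" by eventually_elim simp
    then show ?thesis using False unfolding continuous_within by (simp add: tendsto_eventually)
  qed
  moreover have "\<exists>l. (?g \<longlongrightarrow> l) (at_left t)" for t
  proof (cases "0 < c * t + d")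
    case True
    have "\<forall>\<^sub>F u in at_left t. c * u + d < c * t + d"
      using c unfolding eventually_at_left_field by (intro exI[of _ "t - 1"]) auto
    then have "filterlim (\<lambda>u. c * u + d) (at_left (c * t + d)) (at_left t)"
      using lim unfolding filterlim_at by (auto elim: eventually_mono)
    moreover obtain l where "(f \<longlongrightarrow> l) (at_left (c * t + d))"
      using f True unfolding cadlag_def by blast
    ultimately have "((\<lambda>u. f (c * u + d)) \<longlongrightarrow> l) (at_left t)" by (rule filterlim_compose[rotated])
    moreover have "\<forall>\<^sub>F u in at_left t. 0 < c * u + d" using lim True by (rule order_tendstoD)
    then have "\<forall>\<^sub>F u in at_left t. f (c * u + d) = ?g u" by eventually_elim simp
    ultimately show ?thesis using tendsto_cong[of "\<lambda>u. f (c * u + d)" ?g] by blast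
  next
    case False
    have "c * u < c * t" if "u < t" for u using that c by simp
    then have "\<forall>\<^sub>F u in at_left t. ?g u = 0"
      using False unfolding eventually_at_left_field by (intro exI[of _ "t - 1"]) fastforce
    then show ?thesis by (intro exI tendsto_eventually)
  qed
  ultimately show ?thesis unfolding cadlag_def by blast
qed

lemma cadlag_scale: "cadlag f \<Longrightarrow> 0 < c \<Longrightarrow> cadlag (\<lambda>u. f (c * u))"
proof (rule cadlag_locally)
  assume *: "cadlag f" "0 < c"
  fix T :: real
  have "\<forall>u\<in>{0..T}. f (c * u) = (if 0 \<le> c * u + 0 then f (c * u + 0) else 0)"
    using *(2) by simp
  then show "\<exists>g. cadlag g \<and> (\<forall>u\<in>{0..T}. f (c * u) = g u)"
    using cadlag_affine[OF *, of 0] by blast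
qed

text \<open>For each \<open>y\<close> the integrand is cadlag in \<open>U\<close>, and for
  \<open>U \<le> T\<close> it is dominated by a multiple of the indicator of \<open>[0, T]\<close>;
  one-sided limits are taken under the integral along sequences. The left limits \<open>L y\<close>
  may differ from the values at \<open>t\<close>, and \<mu> may have atoms at such
  \<open>y\<close>.\<close>

lemma cadlag_convolution_integral:
  assumes h: "cadlag h" and V: "\<And>T. 0 \<le> T \<Longrightarrow> \<exists>V. partition_sum_le h T V"
    and hm: "h \<in> borel_measurable (restrict_space borel {0..})"
    and sets: "sets \<mu> = sets borel" and fin: "\<And>t. emeasure \<mu> {0..t} < \<infinity>"
  shows "cadlag (\<lambda>U. LINT y:{0..U}|\<mu>. h (U - y))"
proof -
  define g where "g y U = (if 0 \<le> y then (if 0 \<le> 1 * U + - y then h (1 * U + - y) else 0) else 0)" for y U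
  have eq: "(LINT y:{0..U}|\<mu>. h (U - y)) = (\<integral>y. g y U \<partial>\<mu>)" for U
    unfolding set_lebesgue_integral_def g_def
    by (intro Bochner_Integration.integral_cong refl) (auto simp: indicator_def)
  have g_cadlag: "cadlag (g y)" for y
  proof (cases "0 \<le> y")
    case True
    then show ?thesis unfolding g_def using cadlag_affine[OF h, of 1 "- y"] by simp
  next
    case False
    then show ?thesis unfolding g_def cadlag_def by auto
  qed
  have "(\<lambda>s. indicator {0..} s *\<^sub>R h s) \<in> borel_measurable borel"
    using hm by (subst (asm) borel_measurable_restrict_space_iff) auto
  then have hm': "(\<lambda>s. indicator {0..} s * h s) \<in> borel_measurable borel" by simp
  have gm: "(\<lambda>y. g y U) \<in> borel_measurable \<mu>" for U
  proof -
    have "(\<lambda>y. indicator {0..} y * (indicator {0..} (U - y) * h (U - y))) \<in> borel_measurable borel"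
      by (intro borel_measurable_times measurable_compose[OF _ hm']) measurable
    moreover have "(\<lambda>y. indicator {0..} y * (indicator {0..} (U - y) * h (U - y))) = (\<lambda>y. g y U)"
      unfolding g_def by (auto simp: indicator_def)
    ultimately show ?thesis unfolding measurable_cong_sets[OF sets refl] by simp
  qed
  have dom: "\<exists>B. \<forall>U\<le>T. \<forall>y. norm (g y U) \<le> B * indicator {0..T} y" if T: "0 \<le> T" for T
  proof -
    obtain W where W: "partition_sum_le h T W" using V[OF T] by blast
    have "norm (g y U) \<le> (\<bar>h 0\<bar> + W) * indicator {0..T} y" if "U \<le> T" for y U
      using partition_sum_le_bound[OF W, of "U - y"] partition_sum_le_bound[OF W, of 0] that T unfolding g_def by (auto simp: indicator_def)
    then show ?thesis by blast
  qed
  have int: "integrable \<mu> (\<lambda>y. B * indicator {0..T} y :: real)" for B T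
    using fin[of T] sets by (intro integrable_mult_right integrable_real_indicator) auto
  have conv: "(\<lambda>n. \<integral>y. g y (U n) \<partial>\<mu>) \<longlonglongrightarrow> (\<integral>y. L y \<partial>\<mu>)"
    if T: "0 \<le> T" and U: "\<And>n. U n \<le> T" "\<And>y. (\<lambda>n. g y (U n)) \<longlonglongrightarrow> L y" for L U T
  proof -
    obtain B where B: "\<And>U y. U \<le> T \<Longrightarrow> norm (g y U) \<le> B * indicator {0..T} y" using dom[OF T] by blast
    show ?thesis
    proof (rule integral_dominated_convergence[OF _ gm int])
      show "L \<in> borel_measurable \<mu>" using gm U(2) by (rule borel_measurable_LIMSEQ_real[rotated])
    qed (use B U in auto)
  qed
  show ?thesis
    unfolding cadlag_def eq continuous_within
  proof (intro conjI allI impI)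
    fix t :: real assume t: "0 \<le> t"
    show "((\<lambda>U. \<integral>y. g y U \<partial>\<mu>) \<longlongrightarrow> (\<integral>y. g y t \<partial>\<mu>)) (at_right t)"
    proof (rule tendsto_at_right_sequentially[of t "t + 1"])
      fix U :: "nat \<Rightarrow> real" assume U: "\<And>n. t < U n" "\<And>n. U n < t + 1" "U \<longlonglongrightarrow> t"
      have "filterlim U (at_right t) sequentially"
        using U(1,3) by (auto simp: filterlim_at intro!: always_eventually)
      moreover have "(g y \<longlongrightarrow> g y t) (at_right t)" for y
        using g_cadlag[of y] t unfolding cadlag_def continuous_within by blast
      ultimately have "(\<lambda>n. g y (U n)) \<longlonglongrightarrow> g y t" for y
        by (rule filterlim_compose[rotated])
      then show "(\<lambda>n. \<integral>y. g y (U n) \<partial>\<mu>) \<longlonglongrightarrow> (\<integral>y. g y t \<partial>\<mu>)"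
        using U(2) t by (intro conv[of "t + 1"]) (auto intro: less_imp_le)
    qed simp
  next
    fix t :: real assume t: "0 < t"
    have "\<forall>y. \<exists>l. (g y \<longlongrightarrow> l) (at_left t)" using g_cadlag t unfolding cadlag_def by blast
    then obtain L where L: "\<And>y. (g y \<longlongrightarrow> L y) (at_left t)" by metis
    have "((\<lambda>U. \<integral>y. g y U \<partial>\<mu>) \<longlongrightarrow> (\<integral>y. L y \<partial>\<mu>)) (at_left t)"
    proof (rule tendsto_at_left_sequentially[of 0 t])
      fix U :: "nat \<Rightarrow> real" assume U: "\<And>n. U n < t" "U \<longlonglongrightarrow> t"
      have "filterlim U (at_left t) sequentially"
        using U by (auto simp: filterlim_at intro!: always_eventually)
      with L have "(\<lambda>n. g y (U n)) \<longlonglongrightarrow> L y" for y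
        by (rule filterlim_compose)
      then show "(\<lambda>n. \<integral>y. g y (U n) \<partial>\<mu>) \<longlonglongrightarrow> (\<integral>y. L y \<partial>\<mu>)"
        using U(1) t by (intro conv[of t]) (auto intro: less_imp_le)
    qed (rule t)
    then show "\<exists>l. ((\<lambda>U. \<integral>y. g y U \<partial>\<mu>) \<longlongrightarrow> l) (at_left t)" by blast
  qed
qed

section \<open>Counting and shot noise processes path by path, and regularity of the limit\<close>

lemma counting_eq_card:
  assumes "counting S t \<omega> < \<infinity>"
  shows "finite {k. S k \<omega> \<le> t}" "enn2real (counting S t \<omega>) = real (card {k. S k \<omega> \<le> t})"
proof -
  have "counting S t \<omega> = (\<integral>\<^sup>+k. indicator {k. S k \<omega> \<le> t} k \<partial>count_space UNIV)"
    unfolding counting_def nn_integral_count_space_nat by (intro suminf_cong) (simp add: indicator_def)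
  also have "\<dots> = emeasure (count_space UNIV) {k. S k \<omega> \<le> t}" by simp
  finally have eq: "counting S t \<omega> = emeasure (count_space UNIV) {k. S k \<omega> \<le> t}" .
  then show fin: "finite {k. S k \<omega> \<le> t}"
    using assms by (metis emeasure_count_space_infinite less_irrefl subset_UNIV infinity_ennreal_def)
  show "enn2real (counting S t \<omega>) = real (card {k. S k \<omega> \<le> t})"
    unfolding eq using fin by (simp add: ennreal_of_nat_eq_real_of_nat)
qed

lemma shot_noise_eq_sum:
  assumes "finite {k. S k \<omega> \<le> t}"
  shows "shot_noise h S t \<omega> = (\<Sum>k | S k \<omega> \<le> t. h (t - S k \<omega>))"
  unfolding shot_noise_def by (subst suminf_finite[OF assms]) (auto simp: indicator_def)

lemma cadlag_shot_noise:
  assumes h: "cadlag h" and fin: "\<And>t. finite {k. S k \<omega> \<le> t}"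
  shows "cadlag (\<lambda>t. shot_noise h S t \<omega>)"
proof (rule cadlag_locally)
  fix T :: real assume "0 < T"
  let ?g = "\<lambda>t. \<Sum>k | S k \<omega> \<le> T. if 0 \<le> 1 * t + - S k \<omega> then h (1 * t + - S k \<omega>) else 0"
  have "cadlag ?g" by (intro cadlag_sum cadlag_affine h) auto
  moreover have "shot_noise h S t \<omega> = ?g t" if "t \<in> {0..T}" for t
    unfolding shot_noise_eq_sum[of S \<omega> t h, OF fin] using fin[of T] that
    by (intro sum.mono_neutral_cong_left) auto
  ultimately show "\<exists>g. cadlag g \<and> (\<forall>t\<in>{0..T}. shot_noise h S t \<omega> = g t)" by blast
qed

lemma borel_measurable_shot_noise:
  assumes hm: "h \<in> borel_measurable (restrict_space borel {0..})"
    and S: "\<And>k. S k \<in> borel_measurable M"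
  shows "shot_noise h S t \<in> borel_measurable M"
proof -
  have "(\<lambda>s. indicator {0..} s *\<^sub>R h s) \<in> borel_measurable borel"
    using hm by (subst (asm) borel_measurable_restrict_space_iff) auto
  then have hm': "(\<lambda>s. indicator {0..} s * h s) \<in> borel_measurable borel" by simp
  have "(\<lambda>\<omega>. \<Sum>k. indicator {0..} (t - S k \<omega>) * h (t - S k \<omega>)) \<in> borel_measurable M"
    using S by (intro borel_measurable_suminf measurable_compose[OF _ hm'] borel_measurable_diff) auto
  moreover have "(\<lambda>\<omega>. \<Sum>k. indicator {0..} (t - S k \<omega>) * h (t - S k \<omega>)) = shot_noise h S t"
    unfolding shot_noise_def by (auto simp: indicator_def intro!: suminf_cong)
  ultimately show ?thesis by simp
qed

text \<open>The exceptional null set depends on the horizon; restricting to natural horizons makes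
  their union null.\<close>

lemma locally_hoelder_AE_continuous:
  assumes hoelder: "locally_hoelder_AE M \<alpha> W" and \<alpha>: "0 < \<alpha>"
  shows "AE \<omega> in M. continuous_on {0..} (\<lambda>u. W u \<omega>)"
proof -
  have "AE \<omega> in M. \<exists>K. \<forall>x\<in>{0..real (Suc n)}. \<forall>y\<in>{0..real (Suc n)}. \<bar>W x \<omega> - W y \<omega>\<bar> \<le> K * \<bar>x - y\<bar> powr \<alpha>" for n
  proof -
    obtain K where "AE \<omega> in M. \<forall>x\<in>{0..real (Suc n)}. \<forall>y\<in>{0..real (Suc n)}. \<bar>W x \<omega> - W y \<omega>\<bar> \<le> K \<omega> * \<bar>x - y\<bar> powr \<alpha>"
      using hoelder unfolding locally_hoelder_AE_def by (meson of_nat_0_less_iff zero_less_Suc)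
    then show ?thesis by eventually_elim blast
  qed
  then have "AE \<omega> in M. \<forall>n. \<exists>K. \<forall>x\<in>{0..real (Suc n)}. \<forall>y\<in>{0..real (Suc n)}. \<bar>W x \<omega> - W y \<omega>\<bar> \<le> K * \<bar>x - y\<bar> powr \<alpha>"
    unfolding AE_all_countable by blast
  then show ?thesis
  proof eventually_elim
    case (elim \<omega>)
    show ?case
      unfolding continuous_on
    proof
      fix u :: real assume u: "u \<in> {0..}"
      obtain n where "u + 1 < real n" using reals_Archimedean2 by blast
      then have n: "u + 1 < real (Suc n)" by simp
      obtain K where K: "\<And>x y. x \<in> {0..real (Suc n)} \<Longrightarrow> y \<in> {0..real (Suc n)} \<Longrightarrow> \<bar>W x \<omega> - W y \<omega>\<bar> \<le> K * \<bar>x - y\<bar> powr \<alpha>"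
        using elim by blast
      have "((\<lambda>x. K * \<bar>x - u\<bar> powr \<alpha>) \<longlongrightarrow> K * 0) (at u within {0..})"
      proof (intro tendsto_mult tendsto_const)
        have "((\<lambda>x. \<bar>x - u\<bar>) \<longlongrightarrow> \<bar>u - u\<bar>) (at u within {0..})" by (intro tendsto_intros)
        then have "((\<lambda>x. \<bar>x - u\<bar> powr \<alpha>) \<longlongrightarrow> 0 powr \<alpha>) (at u within {0..})"
          using \<alpha> by (intro tendsto_powr'[OF _ tendsto_const]) auto
        then show "((\<lambda>x. \<bar>x - u\<bar> powr \<alpha>) \<longlongrightarrow> 0) (at u within {0..})" by simp
      qed
      then have lim: "((\<lambda>x. K * \<bar>x - u\<bar> powr \<alpha>) \<longlongrightarrow> 0) (at u within {0..})" by simp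
      have "\<forall>\<^sub>F x in at u within {0..}. x \<in> {0..} \<and> x < u + 1"
        using eventually_at_topological[of "\<lambda>x. x \<in> {0..} \<and> x < u + 1" u "{0..}"]
        by (auto intro!: exI[of _ "{..<u + 1}"])
      then have "\<forall>\<^sub>F x in at u within {0..}. norm (W x \<omega> - W u \<omega>) \<le> K * \<bar>x - u\<bar> powr \<alpha>"
      proof eventually_elim
        case (elim x)
        then show ?case using K[of x u] u n by auto
      qed
      then have "((\<lambda>x. W x \<omega> - W u \<omega>) \<longlongrightarrow> 0) (at u within {0..})"
        using lim by (rule Lim_null_comparison)
      then show "((\<lambda>x. W x \<omega>) \<longlongrightarrow> W u \<omega>) (at u within {0..})" by (simp add: LIM_zero_iff)
    qed
  qed
qed

lemma gaussian_process_measurable: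
  assumes "gaussian_process M W" "0 \<le> u"
  shows "W u \<in> borel_measurable M"
proof -
  have "normal_rv M (\<lambda>\<omega>. \<Sum>v\<in>{u}. 1 * W v \<omega>)"
    using assms(1)[unfolded gaussian_process_def, rule_format, of "{u}" "\<lambda>_. 1"] assms(2) by simp
  then show ?thesis unfolding normal_rv_def by simp
qed


theorem theorem1p1:
  fixes M :: "'a measure" and M' :: "'b measure"
    and S :: "nat \<Rightarrow> 'a \<Rightarrow> real" and W :: "real \<Rightarrow> 'b \<Rightarrow> real"
    and h a b :: "real \<Rightarrow> real" and \<alpha> \<beta> \<rho> :: real
  assumes "prob_space M" and "prob_space M'"
    and "\<And>k. S k \<in> borel_measurable M" and "\<And>k. AE \<omega> in M. 0 < S k \<omega>"
    and "\<And>t. 0 \<le> t \<Longrightarrow> AE \<omega> in M. counting S t \<omega> < \<infinity>"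
    and "0 < \<alpha>"
    and "gaussian_process M' W" and "centered_process M' W"
    and "locally_hoelder_AE M' \<alpha> W" and "AE \<omega> in M'. W 0 \<omega> = 0"
    and "cadlag h" and "eventually_nondecreasing h"
    and "\<And>T. 0 \<le> T \<Longrightarrow> bounded_variation_on 0 T h"
    and "0 \<le> \<beta>" and "regularly_varying h \<beta>"
    and "\<beta> = 0 \<Longrightarrow> filterlim h at_top at_top"
    and "\<And>t. 0 \<le> t \<Longrightarrow> 0 \<le> a t" and "0 < \<rho>" and "regularly_varying a \<rho>"
    and "\<And>t. 0 \<le> t \<Longrightarrow> 0 \<le> b t" and "mono_on {0..} b"
    and "\<And>t. 0 \<le> t \<Longrightarrow> continuous (at_right t) b"
    and "converges_weakly J1_topology
           M (\<lambda>t \<omega>. \<lambda>u\<in>{0..}. (enn2real (counting S (t * u) \<omega>) - b (t * u)) / a t)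
           M' (\<lambda>\<omega>. \<lambda>u\<in>{0..}. W u \<omega>) at_top"
  shows "converges_weakly J1_topology
           M (\<lambda>t \<omega>. \<lambda>u\<in>{0..}.
                (shot_noise h S (t * u) \<omega> - stieltjes_convolution h b (t * u)) / (a t * h t))
           M' (\<lambda>\<omega>. \<lambda>u\<in>{0..}. limit_process W \<beta> u \<omega>) at_top
       \<and> (0 < \<beta> \<longrightarrow> (AE \<omega> in M'.
            ((\<lambda>u. limit_process W \<beta> u \<omega>) \<longlongrightarrow> 0) (at_right 0) \<and> limit_process W \<beta> 0 \<omega> = 0))"
proof -
  note M = assms(1,2) and S = assms(3-5) and h = assms(11-13) and \<beta> = assms(14) and h_rv = assms(15)
    and a_rv = assms(19) and b = assms(20-22) and conv = assms(23)
  define V where "V t \<omega> = (\<lambda>u\<in>{0..}. (enn2real (counting S (t * u) \<omega>) - b (t * u)) / a t)" for t \<omega>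
  define Z where "Z t \<omega> = (\<lambda>u\<in>{0..}. (shot_noise h S (t * u) \<omega> - stieltjes_convolution h b (t * u)) / (a t * h t))" for t \<omega>
  define W' where "W' \<omega> = (\<lambda>u\<in>{0..}. W u \<omega>)" for \<omega>
  define Y where "Y \<omega> = (\<lambda>u\<in>{0..}. limit_process W \<beta> u \<omega>)" for \<omega>
  \<comment> \<open>Set to 0 at 0 as well, whatever \<open>W 0 \<omega>\<close> is, so that
    vanishing for \<open>r \<le> 0\<close> holds for every \<open>\<omega>\<close>. On the almost
    sure event \<open>W 0 \<omega> = 0\<close> the path agrees with \<open>W\<close> on the
    half-line.\<close>
  define x where "x \<omega> r = (if r \<le> 0 then 0 else W r \<omega>)" for \<omega> r
  define \<mu> where "\<mu> = stieltjes_measure b"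
  have hm: "h \<in> borel_measurable (restrict_space borel {0..})" using h_rv unfolding regularly_varying_def by blast
  have h_top: "filterlim h at_top at_top"
    using assms(16) filterlim_regularly_varying_at_top[OF h_rv h(2)] \<beta> by (cases "\<beta> = 0") auto
  have h_var: "\<exists>V. partition_sum_le h T V" if "0 \<le> T" for T
    using h(3)[OF that] unfolding bounded_variation_on_def partition_sum_le_def .
  have sets_\<mu>: "sets \<mu> = sets borel" unfolding \<mu>_def stieltjes_measure_def by simp
  have em_\<mu>: "emeasure \<mu> {0..t} = (if 0 \<le> t then ennreal (b t) else 0)" for t
    unfolding \<mu>_def using emeasure_stieltjes_measure(1)[OF b, of t] by auto
  have fin_\<mu>: "emeasure \<mu> {0..t} < \<infinity>" for t unfolding em_\<mu> by simp
  have m_\<mu>: "measure \<mu> {0..t} = (if 0 \<le> t then b t else 0)" for t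
    unfolding measure_def em_\<mu> using b(1) by simp
  have conv_eq: "stieltjes_convolution h b = (\<lambda>U. LINT y:{0..U}|\<mu>. h (U - y))"
    unfolding stieltjes_convolution_def \<mu>_def by auto
  \<comment> \<open>A measurable event on which all claims about the shot noise are deterministic;
    natural times suffice because the counting process is monotone in time.\<close>
  define \<Omega> where "\<Omega> = {\<omega> \<in> space M. (\<forall>k. 0 < S k \<omega>) \<and> (\<forall>n. counting S (real n) \<omega> < \<infinity>)}"
  have \<Omega>_sets: "\<Omega> \<in> sets M"
  proof -
    note [measurable] = S(1)
    have [measurable]: "counting S t \<in> borel_measurable M" for t unfolding counting_def[abs_def] by measurable
    show ?thesis unfolding \<Omega>_def by measurable
  qed
  have \<Omega>_AE: "AE \<omega> in M. \<omega> \<in> \<Omega>"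
  proof -
    have "AE \<omega> in M. \<forall>k. 0 < S k \<omega>" "AE \<omega> in M. \<forall>n. counting S (real n) \<omega> < \<infinity>"
      unfolding AE_all_countable using S(2,3) by auto
    then show ?thesis using AE_space by eventually_elim (auto simp: \<Omega>_def)
  qed
  have fin: "finite {k. S k \<omega> \<le> t}" and N_eq: "enn2real (counting S t \<omega>) = real (card {k. S k \<omega> \<le> t})"
    if "\<omega> \<in> \<Omega>" for \<omega> t
  proof -
    obtain n where n: "t \<le> real n" using real_arch_simple by blast
    have "counting S t \<omega> \<le> counting S (real n) \<omega>"
      unfolding counting_def using n by (intro suminf_le) (auto simp: indicator_def)
    also have "\<dots> < \<infinity>" using that unfolding \<Omega>_def by blast
    finally have "counting S t \<omega> < \<infinity>" .
    from counting_eq_card[OF this]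
    show "finite {k. S k \<omega> \<le> t}" "enn2real (counting S t \<omega>) = real (card {k. S k \<omega> \<le> t})" .
  qed

  \<comment> \<open>Paths and measurability of the normalised shot noise\<close>
  have cadlag_Z: "cadlag (\<lambda>u. (shot_noise h S (t * u) \<omega> - stieltjes_convolution h b (t * u)) / (a t * h t))"
    if "\<omega> \<in> \<Omega>" "0 < t" for t \<omega>
    unfolding conv_eq
    using fin[OF that(1)] that(2)
    by (intro cadlag_divide cadlag_diff cadlag_scale[of "\<lambda>U. shot_noise h S U \<omega>"]
        cadlag_scale[of "\<lambda>U. LINT y:{0..U}|\<mu>. h (U - y)"] cadlag_shot_noise
        cadlag_convolution_integral h(1) h_var hm sets_\<mu> fin_\<mu>)
  have Z_space: "Z t \<omega> \<in> topspace J1_topology" if "1 \<le> t" "\<omega> \<in> \<Omega>" for t \<omega>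
    unfolding Z_def topspace_J1_topology using that by (intro restrict_skorokhod cadlag_Z) auto
  have Z_random: "random_element M J1_topology (Z t)" if t: "1 \<le> t" for t
    unfolding random_element_def
  proof (intro exI conjI)
    \<comment> \<open>Outside \<open>\<Omega>\<close> the path may fail to be cadlag, so the strict
      version is set to 0 there.\<close>
    let ?Z = "\<lambda>\<omega>. if \<omega> \<in> \<Omega> then Z t \<omega> else (\<lambda>u\<in>{0..}. 0)"
    show "AE \<omega> in M. Z t \<omega> = ?Z \<omega>" using \<Omega>_AE by eventually_elim simp
    show "?Z \<in> M \<rightarrow>\<^sub>M borel_of J1_topology"
    proof (rule measurable_J1)
      fix u :: real assume "0 \<le> u"
      then have "(\<lambda>\<omega>. ?Z \<omega> u) = (\<lambda>\<omega>. if \<omega> \<in> \<Omega> then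
          (shot_noise h S (t * u) \<omega> - stieltjes_convolution h b (t * u)) / (a t * h t) else 0)"
        unfolding Z_def by auto
      also have "\<dots> \<in> borel_measurable M"
        using \<Omega>_sets borel_measurable_shot_noise[OF hm S(1)]
        by (intro measurable_If_set borel_measurable_divide borel_measurable_diff) auto
      finally show "(\<lambda>\<omega>. ?Z \<omega> u) \<in> borel_measurable M" .
    next
      fix \<omega>
      show "?Z \<omega> \<in> skorokhod_space"
        using Z_space[OF t, of \<omega>] restrict_skorokhod[OF cadlag_continuous_on[of "\<lambda>_. 0"]] by auto
    qed
  qed

  \<comment> \<open>Paths and measurability of the limit process\<close>
  have W_good: "AE \<omega> in M'. continuous_on {0..} (\<lambda>u. W u \<omega>) \<and> W 0 \<omega> = 0"
    using locally_hoelder_AE_continuous[OF assms(9,6)] assms(10) by eventually_elim simp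
  have x_eq: "x \<omega> u = W u \<omega>" if "W 0 \<omega> = 0" "0 \<le> u" for \<omega> u
    unfolding x_def using that by (cases "u = 0") auto
  have x_cont: "continuous_on UNIV (x \<omega>)" if "continuous_on {0..} (\<lambda>u. W u \<omega>)" "W 0 \<omega> = 0" for \<omega>
  proof -
    have "continuous_on ({..0} \<union> {0..}) (\<lambda>r. if r \<le> 0 then 0 else W r \<omega>)"
      using that by (intro continuous_on_If) auto
    moreover have "{..0} \<union> {0..} = (UNIV :: real set)" by auto
    ultimately show ?thesis unfolding x_def[abs_def] by simp
  qed
  have x_neg: "x \<omega> r = 0" if "r \<le> 0" for \<omega> r unfolding x_def using that by simp
  have limit_integral_eq: "limit_integral W \<beta> u \<omega> = fractional_integral \<beta> (x \<omega>) u"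
    if "W 0 \<omega> = 0" "\<beta> \<noteq> 0" for u \<omega>
    unfolding limit_integral_def fractional_integral_def using that x_eq[OF that(1)]
    by (auto intro!: set_lebesgue_integral_cong)
  have limit_integral_tendsto: "((\<lambda>u. limit_integral W \<beta> u \<omega>) \<longlongrightarrow> 0) (at_right 0)"
    if "continuous_on {0..} (\<lambda>u. W u \<omega>)" "W 0 \<omega> = 0" "\<beta> \<noteq> 0" for \<omega>
  proof -
    have "cadlag (fractional_integral \<beta> (x \<omega>))"
      using x_neg by (intro cadlag_continuous_on fractional_integral_continuous \<beta> x_cont that) auto
    then have "(fractional_integral \<beta> (x \<omega>) \<longlongrightarrow> fractional_integral \<beta> (x \<omega>) 0) (at_right 0)"
      unfolding cadlag_def continuous_within by blast
    then show ?thesis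
      using limit_integral_eq[OF that(2,3)] fractional_integral_0[of "x \<omega>" \<beta>] x_neg by simp
  qed
  have limit_eq: "limit_process W \<beta> u \<omega> = fractional_integral \<beta> (x \<omega>) u"
    if good: "continuous_on {0..} (\<lambda>u. W u \<omega>)" "W 0 \<omega> = 0" and u: "0 \<le> u" for u \<omega>
  proof (cases "\<beta> = 0")
    case True
    then show ?thesis unfolding limit_process_def fractional_integral_def using x_eq[OF good(2) u] by simp
  next
    case False
    have "Lim (at_right 0) (\<lambda>v. limit_integral W \<beta> v \<omega>) = 0"
      by (rule tendsto_Lim[OF _ limit_integral_tendsto[OF good False]]) simp
    then show ?thesis
      unfolding limit_process_def
      using limit_integral_eq[OF good(2) False] u False fractional_integral_0[of "x \<omega>" \<beta>] x_neg by simp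
  qed
  have Y_random: "random_element M' J1_topology Y"
  proof -
    \<comment> \<open>Continuity of a path is an uncountable condition and its event need not be
      measurable, so paths are set to 0 on a null set covering the exceptions.\<close>
    obtain N where N: "{\<omega> \<in> space M'. \<not> (continuous_on {0..} (\<lambda>u. W u \<omega>) \<and> W 0 \<omega> = 0)} \<subseteq> N"
      "N \<in> null_sets M'"
      using W_good unfolding eventually_ae_filter by auto
    define x' where "x' \<omega> r = (if \<omega> \<in> N then 0 else x \<omega> r)" for \<omega> r
    have x'_cont: "continuous_on UNIV (x' \<omega>)" if "\<omega> \<in> space M'" for \<omega>
    proof (cases "\<omega> \<in> N")
      case False
      then have "continuous_on UNIV (x \<omega>)" using N(1) that by (intro x_cont) auto
      then show ?thesis using False unfolding x'_def by simp
    qed (simp add: x'_def)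
    have x'_neg: "x' \<omega> r = 0" if "r \<le> 0" for \<omega> r unfolding x'_def using x_neg that by simp
    have x'_meas: "(\<lambda>\<omega>. x' \<omega> r) \<in> borel_measurable M'" for r
    proof -
      have "(\<lambda>\<omega>. x \<omega> r) \<in> borel_measurable M'"
        unfolding x_def using gaussian_process_measurable[OF assms(7), of r] by (cases "r \<le> 0") auto
      then show ?thesis unfolding x'_def using N(2) by (intro measurable_If_set) auto
    qed
    let ?Y = "\<lambda>\<omega>. \<lambda>u\<in>{0..}. fractional_integral \<beta> (x' \<omega>) u"
    have "?Y \<in> M' \<rightarrow>\<^sub>M borel_of J1_topology"
    proof (rule measurable_J1)
      fix u :: real assume u: "0 \<le> u"
      let ?S = "\<lambda>n \<omega>. \<Sum>j<Suc n. ((real (Suc j) * ((u + 1) / real (Suc n))) powr \<beta> - (real j * ((u + 1) / real (Suc n))) powr \<beta>) *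
        x' \<omega> (u - real j * ((u + 1) / real (Suc n)))"
      have "(\<lambda>\<omega>. fractional_integral \<beta> (x' \<omega>) u) \<in> borel_measurable M'"
      proof (rule borel_measurable_LIMSEQ_real)
        fix \<omega> assume "\<omega> \<in> space M'"
        then show "(\<lambda>n. ?S n \<omega>) \<longlonglongrightarrow> fractional_integral \<beta> (x' \<omega>) u"
          using u by (intro tendsto_uniform_limitI[OF
              fractional_integral_uniform_limit[OF \<beta> x'_cont x'_neg, of \<omega> "u + 1"]]) auto
      qed (intro borel_measurable_sum borel_measurable_times x'_meas borel_measurable_const)
      then show "(\<lambda>\<omega>. ?Y \<omega> u) \<in> borel_measurable M'" using u by simp
    next
      fix \<omega> assume "\<omega> \<in> space M'"
      then show "?Y \<omega> \<in> skorokhod_space"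
        by (intro restrict_skorokhod cadlag_continuous_on fractional_integral_continuous \<beta> x'_cont x'_neg)
    qed
    moreover have "AE \<omega> in M'. Y \<omega> = ?Y \<omega>"
      using W_good AE_not_in[OF N(2)]
    proof eventually_elim
      case (elim \<omega>)
      then have "x' \<omega> = x \<omega>" unfolding x'_def by auto
      then show ?case unfolding Y_def using limit_eq elim(1) by auto
    qed
    ultimately show ?thesis unfolding random_element_def by blast
  qed

  \<comment> \<open>From closeness of the counting paths to the conclusion\<close>
  have a_pos: "\<forall>\<^sub>F t in at_top. 0 < a t" using a_rv unfolding regularly_varying_def by blast
  have near: "AE \<omega>' in M'. \<forall>U. openin J1_topology U \<and> Y \<omega>' \<in> U \<longrightarrow>
      (\<exists>\<eta>>0. \<forall>\<^sub>F t in at_top. \<forall>\<omega>\<in>\<Omega>. graph_dist (W' \<omega>') (V t \<omega>) < \<eta> \<longrightarrow> Z t \<omega> \<in> U)"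
    using W_good
  proof eventually_elim
    case good: (elim \<omega>')
    show ?case
    proof (intro allI impI)
      fix U assume U: "openin J1_topology U \<and> Y \<omega>' \<in> U"
      then obtain T e where Te: "0 < T" "0 < e" "J1_nbhd (Y \<omega>') T e \<subseteq> U"
        unfolding openin_J1_topology by blast
      have "\<exists>\<eta>>0. \<forall>\<^sub>F t in at_top. \<forall>I D A. summation_by_parts h I D \<longrightarrow> (\<forall>y<0. D y = 0) \<longrightarrow> 0 < A \<longrightarrow>
          (\<forall>v\<in>{0..T}. \<bar>D (t * v) / A - x \<omega>' v\<bar> \<le> \<eta>) \<longrightarrow>
          (\<forall>u\<in>{0..T}. \<bar>I (t * u) / (A * h t) - fractional_integral \<beta> (x \<omega>') u\<bar> \<le> e / 2)"
        using Te good
        by (intro rescaled_integral_close[OF h(2,3) h_rv h_top]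
            fractional_integral_riemann_sum[OF \<beta>] x_cont x_neg) auto
      then obtain \<eta> where \<eta>: "0 < \<eta>" and ev: "\<forall>\<^sub>F t in at_top. \<forall>I D A. summation_by_parts h I D \<longrightarrow>
          (\<forall>y<0. D y = 0) \<longrightarrow> 0 < A \<longrightarrow> (\<forall>v\<in>{0..T}. \<bar>D (t * v) / A - x \<omega>' v\<bar> \<le> \<eta>) \<longrightarrow>
          (\<forall>u\<in>{0..T}. \<bar>I (t * u) / (A * h t) - fractional_integral \<beta> (x \<omega>') u\<bar> \<le> e / 2)"
        by blast
      have "continuous_on {0..} (W' \<omega>')"
        using good unfolding W'_def by (subst continuous_on_cong[OF refl, of _ _ "\<lambda>u. W u \<omega>'"]) auto
      then obtain \<kappa> where \<kappa>: "0 < \<kappa>" "\<And>y. graph_dist (W' \<omega>') y < \<kappa> \<Longrightarrow> \<forall>t\<in>{0..T}. \<bar>y t - W' \<omega>' t\<bar> < \<eta>"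
        using graph_dist_imp_uniform[of "W' \<omega>'" T \<eta>] Te(1) \<eta> by auto
      have "\<forall>\<^sub>F t in at_top. \<forall>\<omega>\<in>\<Omega>. graph_dist (W' \<omega>') (V t \<omega>) < \<kappa> \<longrightarrow> Z t \<omega> \<in> U"
        using ev a_pos eventually_ge_at_top[of 1]
      proof eventually_elim
        case (elim t)
        show ?case
        proof (intro ballI impI)
          fix \<omega> assume \<omega>: "\<omega> \<in> \<Omega>" and close: "graph_dist (W' \<omega>') (V t \<omega>) < \<kappa>"
          \<comment> \<open>The centred counting function and the centred shot noise. By
            \<open>m_\<mu>\<close>, \<open>measure \<mu> {0..y}\<close> is \<open>b y\<close> for
            \<open>y \<ge> 0\<close> and 0 for negative \<open>y\<close>, so \<open>D\<close>
            vanishes below 0 as the estimate demands.\<close>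
          define D where "D y = real (card {k. S k \<omega> \<le> y}) - measure \<mu> {0..y}" for y
          define I where "I U = shot_noise h S U \<omega> - stieltjes_convolution h b U" for U
          have S_pos: "0 < S k \<omega>" for k using \<omega> unfolding \<Omega>_def by blast
          have "summation_by_parts h (\<lambda>U. (\<Sum>k | S k \<omega> \<le> U. h (U - S k \<omega>)) - (LINT y:{0..U}|\<mu>. h (U - y))) D"
            unfolding D_def[abs_def] using fin[OF \<omega>] S_pos
            by (intro summation_by_parts_diff summation_by_parts_sum summation_by_parts_integral h(1) h_var sets_\<mu> fin_\<mu>)
              (auto intro: less_imp_le)
          then have parts: "summation_by_parts h I D"
            unfolding I_def[abs_def] conv_eq using shot_noise_eq_sum[of S \<omega> _ h, OF fin[OF \<omega>]] by simp
          have D_neg: "\<forall>y<0. D y = 0"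
          proof (intro allI impI)
            fix y :: real assume "y < 0"
            then have "{k. S k \<omega> \<le> y} = {}" using S_pos by (auto simp: not_le intro: less_trans)
            then show "D y = 0" unfolding D_def m_\<mu> using \<open>y < 0\<close> by simp
          qed
          have V_eq: "V t \<omega> v = D (t * v) / a t" if "0 \<le> v" for v
            unfolding V_def D_def m_\<mu> N_eq[OF \<omega>] using that elim(3) by simp
          have "\<bar>D (t * v) / a t - x \<omega>' v\<bar> \<le> \<eta>" if v: "v \<in> {0..T}" for v
          proof -
            have "\<bar>V t \<omega> v - W' \<omega>' v\<bar> < \<eta>" using \<kappa>(2)[OF close] v by blast
            then show ?thesis using v V_eq[of v] x_eq[of \<omega>' v] good unfolding W'_def by simp
          qed
          then have bound: "\<forall>u\<in>{0..T}. \<bar>I (t * u) / (a t * h t) - fractional_integral \<beta> (x \<omega>') u\<bar> \<le> e / 2"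
            using elim parts D_neg by blast
          \<comment> \<open>The estimate is uniform on \<open>[0, T]\<close>, so the identity serves
            as time change; \<open>e / 2\<close> provides the bound strictly below
            \<open>e\<close>.\<close>
          have "Z t \<omega> \<in> J1_nbhd (Y \<omega>') T e"
            unfolding J1_nbhd_def
          proof (intro CollectI conjI exI[of _ "\<lambda>t. t"] exI[of _ "e / 2"] ballI allI impI)
            show "Z t \<omega> \<in> skorokhod_space" using Z_space[OF elim(3) \<omega>] by simp
            fix u assume u: "u \<in> {0..T}"
            then have "Z t \<omega> u - Y \<omega>' u = I (t * u) / (a t * h t) - fractional_integral \<beta> (x \<omega>') u"
              unfolding Z_def Y_def I_def using limit_eq good by simp
            then show "\<bar>Z t \<omega> u - Y \<omega>' u\<bar> \<le> e / 2" using bound u by simp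
          qed (use Te(2) time_change_id in auto)
          then show "Z t \<omega> \<in> U" using Te(3) by blast
        qed
      qed
      then show "\<exists>\<eta>>0. \<forall>\<^sub>F t in at_top. \<forall>\<omega>\<in>\<Omega>. graph_dist (W' \<omega>') (V t \<omega>) < \<eta> \<longrightarrow> Z t \<omega> \<in> U"
        using \<kappa>(1) by blast
    qed
  qed
  have "converges_weakly J1_topology M Z M' Y at_top"
  proof (rule converges_weakly_transfer[where d = graph_dist and T = J1_topology and T' = J1_topology
        and V = V and W = W' and Z = Z and Y = Y and \<Omega> = \<Omega> and t\<^sub>0 = 1,
        OF M graph_dist_pseudometric graph_dist_J1_continuous _ _ Y_random
          \<Omega>_AE Z_space near])
    show "converges_weakly J1_topology M V M' W' at_top"
      using conv unfolding V_def[abs_def] W'_def[abs_def] .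
    show "\<forall>\<^sub>F t in at_top. random_element M J1_topology (Z t)"
      using eventually_ge_at_top[of 1] by eventually_elim (rule Z_random)
  qed
  moreover have "AE \<omega> in M'. ((\<lambda>u. limit_process W \<beta> u \<omega>) \<longlongrightarrow> 0) (at_right 0) \<and> limit_process W \<beta> 0 \<omega> = 0" if "0 < \<beta>"
    using W_good
  proof eventually_elim
    case (elim \<omega>)
    then have lim: "((\<lambda>u. limit_integral W \<beta> u \<omega>) \<longlongrightarrow> 0) (at_right 0)"
      using that by (intro limit_integral_tendsto) auto
    have "\<forall>\<^sub>F u in at_right 0. limit_integral W \<beta> u \<omega> = limit_process W \<beta> u \<omega>"
      unfolding eventually_at_right_field limit_process_def using that by (intro exI[of _ 1]) auto
    with lim have "((\<lambda>u. limit_process W \<beta> u \<omega>) \<longlongrightarrow> 0) (at_right 0)" by (simp add: tendsto_cong)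
    moreover have "limit_process W \<beta> 0 \<omega> = 0"
      using limit_eq[of \<omega> 0] elim fractional_integral_0[of "x \<omega>" \<beta>] x_neg by simp
    ultimately show ?case by blast
  qed
  ultimately show ?thesis unfolding Z_def[abs_def] Y_def[abs_def] by blast
qed

end
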